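(* Let $p>1$ and $\alpha>1$. Let $u$ be a smooth, rapidly decaying axisymmetric solution of the three-dimensional incompressible Navier--Stokes equations with viscosity $\nu>0$ on $\mathbb R^3\times I$, with $I$ an open time interval, and set $F=u^\theta/r$, $U=u^r/r$, $H=|F|^{p/2}$ and $Z_{\alpha,p}(t)=\int |F|^p\,d\mu_\alpha$. Then for all $t\in I$ $$\frac1p\frac{d}{dt}Z_{\alpha,p}+\nu\frac{4(p-1)}{p^2}\int|\nabla H|^2\,d\mu_\alpha+\nu\frac{(3-\alpha)(\alpha-1)}p\int H^2r^{\alpha-2}\,dr\,dz=\frac{\alpha-(2p+1)}p\int U|F|^p\,d\mu_\alpha .$$ In particular, $\alpha=2p+1$ is the unique exponent for which the radial-strain term on the right-hand side cancels, i.e. its coefficient $\frac{\alpha-(2p+1)}{p}$ vanishes.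
   Context: Cylindrical coordinates $(r,\theta,z)$ on $\mathbb R^3$. An axisymmetric velocity field is $u=u^r(r,z,t)e_r+u^\theta(r,z,t)e_\theta+u^z(r,z,t)e_z$. All integrals are over $(r,z)\in(0,\infty)\times\mathbb R$ (the angular factor $2\pi$ is dropped), $d\mu_\alpha=r^\alpha\,dr\,dz$, and $\nabla=(\partial_r,\partial_z)$. ``Smooth rapidly decaying'' means that $u$ is smooth as a Cartesian vector field, including across the axis, and that $u$ and its derivatives decay faster than any power of $|x|$, locally uniformly in $t$. Incompressibility reads $\partial_ru^r+\frac{u^r}{r}+\partial_zu^z=0$. With $\Delta_5=\partial_{rr}+\frac3r\partial_r+\partial_{zz}$, the function $F$ satisfies $$F_t+u^rF_r+u^zF_z=\nu\Delta_5F-2UF .$$ At the axis, $F$ extends smoothly and is $O(1)$ (the Cartesian pole conditions). For $1<p<2$, $\nabla|F|^{p/2}$ is understood almost everywhere / in the Sobolev sense, so that $\frac{4}{p^2}|\nabla |F|^{p/2}|^2=|F|^{p-2}|\nabla F|^2$ a.e. *)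

theory Defs
  imports "HOL-Analysis.Analysis"
begin

text \<open>Intended for open \<open>S\<close>: derivatives are taken in the ambient space.\<close>

primrec C_on :: "nat \<Rightarrow> 'a::real_normed_vector set \<Rightarrow> ('a \<Rightarrow> 'b::real_normed_vector) \<Rightarrow> bool" where
  "C_on 0 S f \<longleftrightarrow> continuous_on S f"
| "C_on (Suc k) S f \<longleftrightarrow>
     (\<forall>x\<in>S. f differentiable (at x)) \<and>
     (\<forall>v. C_on k S (\<lambda>x. frechet_derivative f (at x) v))"

definition smooth_on :: "'a::real_normed_vector set \<Rightarrow> ('a \<Rightarrow> 'b::real_normed_vector) \<Rightarrow> bool" where
  "smooth_on S f \<longleftrightarrow> (\<forall>k. C_on k S f)"

definition pd :: "3 \<Rightarrow> (real^3 \<Rightarrow> 'b::real_normed_vector) \<Rightarrow> real^3 \<Rightarrow> 'b" where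
  "pd j g x = frechet_derivative g (at x) (axis j 1)"

primrec pds :: "3 list \<Rightarrow> (real^3 \<Rightarrow> 'b::real_normed_vector) \<Rightarrow> real^3 \<Rightarrow> 'b" where
  "pds [] g = g"
| "pds (j # js) g = pd j (pds js g)"

text \<open>Decay is required of \<open>u\<close> and of all its spatial derivatives; no decay of time derivatives is
  assumed. The constant is uniform for \<open>t\<close> in compact subsets of \<open>I\<close>.\<close>

definition rapidly_decaying :: "real set \<Rightarrow> (real \<Rightarrow> real^3 \<Rightarrow> real^3) \<Rightarrow> bool" where
  "rapidly_decaying I u \<longleftrightarrow>
     (\<forall>js N K. compact K \<and> K \<subseteq> I \<longrightarrow>
        (\<exists>C. \<forall>t\<in>K. \<forall>x. norm x ^ N * norm (pds js (u t) x) \<le> C))"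

text \<open>Smooth velocity \<open>u\<close> with smooth pressure \<open>q\<close> solving the incompressible Navier--Stokes
  equations on \<open>\<real>\<^sup>3 \<times> I\<close>, in Cartesian coordinates.\<close>

definition smooth_NS_solution ::
    "real \<Rightarrow> real set \<Rightarrow> (real \<Rightarrow> real^3 \<Rightarrow> real^3) \<Rightarrow> (real \<Rightarrow> real^3 \<Rightarrow> real) \<Rightarrow> bool" where
  "smooth_NS_solution \<nu> I u q \<longleftrightarrow>
     smooth_on (I \<times> UNIV) (\<lambda>(t, x). u t x) \<and>
     smooth_on (I \<times> UNIV) (\<lambda>(t, x). q t x) \<and>
     (\<forall>t\<in>I. \<forall>x.
        vector_derivative (\<lambda>s. u s x) (at t) + (\<Sum>j\<in>UNIV. (u t x $ j) *\<^sub>R pd j (u t) x)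
          = - (\<chi> i. pd i (q t) x) + \<nu> *\<^sub>R (\<Sum>j\<in>UNIV. pd j (pd j (u t)) x)) \<and>
     (\<forall>t\<in>I. \<forall>x. (\<Sum>j\<in>UNIV. pd j (u t) x $ j) = 0)"

definition cyl :: "real \<Rightarrow> real \<Rightarrow> real \<Rightarrow> real^3" where
  "cyl r \<theta> z = vector [r * cos \<theta>, r * sin \<theta>, z]"

definition e_r :: "real \<Rightarrow> real^3" where
  "e_r \<theta> = vector [cos \<theta>, sin \<theta>, 0]"

definition e_theta :: "real \<Rightarrow> real^3" where
  "e_theta \<theta> = vector [- sin \<theta>, cos \<theta>, 0]"

definition e_z :: "real^3" where
  "e_z = vector [0, 0, 1]"

text \<open>The component functions take their arguments in the order \<open>r z t\<close>; they are determined by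
  \<open>u\<close> for \<open>r > 0\<close>, and their values for \<open>r \<le> 0\<close> play no role.\<close>

definition axisymmetric_with ::
    "real set \<Rightarrow> (real \<Rightarrow> real^3 \<Rightarrow> real^3) \<Rightarrow> (real \<Rightarrow> real \<Rightarrow> real \<Rightarrow> real) \<Rightarrow>
     (real \<Rightarrow> real \<Rightarrow> real \<Rightarrow> real) \<Rightarrow> (real \<Rightarrow> real \<Rightarrow> real \<Rightarrow> real) \<Rightarrow> bool" where
  "axisymmetric_with I u ur ut uz \<longleftrightarrow>
     (\<forall>t\<in>I. \<forall>r>0. \<forall>\<theta> z.
        u t (cyl r \<theta> z) = ur r z t *\<^sub>R e_r \<theta> + ut r z t *\<^sub>R e_theta \<theta> + uz r z t *\<^sub>R e_z)"

definition halfplane :: "(real \<times> real) set" where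
  "halfplane = {0<..} \<times> UNIV"

definition mu :: "real \<Rightarrow> (real \<times> real) measure" where
  "mu \<alpha> = density (lebesgue_on halfplane) (\<lambda>(r, z). ennreal (r powr \<alpha>))"

text \<open>Classical gradient in \<open>(r, z)\<close>. It is only meaningful where the partial derivatives exist;
  for \<open>|F| powr (p / 2)\<close> with \<open>p \<le> 2\<close> this is almost everywhere.\<close>

definition grad :: "(real \<Rightarrow> real \<Rightarrow> real) \<Rightarrow> real \<times> real \<Rightarrow> real \<times> real" where
  "grad h = (\<lambda>(r, z). (deriv (\<lambda>s. h s z) r, deriv (\<lambda>s. h r s) z))"

definition Z :: "real \<Rightarrow> real \<Rightarrow> (real \<Rightarrow> real \<Rightarrow> real \<Rightarrow> real) \<Rightarrow> real \<Rightarrow> real" where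
  "Z \<alpha> p F t = (\<integral>(r, z). \<bar>F r z t\<bar> powr p \<partial>mu \<alpha>)"

end

theory Submission
  imports Defs
begin

text \<open>
  The identity is the $L^p$ energy estimate for the swirl quotient $F = u^\theta / r$. Multiply
  $F_t + u^r F_r + u^z F_z = \nu \Delta_5 F - 2 U F$ by $|F|^{p-2} F\, r^\alpha$ and integrate by parts.
  Incompressibility turns the transport term on the left into $-\frac{\alpha-1}{p} \int U |F|^p$, the mismatch
  between $r^\alpha$ and the weight $r^3$ natural for $\Delta_5$ produces the term with
  $(3-\alpha)(\alpha-1)$, and the stretching term contributes $-2 \int U |F|^p$ on the right. All boundary terms
  vanish: at the axis because $F$ and its derivatives are bounded and $\alpha > 1$, at infinity by
  decay.

  For $p < 2$ the function $|F|^{p-2} F$ need not be differentiable at the zeros of $F$, and even the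
  integrability of $|F|^{p-2} |\nabla F|^2$ is part of the claim. Both are handled along lines: on each
  line parallel to a coordinate axis, the derivative of $|F|^{p-2} F\, \partial F$ is given by the
  formal product rule at every point except the simple zeros of $F$ along that line. Simple zeros
  are isolated, so they are countably many, and the fundamental theorem of calculus tolerates a
  countable exceptional set (\<open>has_integral_derivative_countable_exceptions\<close>). As the
  dissipation is nonnegative and all other terms are absolutely integrable, monotone
  convergence on each line and Fubini's theorem give its integrability and its value at once
  (\<open>radial_integration_by_parts\<close>, \<open>axial_integration_by_parts\<close>,
  \<open>energy_identity\<close>). The same countability shows that the simple zeros are a null set, off
  which $|F|^{p/2}$ is differentiable (\<open>AE_not_degenerate\<close>,
  \<open>gradient_of_abs_powr_half\<close>).

  The equation for $F$ is extracted from the Cartesian equations on the half-plane $\theta = 0$.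
  Nothing is assumed about symmetry or decay of the pressure; but its gradient is the remainder
  of an equation whose other terms commute with rotations about the axis, so the azimuthal
  pressure force is constant along each circle, and it vanishes because the pressure is
  single-valued (\<open>no_azimuthal_pressure_force\<close>). At the
  axis the swirl vanishes, and together with the smoothness of the velocity this bounds $F$ and
  its derivatives up to second order (\<open>decays_quotient\<close>). Since the pressure has dropped out, $F_t$ is a
  combination of decaying spatial terms, locally uniformly in time, and the integral may be
  differentiated by dominated convergence (\<open>weighted_integral_has_real_derivative\<close>).
\<close>

section \<open>The fundamental theorem of calculus with countably many exceptions\<close>

text \<open>The gauge proof of the fundamental theorem works at every tag where the derivative exists. At
  the \<open>n\<close>-th exceptional point continuity alone makes the increment of \<open>f\<close> over a small interval at
  most a multiple of $2^{-n}$; to sum these errors, each is charged to the increment of one fixed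
  bounded increasing function \<open>W\<close> that jumps by at least $2^{-n}$ there, and these increments telescope.\<close>

lemma has_integral_derivative_countable_exceptions:
  fixes f :: "real \<Rightarrow> 'a::banach"
  assumes "a \<le> b" and cont: "continuous_on {a..b} f" and S: "countable S"
    and deriv: "\<And>x. x \<in> {a..b} - S \<Longrightarrow> (f has_vector_derivative f' x) (at x within {a..b})"
  shows "(f' has_integral (f b - f a)) {a..b}"
proof -
  define g where "g = (\<lambda>x. if x \<in> S then 0 else f' x)"
  define s where "s = from_nat_into S"
  \<comment> \<open>The two summands make \<open>W\<close> jump on both sides of each exceptional point, so that an interval having that point as an endpoint is charged too.\<close>
  define w where "w = (\<lambda>n y. (1/2::real)^n * (of_bool (s n \<le> y) + of_bool (s n < y)))"
  define W where "W = (\<lambda>y. \<Sum>n. w n y)"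
  have w_le: "norm (w n y) \<le> 2 * (1/2)^n" for n y
    by (auto simp: w_def)
  have summ: "summable (\<lambda>n. w n y)" for y
    by (rule summable_comparison_test'[OF _ w_le]) (auto intro!: summable_mult summable_geometric)
  have w_mono: "w n u \<le> w n v" if "u \<le> v" for n u v
    using that by (auto simp: w_def)
  have W_mono: "W u \<le> W v" if "u \<le> v" for u v
    unfolding W_def by (intro suminf_le w_mono summ that)
  have W_jump: "(1/2)^n \<le> W v - W u" if "u \<le> s n" "s n \<le> v" "u < v" for n u v
  proof -
    have eq: "W v - W u = (\<Sum>m. w m v - w m u)"
      unfolding W_def by (rule suminf_diff[OF summ summ])
    have "(1/2)^n \<le> w n v - w n u"
      using that by (auto simp: w_def algebra_simps)
    also have "\<dots> \<le> (\<Sum>m. w m v - w m u)"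
      using sum_le_suminf[OF summable_diff[OF summ summ], of "{n}" v u] w_mono[of u v] that
      by simp
    finally show ?thesis unfolding eq .
  qed
  have "(g has_integral (f b - f a)) (cbox a b)"
    unfolding has_integral[of g]
  proof (intro allI impI)
    fix e0 :: real assume "e0 > 0"
    define e where "e = e0 / (2 * (b - a + (W b - W a) + 1))"
    have den: "b - a + (W b - W a) + 1 > 0"
      using \<open>a \<le> b\<close> W_mono[of a b] by linarith
    have "e > 0" unfolding e_def using den \<open>e0 > 0\<close> by simp
    have "\<exists>d>0. (x \<in> {a..b} - S \<longrightarrow>
         (\<forall>y\<in>{a..b}. norm (y-x) < d \<longrightarrow> norm (f y - f x - (y-x) *\<^sub>R f' x) \<le> e * norm (y-x)))
       \<and> (\<forall>n. x \<in> {a..b} \<longrightarrow> x \<in> S \<longrightarrow> n = to_nat_on S x \<longrightarrow>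
         (\<forall>y\<in>{a..b}. norm (y-x) < d \<longrightarrow> norm (f y - f x) \<le> e * (1/2)^n / 2))" for x
    proof (cases "x \<in> {a..b}")
      case True
      show ?thesis
      proof (cases "x \<in> S")
        case False
        then show ?thesis
          using deriv[unfolded has_vector_derivative_def has_derivative_within_alt] True \<open>e > 0\<close>
          by blast
      next
        case xS: True
        have "e * (1/2)^(to_nat_on S x) / 2 > 0" using \<open>e > 0\<close> by simp
        then obtain d where "d > 0" "\<forall>y\<in>{a..b}. dist y x < d \<longrightarrow> dist (f y) (f x) < e * (1/2)^(to_nat_on S x) / 2"
          using cont[unfolded continuous_on_iff] True by meson
        then show ?thesis using xS by (intro exI[of _ d]) (auto simp: dist_norm less_imp_le)
      qed
    qed (auto intro: exI[of _ 1])
    then obtain d where d0: "\<And>x. 0 < d x"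
      and d1: "\<And>x y. \<lbrakk>x \<in> {a..b} - S; y \<in> {a..b}; norm (y-x) < d x\<rbrakk>
                  \<Longrightarrow> norm (f y - f x - (y-x) *\<^sub>R f' x) \<le> e * norm (y-x)"
      and d2: "\<And>x y. \<lbrakk>x \<in> {a..b}; x \<in> S; y \<in> {a..b}; norm (y-x) < d x\<rbrakk>
                  \<Longrightarrow> norm (f y - f x) \<le> e * (1/2)^(to_nat_on S x) / 2"
      by metis
    show "\<exists>\<gamma>. gauge \<gamma> \<and> (\<forall>p. p tagged_division_of cbox a b \<and> \<gamma> fine p \<longrightarrow>
            norm ((\<Sum>(x,K)\<in>p. measure lborel K *\<^sub>R g x) - (f b - f a)) < e0)"
    proof (intro exI conjI allI impI; (elim conjE)?)
      show "gauge (\<lambda>x. ball x (d x))"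
        using d0 gauge_ball_dependent by blast
    next
      fix p
      assume ptag: "p tagged_division_of cbox a b" and finep: "(\<lambda>x. ball x (d x)) fine p"
      have tele: "h b - h a = (\<Sum>(x,K)\<in>p. h (Sup K) - h (Inf K))" for h :: "real \<Rightarrow> 'b::real_normed_vector"
        using additive_tagged_division_1[where f=h] \<open>a \<le> b\<close> ptag by auto
      have "norm (\<Sum>(x, K) \<in> p. measure lborel K *\<^sub>R g x - (f (Sup K) - f (Inf K)))
          \<le> (\<Sum>(x, K)\<in>p. e * ((Sup K - Inf K) + (W (Sup K) - W (Inf K))))"
      proof (rule sum_norm_le, safe)
        fix x K
        assume xK: "(x, K) \<in> p"
        then obtain u v where k: "K = cbox u v" and "x \<in> K" and kab: "K \<subseteq> cbox a b"
          using ptag by (metis tagged_division_ofD(2,3,4))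
        then have uxv: "u \<le> x" "x \<le> v" and "u \<le> v" by auto
        have ball: "\<forall>y\<in>K. y \<in> ball x (d x)"
          using finep xK by blast
        have mem: "x \<in> {a..b}" "u \<in> {a..b}" "v \<in> {a..b}"
          using kab k uxv by auto
        have near: "norm (u - x) < d x" "norm (v - x) < d x"
          using bspec[OF ball, of u] bspec[OF ball, of v] k uxv \<open>u \<le> v\<close> by (auto simp: dist_real_def)
        have "norm ((v - u) *\<^sub>R g x - (f v - f u)) \<le> e * ((v - u) + (W v - W u))"
        proof (cases "x \<in> S")
          case False
          have "norm ((v - u) *\<^sub>R f' x - (f v - f u)) = norm (f u - f x - (u - x) *\<^sub>R f' x - (f v - f x - (v - x) *\<^sub>R f' x))"
            by (auto simp: algebra_simps)
          also have "\<dots> \<le> norm (f u - f x - (u - x) *\<^sub>R f' x) + norm (f v - f x - (v - x) *\<^sub>R f' x)"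
            by (rule norm_triangle_ineq4)
          also have "\<dots> \<le> e * norm (u - x) + e * norm (v - x)"
            using d1 mem near False by (intro add_mono) auto
          also have "\<dots> = e * (v - u)" using uxv by (simp add: algebra_simps)
          also have "\<dots> \<le> e * ((v - u) + (W v - W u))"
            using \<open>e > 0\<close> W_mono[OF \<open>u \<le> v\<close>] by simp
          finally show ?thesis using False by (simp add: g_def)
        next
          case True
          show ?thesis
          proof (cases "u = v")
            case False
            define n where "n = to_nat_on S x"
            have sn: "s n = x" unfolding s_def n_def using S True by simp
            have "norm (f v - f u) \<le> norm (f v - f x) + norm (f u - f x)"
              using norm_triangle_ineq4[of "f v - f x" "f u - f x"] by simp
            also have "\<dots> \<le> e * (1/2)^n / 2 + e * (1/2)^n / 2"
              using d2 mem near True by (intro add_mono) (auto simp: n_def)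
            also have "\<dots> = e * (1/2)^n" by simp
            also have "\<dots> \<le> e * ((v - u) + (W v - W u))"
            proof -
              have "(1/2)^n \<le> W v - W u" using W_jump[of u n v] uxv False sn by simp
              also have "\<dots> \<le> (v - u) + (W v - W u)" using \<open>u \<le> v\<close> by simp
              finally show ?thesis using \<open>e > 0\<close> by (intro mult_left_mono) auto
            qed
            finally show ?thesis using True by (simp add: g_def norm_minus_commute)
          qed auto
        qed
        then show "norm (measure lborel K *\<^sub>R g x - (f (Sup K) - f (Inf K)))
             \<le> e * ((Sup K - Inf K) + (W (Sup K) - W (Inf K)))"
          unfolding k using \<open>u \<le> v\<close> by (simp add: content_real)
      qed
      also have "\<dots> = e * ((b - a) + (W b - W a))"
        unfolding tele[of "\<lambda>x. x"] tele[of W] sum.distrib[symmetric] sum_distrib_left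
        by (intro sum.cong) auto
      also have "\<dots> \<le> e * (b - a + (W b - W a) + 1)" using \<open>e > 0\<close> by simp
      also have "\<dots> = e0 / 2" using den unfolding e_def by (simp add: divide_simps)
      also have "\<dots> < e0" using \<open>e0 > 0\<close> by simp
      finally show "norm ((\<Sum>(x,K)\<in>p. measure lborel K *\<^sub>R g x) - (f b - f a)) < e0"
        unfolding tele[of f] by (simp add: sum_subtractf split_def)
    qed
  qed
  then have "(g has_integral (f b - f a)) {a..b}" by simp
  then show ?thesis
    by (rule has_integral_spike[of S, rotated 2])
      (use S in \<open>auto simp: g_def negligible_iff_null_sets intro: null_sets_completionI countable_imp_null_set_lborel\<close>)
qed

text \<open>A zero with nonvanishing derivative is isolated from all other zeros, so disjoint
  neighbourhoods, each containing a rational number, separate the simple zeros.\<close>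

lemma countable_simple_zeros:
  fixes f :: "real \<Rightarrow> real"
  assumes "\<And>x. x \<in> S \<Longrightarrow> (f has_real_derivative f' x) (at x)"
  shows "countable {x \<in> S. f x = 0 \<and> f' x \<noteq> 0}" (is "countable ?K")
proof -
  have "\<exists>d>0. \<forall>y. y \<noteq> x \<longrightarrow> dist y x < d \<longrightarrow> f y \<noteq> 0" if "x \<in> ?K" for x
  proof -
    have "((\<lambda>y. (f y - f x) / (y - x)) \<longlongrightarrow> f' x) (at x)"
      using assms[of x] that unfolding has_field_derivative_iff by blast
    then have "\<forall>\<^sub>F y in at x. (f y - f x) / (y - x) \<noteq> 0"
      using that by (intro tendsto_imp_eventually_ne) auto
    then show ?thesis using that by (auto simp: eventually_at)
  qed
  then obtain d where d0: "\<forall>x\<in>?K. d x > 0 \<and> (\<forall>y. y \<noteq> x \<longrightarrow> dist y x < d x \<longrightarrow> f y \<noteq> 0)"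
    using bchoice[of ?K "\<lambda>x d. d > 0 \<and> (\<forall>y. y \<noteq> x \<longrightarrow> dist y x < d \<longrightarrow> f y \<noteq> 0)"] by blast
  have d: "d x > 0" if "x \<in> ?K" for x
    using bspec[OF d0 that] by blast
  have d': "f y \<noteq> 0" if "x \<in> ?K" "y \<noteq> x" "dist y x < d x" for x y
    using bspec[OF d0 that(1)] that(2,3) by blast
  have "\<exists>q\<in>\<rat>. q \<in> ball x (d x / 2)" if xK: "x \<in> ?K" for x
  proof -
    obtain q where "q \<in> \<rat>" "x < q" "q < x + d x / 2"
      using Rats_dense_in_real[of x "x + d x / 2"] d[OF xK] by auto
    then show ?thesis by (intro bexI[of _ q]) (auto simp: dist_real_def)
  qed
  then obtain q where "\<forall>x\<in>?K. q x \<in> \<rat> \<and> q x \<in> ball x (d x / 2)"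
    using bchoice[of ?K "\<lambda>x q. q \<in> \<rat> \<and> q \<in> ball x (d x / 2)"] by blast
  then have q: "\<And>x. x \<in> ?K \<Longrightarrow> q x \<in> \<rat> \<and> q x \<in> ball x (d x / 2)"
    by blast
  have "inj_on q ?K"
  proof (rule inj_onI, rule ccontr)
    fix x y assume xy: "x \<in> ?K" "y \<in> ?K" "q x = q y" "x \<noteq> y"
    have "d x \<le> dist y x" "d y \<le> dist x y"
      using d'[OF xy(1), of y] d'[OF xy(2), of x] xy by (auto simp: not_less[symmetric])
    moreover have "dist x (q x) < d x / 2" "dist y (q x) < d y / 2"
      using q[OF xy(1)] q[OF xy(2)] xy(3) by auto
    moreover have "dist x y \<le> dist x (q x) + dist y (q x)" by (metis dist_triangle2)
    ultimately show False by (simp add: dist_commute)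
  qed
  moreover have "countable (q ` ?K)"
    by (rule countable_subset[OF _ countable_rat]) (use q in auto)
  ultimately show ?thesis by (rule countable_image_inj_on[rotated])
qed

text \<open>Here \<open>A\<close> is not known to be integrable. Its integrals over compact pieces are controlled by the
  increments of \<open>P\<close> and the integrals of \<open>B\<close>, and nonnegativity of \<open>A\<close> allows monotone convergence.\<close>

lemma integral_derivative_exhaustion:
  fixes A B P :: "real \<Rightarrow> real" and a b :: "nat \<Rightarrow> real"
  assumes a: "decseq a" and b: "incseq b" and ab: "\<And>n. a n \<le> b n"
    and S: "S = (\<Union>n. {a n..b n})"
    and P: "(\<lambda>n. P (b n) - P (a n)) \<longlonglongrightarrow> l"
    and K: "countable K"
    and deriv: "\<And>x. x \<in> S - K \<Longrightarrow> (P has_real_derivative A x + B x) (at x)"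
    and cont: "continuous_on S P"
    and A: "set_borel_measurable lborel S A" "\<And>x. x \<in> S \<Longrightarrow> A x \<ge> 0"
    and B: "set_integrable lborel S B"
  shows "set_integrable lborel S A \<and> (LINT x:S|lborel. A x) = l - (LINT x:S|lborel. B x)"
proof -
  define J where "J = (\<lambda>n. {a n..b n})"
  have inc: "incseq J"
    unfolding J_def incseq_def
    using decseqD[OF a] incseqD[OF b] by (metis atLeastatMost_subset_iff)
  have JS: "J n \<subseteq> S" for n unfolding S J_def by blast
  have Jb: "J n \<in> sets lborel" for n by (simp add: J_def)
  have BJ: "set_integrable lborel (J n) B" for n
    by (rule set_integrable_subset[OF B]) (use Jb JS in auto)
  have AJ: "(A has_integral (P (b n) - P (a n) - (LINT x:J n|lborel. B x))) (J n)" for n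
  proof -
    have "((\<lambda>x. A x + B x) has_integral (P (b n) - P (a n))) (J n)"
      unfolding J_def
    proof (rule has_integral_derivative_countable_exceptions[OF ab _ K])
      show "continuous_on {a n..b n} P"
        using cont JS[of n] unfolding J_def by (rule continuous_on_subset)
      show "(P has_vector_derivative A x + B x) (at x within {a n..b n})" if "x \<in> {a n..b n} - K" for x
        unfolding has_real_derivative_iff_has_vector_derivative[symmetric]
        by (rule has_field_derivative_at_within, rule deriv) (use that JS[of n] in \<open>auto simp: J_def\<close>)
    qed
    moreover have "(B has_integral (LINT x:J n|lborel. B x)) (J n)"
      using set_borel_integral_eq_integral[OF BJ] by (metis has_integral_integral)
    ultimately show ?thesis
      using has_integral_diff[of "\<lambda>x. A x + B x" _ _ B] by simp
  qed
  have meas: "(\<lambda>x. indicator (J n) x * A x) \<in> borel_measurable lborel" for n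
  proof -
    have "(\<lambda>x. indicator (J n) x * (indicator S x * A x)) \<in> borel_measurable lborel"
      by (rule borel_measurable_times[OF borel_measurable_indicator[OF Jb]])
        (use A(1) in \<open>simp add: set_borel_measurable_def\<close>)
    then show ?thesis using JS[of n]
      by (subst (asm) measurable_cong[where g="\<lambda>x. indicator (J n) x * A x"]) (auto simp: indicator_def)
  qed
  have nn: "(\<integral>\<^sup>+x. ennreal (indicator (J n) x * A x) \<partial>lborel)
        = ennreal (P (b n) - P (a n) - (LINT x:J n|lborel. B x))" for n
    using nn_integral_has_integral_lebesgue[OF _ AJ, of n] A(2) JS by auto
  have pos: "0 \<le> indicator (J n) x * A x" for n x
    using A(2) JS[of n] by (auto simp: indicator_def)
  have int: "integrable lborel (\<lambda>x. indicator (J n) x * A x)" for n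
    by (rule integrableI_nonneg[OF meas]) (use pos in \<open>auto simp: nn\<close>)
  have val: "(LINT x|lborel. indicator (J n) x * A x)
        = P (b n) - P (a n) - (LINT x:J n|lborel. B x)" for n
  proof -
    have "(\<lambda>x. indicator (J n) x * A x) = (\<lambda>x. if x \<in> J n then A x else 0)"
      by auto
    then have "(A has_integral (LINT x|lborel. indicator (J n) x * A x)) (J n)"
      using has_integral_integral_lborel[OF int[of n]]
      by (simp only: has_integral_restrict_UNIV)
    then show ?thesis using AJ[of n] by (rule has_integral_unique)
  qed
  have limB: "(\<lambda>n. LINT x:J n|lborel. B x) \<longlonglongrightarrow> (LINT x:S|lborel. B x)"
    using set_integral_cont_up[of J lborel B] inc Jb B unfolding S J_def by auto
  have lim: "(\<lambda>n. LINT x|lborel. indicator (J n) x * A x) \<longlonglongrightarrow> l - (LINT x:S|lborel. B x)"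
    unfolding val by (intro tendsto_intros P limB)
  have ev: "\<exists>N. \<forall>n\<ge>N. indicator (J n) x = (indicator S x :: real)" for x
  proof (cases "x \<in> S")
    case True
    then obtain N where "x \<in> J N" unfolding S J_def by blast
    then have "\<forall>n\<ge>N. x \<in> J n" using inc by (auto simp: incseq_def)
    then show ?thesis using True by (auto simp: indicator_def)
  qed (use JS in \<open>auto simp: indicator_def\<close>)
  have ptw: "(\<lambda>n. indicator (J n) x * A x) \<longlonglongrightarrow> indicator S x * A x" for x
    by (rule tendsto_eventually) (use ev[of x] in \<open>auto simp: eventually_sequentially\<close>)
  have mono: "incseq (\<lambda>n. indicator (J n) x * A x)" for x
  proof (rule monoI)
    fix m n :: nat assume "m \<le> n"
    then have "J m \<subseteq> J n" using inc by (simp add: incseq_def)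
    then show "indicator (J m) x * A x \<le> indicator (J n) x * A x"
      using pos[of n x] by (auto simp: indicator_def)
  qed
  have mS: "(\<lambda>x. indicator S x * A x) \<in> borel_measurable lborel"
    using A(1) by (simp add: set_borel_measurable_def)
  show ?thesis
    unfolding set_integrable_def set_lebesgue_integral_def real_scaleR_def
    by (intro conjI integral_monotone_convergence_nonneg[OF int _ _ _ lim[unfolded set_lebesgue_integral_def real_scaleR_def] mS]
        AE_I2 mono pos ptw)
qed

section \<open>Integration by parts along the lines of the half-plane\<close>

lemma integral_derivative_halfline:
  fixes A B P :: "real \<Rightarrow> real"
  assumes P0: "(P \<longlongrightarrow> l0) (at_right 0)" and P1: "(P \<longlongrightarrow> l1) at_top"
    and "countable K"
    and "\<And>x. x \<in> {0<..} - K \<Longrightarrow> (P has_real_derivative A x + B x) (at x)"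
    and "continuous_on {0<..} P"
    and "set_borel_measurable lborel {0<..} A" "\<And>x. x \<in> {0<..} \<Longrightarrow> A x \<ge> 0"
    and "set_integrable lborel {0<..} B"
  shows "set_integrable lborel {0<..} A
       \<and> (LINT x:{0<..}|lborel. A x) = l1 - l0 - (LINT x:{0<..}|lborel. B x)"
proof (rule integral_derivative_exhaustion[where P=P and K=K and a="\<lambda>n. inverse (real (Suc n))" and b="\<lambda>n. real (Suc n)"])
  show "{0<..} = (\<Union>n. {inverse (real (Suc n))..real (Suc n)})"
  proof (intro equalityI subsetI)
    fix x :: real assume x: "x \<in> {0<..}"
    obtain m where m: "inverse (real (Suc m)) < x" using x reals_Archimedean by auto
    obtain n where n: "x < real n" using reals_Archimedean2 by auto
    have "inverse (real (Suc (max m n))) \<le> inverse (real (Suc m))"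
      by (rule le_imp_inverse_le) auto
    then have "inverse (real (Suc (max m n))) \<le> x" using m by linarith
    moreover have "x \<le> real (Suc (max m n))" using n by linarith
    ultimately show "x \<in> (\<Union>n. {inverse (real (Suc n))..real (Suc n)})"
      by (intro UN_I[of "max m n"]) simp_all
  qed (auto intro: less_le_trans[rotated])
  have 1: "filterlim (\<lambda>n. inverse (real (Suc n))) (at_right 0) sequentially"
    using LIMSEQ_inverse_real_of_nat by (auto simp: filterlim_at)
  have 2: "filterlim (\<lambda>n. real (Suc n)) at_top sequentially"
    by (rule filterlim_compose[OF filterlim_real_sequentially filterlim_Suc])
  show "(\<lambda>n. P (real (Suc n)) - P (inverse (real (Suc n)))) \<longlonglongrightarrow> l1 - l0"
    by (intro tendsto_diff filterlim_compose[OF P0 1] filterlim_compose[OF P1 2])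
  show "inverse (real (Suc n)) \<le> real (Suc n)" for n
    by (rule order.trans[of _ 1]) (auto simp: inverse_le_1_iff)
qed (use assms in \<open>auto simp: decseq_def incseq_def intro!: le_imp_inverse_le\<close>)

lemma integral_derivative_line:
  fixes A B P :: "real \<Rightarrow> real"
  assumes P0: "(P \<longlongrightarrow> l0) at_bot" and P1: "(P \<longlongrightarrow> l1) at_top"
    and "countable K"
    and "\<And>x. x \<notin> K \<Longrightarrow> (P has_real_derivative A x + B x) (at x)"
    and "continuous_on UNIV P"
    and "A \<in> borel_measurable lborel" "\<And>x. A x \<ge> 0"
    and "integrable lborel B"
  shows "integrable lborel A
       \<and> integral\<^sup>L lborel A = l1 - l0 - integral\<^sup>L lborel B"
proof -
  have "set_integrable lborel UNIV A
       \<and> (LINT x:UNIV|lborel. A x) = l1 - l0 - (LINT x:UNIV|lborel. B x)"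
  proof (rule integral_derivative_exhaustion[where P=P and K=K and a="\<lambda>n. - real n" and b="\<lambda>n. real n"])
    show "UNIV = (\<Union>n. {- real n..real n})"
    proof (intro equalityI subsetI)
      fix x :: real
      obtain n where n: "\<bar>x\<bar> < real n" using reals_Archimedean2 by auto
      then show "x \<in> (\<Union>n. {- real n..real n})" by (intro UN_I[of n]) auto
    qed auto
    have 1: "filterlim (\<lambda>n. - real n) at_bot sequentially"
      by (rule filterlim_compose[OF filterlim_uminus_at_bot_at_top filterlim_real_sequentially])
    show "(\<lambda>n. P (real n) - P (- real n)) \<longlonglongrightarrow> l1 - l0"
      by (intro tendsto_diff filterlim_compose[OF P0 1] filterlim_compose[OF P1 filterlim_real_sequentially])
  qed (use assms in \<open>auto simp: decseq_def incseq_def set_borel_measurable_def set_integrable_def\<close>)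
  then show ?thesis by (simp add: set_integrable_def set_lebesgue_integral_def)
qed

text \<open>Integrability of a nonnegative \<open>f\<close> on the product follows from Tonelli's theorem, since its slice
  integrals agree with those of the integrable \<open>- g\<close>.\<close>

lemma (in pair_sigma_finite) integral_eq_of_slices:
  fixes f g :: "'a \<times> 'b \<Rightarrow> real"
  assumes f[measurable]: "f \<in> borel_measurable (M1 \<Otimes>\<^sub>M M2)" and g: "integrable (M1 \<Otimes>\<^sub>M M2) g"
    and pos: "\<And>z. f z \<ge> 0"
    and slice: "\<And>x. integrable M2 (\<lambda>y. g (x, y)) \<Longrightarrow>
       integrable M2 (\<lambda>y. f (x, y)) \<and> (\<integral>y. f (x, y) \<partial>M2) = - (\<integral>y. g (x, y) \<partial>M2)"
  shows "integrable (M1 \<Otimes>\<^sub>M M2) f \<and> integral\<^sup>L (M1 \<Otimes>\<^sub>M M2) f = - integral\<^sup>L (M1 \<Otimes>\<^sub>M M2) g"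
proof -
  have ae: "AE x in M1. integrable M2 (\<lambda>y. g (x, y))" by (rule AE_integrable_fst'[OF g])
  have ig: "integrable M1 (\<lambda>x. \<integral>y. g (x, y) \<partial>M2)" by (rule integrable_fst'[OF g])
  have mf: "(\<lambda>x. \<integral>y. f (x, y) \<partial>M2) \<in> borel_measurable M1"
    by (rule M2.borel_measurable_lebesgue_integral) simp
  have aeq: "AE x in M1. (\<integral>y. f (x, y) \<partial>M2) = - (\<integral>y. g (x, y) \<partial>M2)"
    using ae by eventually_elim (use slice in blast)
  have "integrable (M1 \<Otimes>\<^sub>M M2) f"
  proof (rule Fubini_integrable[OF f])
    show "integrable M1 (\<lambda>x. \<integral>y. norm (f (x, y)) \<partial>M2)"
      using integrable_cong_AE[OF mf _ aeq] ig pos by auto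
    show "AE x in M1. integrable M2 (\<lambda>y. f (x, y))"
      using ae by eventually_elim (use slice in blast)
  qed
  moreover from this have "integral\<^sup>L (M1 \<Otimes>\<^sub>M M2) f = (\<integral>x. (\<integral>y. f (x, y) \<partial>M2) \<partial>M1)"
    by (rule integral_fst'[symmetric])
  moreover have "\<dots> = (\<integral>x. - (\<integral>y. g (x, y) \<partial>M2) \<partial>M1)"
    by (rule integral_cong_AE[OF mf _ aeq]) (use ig in auto)
  ultimately show ?thesis using integral_fst'[OF g] by simp
qed

lemma halfplane_sets [measurable, simp]: "halfplane \<in> sets borel"
  unfolding halfplane_def by (intro borel_open open_Times) auto

lemma open_halfplane: "open halfplane"
  unfolding halfplane_def by (intro open_Times) auto

lemma halfplane_iff [simp]: "(r, z) \<in> halfplane \<longleftrightarrow> r > 0"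
  by (simp add: halfplane_def)

lemma borel_pair_measurable:
  fixes f :: "real \<times> real \<Rightarrow> real"
  assumes "f \<in> borel_measurable borel"
  shows "f \<in> borel_measurable (lborel \<Otimes>\<^sub>M lborel)"
  using assms by (simp add: lborel_prod)

text \<open>The integral of an axial derivative over the half-plane vanishes. The derivative is split into a
  nonnegative part \<open>A\<close>, whose integrability is a conclusion, and an integrable part \<open>B\<close>.\<close>

lemma axial_integration_by_parts:
  fixes A B P :: "real \<times> real \<Rightarrow> real"
  assumes lim: "\<And>r. r > 0 \<Longrightarrow> ((\<lambda>z. P (r, z)) \<longlongrightarrow> 0) at_bot" "\<And>r. r > 0 \<Longrightarrow> ((\<lambda>z. P (r, z)) \<longlongrightarrow> 0) at_top"
    and K: "\<And>r. r > 0 \<Longrightarrow> countable (K r)"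
    and deriv: "\<And>r z. r > 0 \<Longrightarrow> z \<notin> K r \<Longrightarrow> ((\<lambda>z. P (r, z)) has_real_derivative A (r, z) + B (r, z)) (at z)"
    and cont: "\<And>r. r > 0 \<Longrightarrow> continuous_on UNIV (\<lambda>z. P (r, z))"
    and A: "set_borel_measurable lborel halfplane A" "\<And>r z. r > 0 \<Longrightarrow> A (r, z) \<ge> 0"
    and B: "set_integrable lborel halfplane B"
  shows "set_integrable lborel halfplane A \<and> (LINT x:halfplane|lborel. A x) = - (LINT x:halfplane|lborel. B x)"
proof -
  define f where "f = (\<lambda>x. indicator halfplane x * A x)"
  define g where "g = (\<lambda>x. indicator halfplane x * B x)"
  have f: "f \<in> borel_measurable borel" using A(1) by (simp add: f_def set_borel_measurable_def)
  have g: "integrable lborel g" using B by (simp add: g_def set_integrable_def)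
  have gz: "g (r, z) = (if r > 0 then B (r, z) else 0)" "f (r, z) = (if r > 0 then A (r, z) else 0)" for r z
    by (auto simp: f_def g_def indicator_def)
  have "integrable (lborel \<Otimes>\<^sub>M lborel) f \<and> integral\<^sup>L (lborel \<Otimes>\<^sub>M lborel) f = - integral\<^sup>L (lborel \<Otimes>\<^sub>M lborel) g"
  proof (rule lborel_pair.integral_eq_of_slices)
    show "f \<in> borel_measurable (lborel \<Otimes>\<^sub>M lborel)" using f by (rule borel_pair_measurable)
    show "integrable (lborel \<Otimes>\<^sub>M lborel) g" using g by (simp add: lborel_prod)
    show "f x \<ge> 0" for x using A(2) by (cases x) (auto simp: gz)
    fix r assume i: "integrable lborel (\<lambda>z. g (r, z))"
    show "integrable lborel (\<lambda>y. f (r, y)) \<and> (LBINT y. f (r, y)) = - (LBINT y. g (r, y))"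
    proof (cases "r > 0")
      case True
      have "(\<lambda>z. f (r, z)) \<in> borel_measurable borel"
        by (rule measurable_compose[OF _ f]) simp
      then have m: "(\<lambda>z. A (r, z)) \<in> borel_measurable lborel" using True by (simp add: gz)
      show ?thesis
        using integral_derivative_line[OF lim(1)[OF True] lim(2)[OF True] K[OF True] deriv[OF True]
          cont[OF True] m A(2)[OF True]] i True
        by (simp add: gz)
    qed (simp add: gz)
  qed
  then show ?thesis unfolding f_def g_def lborel_prod
    by (simp add: set_integrable_def set_lebesgue_integral_def)
qed

lemma radial_integration_by_parts:
  fixes A B P :: "real \<times> real \<Rightarrow> real"
  assumes lim: "\<And>z. ((\<lambda>r. P (r, z)) \<longlongrightarrow> 0) (at_right 0)" "\<And>z. ((\<lambda>r. P (r, z)) \<longlongrightarrow> 0) at_top"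
    and K: "\<And>z. countable (K z)"
    and deriv: "\<And>r z. r > 0 \<Longrightarrow> r \<notin> K z \<Longrightarrow> ((\<lambda>r. P (r, z)) has_real_derivative A (r, z) + B (r, z)) (at r)"
    and cont: "\<And>z. continuous_on {0<..} (\<lambda>r. P (r, z))"
    and A: "set_borel_measurable lborel halfplane A" "\<And>r z. r > 0 \<Longrightarrow> A (r, z) \<ge> 0"
    and B: "set_integrable lborel halfplane B"
  shows "set_integrable lborel halfplane A \<and> (LINT x:halfplane|lborel. A x) = - (LINT x:halfplane|lborel. B x)"
proof -
  define f where "f = (\<lambda>x. indicator halfplane x * A x)"
  define g where "g = (\<lambda>x. indicator halfplane x * B x)"
  have f: "f \<in> borel_measurable borel" using A(1) by (simp add: f_def set_borel_measurable_def)
  have g: "integrable lborel g" using B by (simp add: g_def set_integrable_def)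
  have gz: "g (r, z) = indicator {0<..} r * B (r, z)" "f (r, z) = indicator {0<..} r * A (r, z)" for r z
    by (auto simp: f_def g_def indicator_def)
  have f': "f \<in> borel_measurable (lborel \<Otimes>\<^sub>M lborel)" using f by (rule borel_pair_measurable)
  have g': "integrable (lborel \<Otimes>\<^sub>M lborel) g" using g by (simp add: lborel_prod)
  define f2 where "f2 = (\<lambda>(z, r). f (r, z))"
  define g2 where "g2 = (\<lambda>(z, r). g (r, z))"
  have "integrable (lborel \<Otimes>\<^sub>M lborel) f2 \<and> integral\<^sup>L (lborel \<Otimes>\<^sub>M lborel) f2 = - integral\<^sup>L (lborel \<Otimes>\<^sub>M lborel) g2"
  proof (rule lborel_pair.integral_eq_of_slices)
    show "f2 \<in> borel_measurable (lborel \<Otimes>\<^sub>M lborel)" unfolding f2_def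
      by (rule measurable_pair_swap[OF f'])
    show "integrable (lborel \<Otimes>\<^sub>M lborel) g2" unfolding g2_def
      by (rule lborel_pair.integrable_product_swap[OF g'])
    show "f2 x \<ge> 0" for x using A(2) by (cases x) (auto simp: gz f2_def indicator_def)
    fix z assume i: "integrable lborel (\<lambda>r. g2 (z, r))"
    have m: "(\<lambda>r. f (r, z)) \<in> borel_measurable borel"
      by (rule measurable_compose[OF _ f]) simp
    show "integrable lborel (\<lambda>y. f2 (z, y)) \<and> (LBINT y. f2 (z, y)) = - (LBINT y. g2 (z, y))"
      using integral_derivative_halfline[OF lim(1)[of z] lim(2)[of z] K, of z "\<lambda>r. A (r, z)" "\<lambda>r. B (r, z)"]
        deriv[of _ z] cont[of z] m A(2)[of _ z] i
      by (simp add: gz f2_def g2_def set_integrable_def set_lebesgue_integral_def set_borel_measurable_def)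
  qed
  then have "integrable (lborel \<Otimes>\<^sub>M lborel) f \<and> integral\<^sup>L (lborel \<Otimes>\<^sub>M lborel) f = - integral\<^sup>L (lborel \<Otimes>\<^sub>M lborel) g"
    unfolding f2_def g2_def
    using lborel_pair.integrable_product_swap_iff[of f] lborel_pair.integral_product_swap[OF f']
      lborel_pair.integral_product_swap[OF borel_measurable_integrable[OF g']] by simp
  then show ?thesis unfolding f_def g_def lborel_prod
    by (simp add: set_integrable_def set_lebesgue_integral_def)
qed

section \<open>Calculus of signed powers\<close>

text \<open>The odd power $|s|^{q-1} s$. For $q = p - 1$ it is $|s|^{p-2} s$, the derivative of $|s|^p / p$,
  which is continuous for every $p > 1$.\<close>

definition sgn_powr :: "real \<Rightarrow> real \<Rightarrow> real" where
  "sgn_powr q s = sgn s * \<bar>s\<bar> powr q"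

lemma sgn_powr_0 [simp]: "sgn_powr q 0 = 0"
  by (simp add: sgn_powr_def)

lemma abs_sgn_powr: "\<bar>sgn_powr q s\<bar> = \<bar>s\<bar> powr q"
  by (cases "s = 0") (auto simp: sgn_powr_def abs_mult abs_sgn_eq)

lemma sgn_powr_mult_self: "s * sgn_powr (p - 1) s = \<bar>s\<bar> powr p"
proof (cases "s = 0")
  case False
  then show ?thesis by (auto simp: sgn_powr_def powr_diff sgn_if abs_if)
qed simp

lemma DERIV_abs_powr_nonzero:
  assumes "s \<noteq> (0::real)"
  shows "((\<lambda>s. \<bar>s\<bar> powr q) has_real_derivative q * sgn_powr (q - 1) s) (at s)"
proof (cases "s > 0")
  case True
  have "((\<lambda>s. s powr q) has_real_derivative q * s powr (q - 1)) (at s)"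
    by (rule has_real_derivative_powr[OF True])
  then have "((\<lambda>s. \<bar>s\<bar> powr q) has_real_derivative q * s powr (q - 1)) (at s)"
    by (rule DERIV_cong_ev[OF refl _ refl, THEN iffD1, rotated])
      (use True in \<open>auto intro!: eventually_mono[OF eventually_nhds_in_open[of "{0<..}" s]]\<close>)
  then show ?thesis using True by (simp add: sgn_powr_def)
next
  case False
  then have n: "s < 0" using assms by simp
  have "((\<lambda>s. (- s) powr q) has_real_derivative - (q * (- s) powr (q - 1))) (at s)"
    using n by (auto intro!: derivative_eq_intros simp: powr_diff)
  then have "((\<lambda>s. \<bar>s\<bar> powr q) has_real_derivative - (q * (- s) powr (q - 1))) (at s)"
    by (rule DERIV_cong_ev[OF refl _ refl, THEN iffD1, rotated])
      (use n in \<open>auto intro!: eventually_mono[OF eventually_nhds_in_open[of "{..<0}" s]]\<close>)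
  then show ?thesis using n by (simp add: sgn_powr_def)
qed

lemma tendsto_abs_powr_0:
  assumes "q > (0::real)"
  shows "((\<lambda>s. \<bar>s\<bar> powr q) \<longlongrightarrow> 0) (at 0)"
proof -
  have "continuous_on UNIV (\<lambda>s::real. \<bar>s\<bar> powr q)"
    by (intro continuous_on_powr' continuous_intros) (use assms in auto)
  then have "isCont (\<lambda>s::real. \<bar>s\<bar> powr q) 0"
    by (simp add: continuous_on_eq_continuous_at)
  then show ?thesis by (simp add: isCont_def)
qed

lemma DERIV_abs_powr:
  assumes "q > 1"
  shows "((\<lambda>s. \<bar>s\<bar> powr q) has_real_derivative q * sgn_powr (q - 1) s) (at s)"
proof (cases "s = 0")
  case True
  have "((\<lambda>h. \<bar>h\<bar> powr q / h) \<longlongrightarrow> 0) (at 0)"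
  proof (rule tendsto_rabs_zero_cancel, rule Lim_transform_eventually)
    show "((\<lambda>s. \<bar>s\<bar> powr (q - 1)) \<longlongrightarrow> 0) (at 0)"
      by (rule tendsto_abs_powr_0) (use assms in simp)
    show "\<forall>\<^sub>F h in at 0. \<bar>h\<bar> powr (q - 1) = \<bar>\<bar>h\<bar> powr q / h\<bar>"
      unfolding eventually_at by (intro exI[of _ 1]) (auto simp: powr_diff)
  qed
  then show ?thesis using True by (simp add: DERIV_def)
qed (rule DERIV_abs_powr_nonzero)

lemma DERIV_sgn_powr:
  assumes "s \<noteq> 0"
  shows "(sgn_powr q has_real_derivative q * \<bar>s\<bar> powr (q - 1)) (at s)"
proof -
  have "((\<lambda>x. sgn s * \<bar>x\<bar> powr q) has_real_derivative sgn s * (q * sgn_powr (q - 1) s)) (at s)"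
    by (intro DERIV_cmult DERIV_abs_powr_nonzero assms)
  then have "(sgn_powr q has_real_derivative sgn s * (q * sgn_powr (q - 1) s)) (at s)"
  proof (rule DERIV_cong_ev[OF refl _ refl, THEN iffD1, rotated])
    have "\<forall>\<^sub>F x in nhds s. x \<in> (if s > 0 then {0<..} else {..<0})"
      by (rule eventually_nhds_in_open) (use assms in auto)
    then show "\<forall>\<^sub>F x in nhds s. sgn s * \<bar>x\<bar> powr q = sgn_powr q x"
      by eventually_elim (use assms in \<open>auto simp: sgn_powr_def split: if_splits\<close>)
  qed
  moreover have "sgn s * sgn s = 1" using assms by (simp add: sgn_if)
  ultimately show ?thesis by (simp add: sgn_powr_def mult.left_commute)
qed

lemma continuous_on_sgn_powr [continuous_intros]:
  fixes f :: "'a::topological_space \<Rightarrow> real"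
  assumes "q > 0" and f: "continuous_on A f"
  shows "continuous_on A (\<lambda>x. sgn_powr q (f x))"
proof -
  have "isCont (sgn_powr q) s" for s
  proof (cases "s = 0")
    case True
    have "(sgn_powr q \<longlongrightarrow> 0) (at 0)"
      by (rule tendsto_rabs_zero_cancel) (use tendsto_abs_powr_0[OF \<open>q > 0\<close>] in \<open>simp add: abs_sgn_powr\<close>)
    then show ?thesis using True by (simp add: isCont_def)
  qed (use DERIV_isCont DERIV_sgn_powr in blast)
  then have "continuous_on UNIV (sgn_powr q)" by (simp add: continuous_at_imp_continuous_on)
  then show ?thesis using f by (rule continuous_on_compose2) auto
qed

lemma continuous_on_abs_powr [continuous_intros]:
  fixes f :: "'a::topological_space \<Rightarrow> real"
  assumes "q > 0" and "continuous_on A f"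
  shows "continuous_on A (\<lambda>x. \<bar>f x\<bar> powr q)"
  using assms by (intro continuous_on_powr' continuous_intros) auto

text \<open>The difference quotient of the product at \<open>x\<close> is \<open>f\<close> times that of \<open>g\<close>. This is the situation
  at a multiple zero of $F$, where $|F|^{p-2} F$ is merely known to be continuous.\<close>

lemma DERIV_mult_vanishing:
  fixes f g :: "real \<Rightarrow> real"
  assumes f: "isCont f x" "f x = 0" and g: "(g has_real_derivative d) (at x)" "g x = 0"
  shows "((\<lambda>y. f y * g y) has_real_derivative 0) (at x)"
proof -
  have "((\<lambda>y. f y * ((g y - g x) / (y - x))) \<longlongrightarrow> 0 * d) (at x)"
    using f g by (intro tendsto_mult) (auto simp: isCont_def has_field_derivative_iff)
  then show ?thesis using g(2) f(2) by (simp add: has_field_derivative_iff)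
qed

text \<open>The formal product rule, valid everywhere except at simple zeros of \<open>f\<close>. At a multiple zero
  both terms on the right are zero, for the first because \<open>0 powr a = 0\<close> for every \<open>a\<close>.\<close>

lemma DERIV_sgn_powr_mult_derivative:
  assumes "q > 0"
    and f: "(f has_real_derivative f' x) (at x)" and f': "(f' has_real_derivative d) (at x)"
    and "f x \<noteq> 0 \<or> f' x = 0"
  shows "((\<lambda>y. sgn_powr q (f y) * f' y) has_real_derivative
            q * \<bar>f x\<bar> powr (q - 1) * (f' x)\<^sup>2 + sgn_powr q (f x) * d) (at x)"
proof (cases "f x = 0")
  case False
  have "((\<lambda>y. sgn_powr q (f y)) has_real_derivative q * \<bar>f x\<bar> powr (q - 1) * f' x) (at x)"
    by (rule DERIV_chain2[OF DERIV_sgn_powr[OF False] f])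
  from DERIV_mult[OF this f'] show ?thesis by (simp add: power2_eq_square algebra_simps)
next
  case True
  have "continuous_on UNIV (sgn_powr q)" by (intro continuous_intros \<open>q > 0\<close>)
  then have "isCont (sgn_powr q) (f x)" by (simp add: continuous_on_eq_continuous_at)
  then have "isCont (\<lambda>y. sgn_powr q (f y)) x"
    using isCont_o2[OF DERIV_isCont[OF f]] by blast
  from DERIV_mult_vanishing[OF this _ f'] True assms(4) show ?thesis by simp
qed

section \<open>Rapidly decaying profiles and weighted integrability\<close>

text \<open>The fixed factor $1 + z^2$ already gives integrability in \<open>z\<close>, whereas in \<open>r\<close> the weights
  $r^\alpha$ call for arbitrary exponents. The axis $r = 0$ is included, and the constant is uniform
  over \<open>T\<close>, which is a compact set of times in the applications.\<close>

definition decays :: "real set \<Rightarrow> (real \<Rightarrow> real \<Rightarrow> real \<Rightarrow> real) \<Rightarrow> bool" where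
  "decays T X \<longleftrightarrow> (\<forall>N::nat. \<exists>C. \<forall>t\<in>T. \<forall>r\<ge>0. \<forall>z. \<bar>X t r z\<bar> * ((1 + r) ^ N * (1 + z\<^sup>2)) \<le> C)"

lemma decaysE:
  assumes "decays T X"
  obtains C where "C \<ge> 0" "\<And>t r z. t \<in> T \<Longrightarrow> r \<ge> 0 \<Longrightarrow> \<bar>X t r z\<bar> * ((1 + r) ^ N * (1 + z\<^sup>2)) \<le> C"
proof -
  obtain C where "\<forall>t\<in>T. \<forall>r\<ge>0. \<forall>z. \<bar>X t r z\<bar> * ((1 + r) ^ N * (1 + z\<^sup>2)) \<le> C"
    using assms unfolding decays_def by blast
  then show thesis by (intro that[of "max 0 C"]) (auto intro: max.coboundedI2)
qed

lemma decays_scaled_bound: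
  assumes X: "decays T X" and "\<And>t r z. t \<in> T \<Longrightarrow> r \<ge> 0 \<Longrightarrow> \<bar>Y t r z\<bar> \<le> c * \<bar>X t r z\<bar>"
  shows "decays T Y"
  unfolding decays_def
proof
  fix N
  obtain C where C: "C \<ge> 0" "\<And>t r z. t \<in> T \<Longrightarrow> r \<ge> 0 \<Longrightarrow> \<bar>X t r z\<bar> * ((1 + r) ^ N * (1 + z\<^sup>2)) \<le> C"
    by (rule decaysE[OF X, of "N"]; blast)
  show "\<exists>C. \<forall>t\<in>T. \<forall>r\<ge>0. \<forall>z. \<bar>Y t r z\<bar> * ((1 + r) ^ N * (1 + z\<^sup>2)) \<le> C"
  proof (intro exI[of _ "\<bar>c\<bar> * C"] ballI allI impI)
    fix t r z :: real assume tr: "t \<in> T" "0 \<le> r"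
    have w: "0 \<le> (1 + r) ^ N * (1 + z\<^sup>2)" using tr by simp
    have "\<bar>Y t r z\<bar> \<le> \<bar>c\<bar> * \<bar>X t r z\<bar>"
      using assms(2)[OF tr, of z] mult_right_mono[OF abs_ge_self[of c], of "\<bar>X t r z\<bar>"] by linarith
    then have "\<bar>Y t r z\<bar> * ((1 + r) ^ N * (1 + z\<^sup>2)) \<le> \<bar>c\<bar> * \<bar>X t r z\<bar> * ((1 + r) ^ N * (1 + z\<^sup>2))"
      by (rule mult_right_mono[OF _ w])
    also have "\<dots> \<le> \<bar>c\<bar> * C"
      using mult_left_mono[OF C(2)[OF tr, of z], of "\<bar>c\<bar>"] by (simp add: mult.assoc)
    finally show "\<bar>Y t r z\<bar> * ((1 + r) ^ N * (1 + z\<^sup>2)) \<le> \<bar>c\<bar> * C" .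
  qed
qed

lemma decays_cong:
  assumes "decays T X" "\<And>t r z. t \<in> T \<Longrightarrow> r \<ge> 0 \<Longrightarrow> Y t r z = X t r z"
  shows "decays T Y"
  by (rule decays_scaled_bound[OF assms(1), of _ 1]) (simp add: assms(2))

lemma decays_cmult: "decays T X \<Longrightarrow> decays T (\<lambda>t r z. c * X t r z)"
  by (erule decays_scaled_bound[of _ _ _ "\<bar>c\<bar>"]) (simp add: abs_mult)

lemma decays_minus: "decays T X \<Longrightarrow> decays T (\<lambda>t r z. - X t r z)"
  by (erule decays_scaled_bound[of _ _ _ 1]) simp

lemma decays_add:
  assumes X: "decays T X" and Y: "decays T Y"
  shows "decays T (\<lambda>t r z. X t r z + Y t r z)"
  unfolding decays_def
proof
  fix N
  obtain C where "C \<ge> 0" and C: "\<And>t r z. t \<in> T \<Longrightarrow> r \<ge> 0 \<Longrightarrow> \<bar>X t r z\<bar> * ((1 + r) ^ N * (1 + z\<^sup>2)) \<le> C"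
    by (rule decaysE[OF X, of "N"]; blast)
  obtain D where "D \<ge> 0" and D: "\<And>t r z. t \<in> T \<Longrightarrow> r \<ge> 0 \<Longrightarrow> \<bar>Y t r z\<bar> * ((1 + r) ^ N * (1 + z\<^sup>2)) \<le> D"
    by (rule decaysE[OF Y, of "N"]; blast)
  show "\<exists>C. \<forall>t\<in>T. \<forall>r\<ge>0. \<forall>z. \<bar>X t r z + Y t r z\<bar> * ((1 + r) ^ N * (1 + z\<^sup>2)) \<le> C"
  proof (intro exI[of _ "C + D"] ballI allI impI)
    fix t r z :: real assume tr: "t \<in> T" "0 \<le> r"
    have "\<bar>X t r z + Y t r z\<bar> * ((1 + r) ^ N * (1 + z\<^sup>2))
        \<le> (\<bar>X t r z\<bar> + \<bar>Y t r z\<bar>) * ((1 + r) ^ N * (1 + z\<^sup>2))"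
      using tr by (intro mult_right_mono) auto
    also have "\<dots> \<le> C + D" using C[OF tr, of z] D[OF tr, of z] by (simp add: distrib_right)
    finally show "\<bar>X t r z + Y t r z\<bar> * ((1 + r) ^ N * (1 + z\<^sup>2)) \<le> C + D" .
  qed
qed

lemma decays_diff: "decays T X \<Longrightarrow> decays T Y \<Longrightarrow> decays T (\<lambda>t r z. X t r z - Y t r z)"
  using decays_add[OF _ decays_minus, of T X Y] by simp

lemma decays_bounded:
  assumes "decays T X"
  obtains B where "B \<ge> 0" "\<And>t r z. t \<in> T \<Longrightarrow> r \<ge> 0 \<Longrightarrow> \<bar>X t r z\<bar> \<le> B"
proof -
  obtain C where C: "C \<ge> 0" "\<And>t r z. t \<in> T \<Longrightarrow> r \<ge> 0 \<Longrightarrow> \<bar>X t r z\<bar> * ((1 + r) ^ 0 * (1 + z\<^sup>2)) \<le> C"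
    by (rule decaysE[OF assms, of "0"]; blast)
  have "\<bar>X t r z\<bar> \<le> C" if "t \<in> T" "r \<ge> 0" for t r z
    using mult_left_mono[of 1 "1 + z\<^sup>2" "\<bar>X t r z\<bar>"] C(2)[OF that, of z] by simp
  then show thesis using that C(1) by blast
qed

lemma decays_mult_bounded:
  assumes X: "decays T X" and "\<And>t r z. t \<in> T \<Longrightarrow> r \<ge> 0 \<Longrightarrow> \<bar>Y t r z\<bar> \<le> B"
  shows "decays T (\<lambda>t r z. Y t r z * X t r z)"
  by (rule decays_scaled_bound[OF X, of _ B]) (auto simp: abs_mult intro!: mult_right_mono assms(2))

lemma decays_mult:
  assumes X: "decays T X" and Y: "decays T Y"
  shows "decays T (\<lambda>t r z. Y t r z * X t r z)"
  by (rule decays_bounded[OF Y]) (rule decays_mult_bounded[OF X])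

lemma decays_sgn_powr_mult:
  assumes X: "decays T X" and F: "decays T F" and "q > 0"
  shows "decays T (\<lambda>t r z. sgn_powr q (F t r z) * X t r z)"
proof -
  obtain B where B: "B \<ge> 0" "\<And>t r z. t \<in> T \<Longrightarrow> r \<ge> 0 \<Longrightarrow> \<bar>F t r z\<bar> \<le> B"
    by (rule decays_bounded[OF F]; blast)
  show ?thesis
    by (rule decays_mult_bounded[OF X, of _ "B powr q"])
      (use B \<open>q > 0\<close> in \<open>auto simp: abs_sgn_powr intro!: powr_mono2\<close>)
qed

lemma decays_abs_powr:
  assumes F: "decays T F" and "p > 1"
  shows "decays T (\<lambda>t r z. \<bar>F t r z\<bar> powr p)"
  using decays_sgn_powr_mult[OF F F, of "p - 1"] \<open>p > 1\<close>
  by (simp add: mult.commute[of "sgn_powr _ _"] sgn_powr_mult_self)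

lemma decays_power_r:
  assumes X: "decays T X"
  shows "decays T (\<lambda>t r z. r ^ k * X t r z)"
  unfolding decays_def
proof
  fix N
  obtain C where "C \<ge> 0" and C: "\<And>t r z. t \<in> T \<Longrightarrow> r \<ge> 0 \<Longrightarrow> \<bar>X t r z\<bar> * ((1 + r) ^ (k + N) * (1 + z\<^sup>2)) \<le> C"
    by (rule decaysE[OF X, of "k + N"]; blast)
  show "\<exists>C. \<forall>t\<in>T. \<forall>r\<ge>0. \<forall>z. \<bar>r ^ k * X t r z\<bar> * ((1 + r) ^ N * (1 + z\<^sup>2)) \<le> C"
  proof (intro exI[of _ C] ballI allI impI)
    fix t r z :: real assume tr: "t \<in> T" "0 \<le> r"
    have "\<bar>r ^ k * X t r z\<bar> * ((1 + r) ^ N * (1 + z\<^sup>2)) = r ^ k * (\<bar>X t r z\<bar> * ((1 + r) ^ N * (1 + z\<^sup>2)))"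
      using tr by (simp add: abs_mult power_abs)
    also have "\<dots> \<le> (1 + r) ^ k * (\<bar>X t r z\<bar> * ((1 + r) ^ N * (1 + z\<^sup>2)))"
      using tr by (intro mult_right_mono power_mono) auto
    also have "\<dots> = \<bar>X t r z\<bar> * ((1 + r) ^ (k + N) * (1 + z\<^sup>2))"
      by (simp add: power_add mult_ac)
    also have "\<dots> \<le> C" by (rule C[OF tr])
    finally show "\<bar>r ^ k * X t r z\<bar> * ((1 + r) ^ N * (1 + z\<^sup>2)) \<le> C" .
  qed
qed

lemma decays_mult_r: "decays T X \<Longrightarrow> decays T (\<lambda>t r z. r * X t r z)"
  using decays_power_r[of T X 1] by simp

text \<open>An integrable majorant for every decaying profile with weight $r^{\alpha-2}$, the most singular
  weight that occurs.\<close>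

definition dominator :: "real \<Rightarrow> real \<times> real \<Rightarrow> real" where
  "dominator \<alpha> = (\<lambda>(r, z). r powr (\<alpha> - 2) * (1 + r) powr (- \<alpha>) * inverse (1 + z\<^sup>2))"

lemma integrable_inverse_one_plus_square: "integrable lborel (\<lambda>z::real. inverse (1 + z\<^sup>2))"
proof -
  have "integrable lborel (\<lambda>z::real. inverse (1 + z\<^sup>2))
      \<and> integral\<^sup>L lborel (\<lambda>z::real. inverse (1 + z\<^sup>2)) = pi / 2 - - (pi / 2) - integral\<^sup>L lborel (\<lambda>z::real. 0)"
  proof (rule integral_derivative_line[where P=arctan and K="{}"])
    show "(arctan \<longlongrightarrow> - (pi / 2)) at_bot" using tendsto_arctan_at_bot by simp
    show "continuous_on UNIV arctan" by (intro continuous_intros)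
    show "(arctan has_real_derivative inverse (1 + x\<^sup>2) + 0) (at x)" for x
      using DERIV_arctan[of x] by simp
  qed (auto intro: tendsto_arctan_at_top)
  then show ?thesis by blast
qed

text \<open>The weight is the derivative of the bounded function $(r / (1 + r))^{\alpha-1} / (\alpha - 1)$.\<close>

lemma integrable_radial_weight:
  fixes \<alpha> :: real
  assumes "\<alpha> > 1"
  shows "set_integrable lborel {0<..} (\<lambda>r::real. r powr (\<alpha> - 2) * (1 + r) powr (- \<alpha>))"
proof -
  define P :: "real \<Rightarrow> real" where "P = (\<lambda>r. (r / (1 + r)) powr (\<alpha> - 1) / (\<alpha> - 1))"
  have "set_integrable lborel {0<..} (\<lambda>r::real. r powr (\<alpha> - 2) * (1 + r) powr (- \<alpha>))
      \<and> (LINT r:{0<..}|lborel. r powr (\<alpha> - 2) * (1 + r) powr (- \<alpha>))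
         = 1 / (\<alpha> - 1) - 0 - (LINT r:{0::real<..}|lborel. (0::real))"
  proof (rule integral_derivative_halfline[where P=P and K="{}"])
    have "((\<lambda>r::real. r / (1 + r)) \<longlongrightarrow> 0 / (1 + 0)) (at_right 0)"
      by (intro tendsto_intros) auto
    then have "((\<lambda>r::real. (r / (1 + r)) powr (\<alpha> - 1)) \<longlongrightarrow> 0 powr (\<alpha> - 1)) (at_right 0)"
      using assms by (intro tendsto_powr') (auto simp: eventually_at intro!: exI[of _ 1])
    then have "((\<lambda>r::real. (r / (1 + r)) powr (\<alpha> - 1) / (\<alpha> - 1)) \<longlongrightarrow> 0 powr (\<alpha> - 1) / (\<alpha> - 1)) (at_right 0)"
      using assms by (intro tendsto_divide tendsto_const) auto
    then show "(P \<longlongrightarrow> 0) (at_right 0)" by (simp add: P_def)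
    have "((\<lambda>r::real. inverse (1 + r)) \<longlongrightarrow> 0) at_top"
      by (rule tendsto_inverse_0_at_top[OF filterlim_tendsto_add_at_top[OF tendsto_const filterlim_ident]])
    then have "((\<lambda>r::real. 1 - inverse (1 + r)) \<longlongrightarrow> 1 - 0) at_top"
      by (intro tendsto_intros)
    moreover have "\<forall>\<^sub>F r::real in at_top. 1 - inverse (1 + r) = r / (1 + r)"
      using eventually_gt_at_top[of 0] by eventually_elim (auto simp: field_simps)
    ultimately have "((\<lambda>r::real. r / (1 + r)) \<longlongrightarrow> 1) at_top"
      using Lim_transform_eventually by fastforce
    then have "((\<lambda>r::real. (r / (1 + r)) powr (\<alpha> - 1)) \<longlongrightarrow> 1 powr (\<alpha> - 1)) at_top"
      by (intro tendsto_powr tendsto_const) auto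
    then have "((\<lambda>r::real. (r / (1 + r)) powr (\<alpha> - 1) / (\<alpha> - 1)) \<longlongrightarrow> 1 powr (\<alpha> - 1) / (\<alpha> - 1)) at_top"
      using assms by (intro tendsto_divide tendsto_const) auto
    then show "(P \<longlongrightarrow> 1 / (\<alpha> - 1)) at_top" by (simp add: P_def)
    show "(P has_real_derivative r powr (\<alpha> - 2) * (1 + r) powr (- \<alpha>) + 0) (at r)" if "r \<in> {0<..} - {}" for r
    proof -
      have r: "r > 0" using that by simp
      have "((\<lambda>r. r / (1 + r)) has_real_derivative 1 / (1 + r)\<^sup>2) (at r)"
        using r by (auto intro!: derivative_eq_intros simp: power2_eq_square field_simps)
      from DERIV_powr[OF this, of "\<lambda>_. \<alpha> - 1" 0]
      have "(P has_real_derivative (r / (1 + r)) powr (\<alpha> - 1) * ((1 / (1 + r)\<^sup>2) * (\<alpha> - 1) / (r / (1 + r))) / (\<alpha> - 1)) (at r)"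
        unfolding P_def using r by (intro DERIV_cdivide) simp
      moreover have "(r / (1 + r)) powr (\<alpha> - 1) * ((1 / (1 + r)\<^sup>2) * (\<alpha> - 1) / (r / (1 + r))) / (\<alpha> - 1)
          = r powr (\<alpha> - 2) * (1 + r) powr (- \<alpha>) + 0"
        using r assms by (simp add: powr_divide powr_diff powr_minus divide_simps power2_eq_square)
      ultimately show ?thesis by simp
    qed
    then show "continuous_on {0<..} P"
      by (auto intro!: continuous_at_imp_continuous_on DERIV_isCont)
    show "set_borel_measurable lborel {0<..} (\<lambda>r. r powr (\<alpha> - 2) * (1 + r) powr - \<alpha>)"
      unfolding set_borel_measurable_def by measurable
  qed (auto simp: set_integrable_def)
  then show ?thesis by blast
qed

lemma dominator_nonneg: "dominator \<alpha> x \<ge> 0"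
  by (cases x) (auto simp: dominator_def)

lemma integrable_dominator:
  assumes "\<alpha> > 1"
  shows "set_integrable lborel halfplane (dominator \<alpha>)"
proof -
  define k where "k = (\<lambda>r. indicator {0<..} r * (r powr (\<alpha> - 2) * (1 + r) powr (- \<alpha>)))"
  define j where "j = (\<lambda>z::real. inverse (1 + z\<^sup>2))"
  have k: "integrable lborel k" and j: "integrable lborel j"
    using integrable_radial_weight[OF assms] integrable_inverse_one_plus_square
    by (auto simp: k_def j_def set_integrable_def)
  have [measurable]: "k \<in> borel_measurable borel" "j \<in> borel_measurable borel"
    using borel_measurable_integrable[OF k] borel_measurable_integrable[OF j] by simp_all
  have "integrable (lborel \<Otimes>\<^sub>M lborel) (\<lambda>(r, z). k r * j z)"
  proof (rule lborel_pair.Fubini_integrable)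
    show "integrable lborel (\<lambda>r. LBINT z. norm (case (r, z) of (r, z) \<Rightarrow> k r * j z))"
      using k by (simp add: abs_mult)
    show "AE r in lborel. integrable lborel (\<lambda>z. case (r, z) of (r, z) \<Rightarrow> k r * j z)"
      using j by simp
  qed measurable
  moreover have "(\<lambda>(r, z). k r * j z) = (\<lambda>x. indicator halfplane x * dominator \<alpha> x)"
    by (auto simp: k_def j_def dominator_def indicator_def fun_eq_iff)
  ultimately show ?thesis by (simp add: set_integrable_def lborel_prod)
qed

lemma decays_dominated:
  assumes "decays T X"
  obtains C where "C \<ge> 0"
    "\<And>t r z. t \<in> T \<Longrightarrow> r > 0 \<Longrightarrow> \<bar>r powr (\<alpha> - 2) * X t r z\<bar> \<le> C * dominator \<alpha> (r, z)"
proof -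
  define N where "N = nat \<lceil>\<alpha>\<rceil>"
  obtain C where C: "C \<ge> 0" "\<And>t r z. t \<in> T \<Longrightarrow> r \<ge> 0 \<Longrightarrow> \<bar>X t r z\<bar> * ((1 + r) ^ N * (1 + z\<^sup>2)) \<le> C"
    by (rule decaysE[OF assms, of "N"]; blast)
  have "\<bar>r powr (\<alpha> - 2) * X t r z\<bar> \<le> C * dominator \<alpha> (r, z)" if tr: "t \<in> T" "r > 0" for t r z
  proof -
    have "(1 + r) powr \<alpha> \<le> (1 + r) powr real N"
      by (rule powr_mono) (use tr in \<open>auto simp: N_def real_nat_ceiling_ge\<close>)
    also have "\<dots> = (1 + r) ^ N" using tr by (simp add: powr_realpow)
    finally have le: "(1 + r) powr \<alpha> \<le> (1 + r) ^ N" .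
    have "\<bar>X t r z\<bar> * ((1 + r) powr \<alpha> * (1 + z\<^sup>2)) \<le> \<bar>X t r z\<bar> * ((1 + r) ^ N * (1 + z\<^sup>2))"
      using le by (intro mult_left_mono mult_right_mono) auto
    also have "\<dots> \<le> C" using C(2)[of t r z] tr by simp
    finally have le2: "\<bar>X t r z\<bar> * ((1 + r) powr \<alpha> * (1 + z\<^sup>2)) \<le> C" .
    have pos: "0 < (1 + r) powr \<alpha> * (1 + z\<^sup>2)" using tr by (intro mult_pos_pos) (auto intro: add_pos_nonneg)
    have "\<bar>X t r z\<bar> \<le> C / ((1 + r) powr \<alpha> * (1 + z\<^sup>2))"
      using le2 pos by (simp add: pos_le_divide_eq)
    also have "\<dots> = C * ((1 + r) powr (- \<alpha>) * inverse (1 + z\<^sup>2))"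
      by (simp add: powr_minus divide_inverse)
    finally have "\<bar>r powr (\<alpha> - 2)\<bar> * \<bar>X t r z\<bar> \<le> r powr (\<alpha> - 2) * (C * ((1 + r) powr (- \<alpha>) * inverse (1 + z\<^sup>2)))"
      by (simp add: mult_left_mono)
    then show ?thesis by (simp add: abs_mult dominator_def mult_ac)
  qed
  then show thesis using that C(1) by blast
qed

lemma set_borel_measurable_continuous_halfplane:
  fixes f :: "real \<times> real \<Rightarrow> real"
  assumes "continuous_on halfplane f"
  shows "set_borel_measurable lborel halfplane f"
  using borel_measurable_continuous_on_indicator[OF halfplane_sets assms]
  by (simp add: set_borel_measurable_def)

lemma decays_set_integrable:
  assumes "decays T X" "t \<in> T" "\<alpha> > 1"
    and m: "set_borel_measurable lborel halfplane (\<lambda>(r, z). r powr (\<alpha> - 2) * X t r z)"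
  shows "set_integrable lborel halfplane (\<lambda>(r, z). r powr (\<alpha> - 2) * X t r z)"
proof -
  obtain C where C: "C \<ge> 0"
    "\<And>t r z. t \<in> T \<Longrightarrow> r > 0 \<Longrightarrow> \<bar>r powr (\<alpha> - 2) * X t r z\<bar> \<le> C * dominator \<alpha> (r, z)"
    by (rule decays_dominated[OF assms(1), of \<alpha>]; blast)
  have d: "integrable lborel (\<lambda>x. C * (indicator halfplane x * dominator \<alpha> x))"
    using integrable_dominator[OF assms(3)] by (simp add: set_integrable_def)
  show ?thesis unfolding set_integrable_def
  proof (rule Bochner_Integration.integrable_bound[OF d])
    show "(\<lambda>x. indicat_real halfplane x *\<^sub>R (case x of (r, z) \<Rightarrow> r powr (\<alpha> - 2) * X t r z)) \<in> borel_measurable lborel"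
      using m by (simp add: set_borel_measurable_def)
    show "AE x in lborel. norm (indicat_real halfplane x *\<^sub>R (case x of (r, z) \<Rightarrow> r powr (\<alpha> - 2) * X t r z))
           \<le> norm (C * (indicat_real halfplane x * dominator \<alpha> x))"
      using C(2)[OF \<open>t \<in> T\<close>] C(1) dominator_nonneg
      by (intro AE_I2) (auto simp: indicator_def abs_mult)
  qed
qed

lemma decays_tendsto_axis:
  assumes "decays T X" "t \<in> T" "\<alpha> > 1"
  shows "((\<lambda>r. r powr (\<alpha> - 1) * X t r z) \<longlongrightarrow> 0) (at_right 0)"
proof -
  obtain B where B: "B \<ge> 0" "\<And>t r z. t \<in> T \<Longrightarrow> r \<ge> 0 \<Longrightarrow> \<bar>X t r z\<bar> \<le> B"
    by (rule decays_bounded[OF assms(1)]; blast)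
  have "((\<lambda>r::real. \<bar>r\<bar> powr (\<alpha> - 1)) \<longlongrightarrow> 0) (at_right 0)"
    using tendsto_abs_powr_0[of "\<alpha> - 1"] assms(3) by (auto intro: filterlim_mono at_le)
  then have lim: "((\<lambda>r::real. B * \<bar>r\<bar> powr (\<alpha> - 1)) \<longlongrightarrow> 0) (at_right 0)"
    by (rule tendsto_mult_right_zero)
  show ?thesis
  proof (rule Lim_null_comparison[OF _ lim])
    show "\<forall>\<^sub>F r in at_right 0. norm (r powr (\<alpha> - 1) * X t r z) \<le> B * \<bar>r\<bar> powr (\<alpha> - 1)"
      using eventually_at_right_less[of 0]
      by eventually_elim (use B(2)[OF \<open>t \<in> T\<close>] in \<open>auto simp: abs_mult mult.commute intro!: mult_right_mono\<close>)
  qed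
qed

lemma decays_tendsto_radial:
  assumes "decays T X" "t \<in> T"
  shows "((\<lambda>r. r powr (\<alpha> - 1) * X t r z) \<longlongrightarrow> 0) at_top"
proof -
  define N where "N = nat \<lceil>\<alpha>\<rceil>"
  obtain D where D: "D \<ge> 0" "\<And>t r z. t \<in> T \<Longrightarrow> r \<ge> 0 \<Longrightarrow> \<bar>X t r z\<bar> * ((1 + r) ^ N * (1 + z\<^sup>2)) \<le> D"
    by (rule decaysE[OF assms(1), of "N"]; blast)
  have lim: "((\<lambda>r::real. D * inverse r) \<longlongrightarrow> 0) at_top"
    by (intro tendsto_mult_right_zero tendsto_inverse_0_at_top filterlim_ident)
  show ?thesis
  proof (rule Lim_null_comparison[OF _ lim])
    show "\<forall>\<^sub>F r in at_top. norm (r powr (\<alpha> - 1) * X t r z) \<le> D * inverse r"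
      using eventually_ge_at_top[of 1]
    proof eventually_elim
      case (elim r)
      have "r powr \<alpha> \<le> r powr real N"
        by (rule powr_mono) (use elim in \<open>auto simp: N_def real_nat_ceiling_ge\<close>)
      also have "\<dots> = r ^ N" using elim by (simp add: powr_realpow)
      also have "\<dots> \<le> (1 + r) ^ N" using elim by (intro power_mono) auto
      also have "\<dots> \<le> (1 + r) ^ N * (1 + z\<^sup>2)" using elim by simp
      finally have "\<bar>X t r z\<bar> * r powr \<alpha> \<le> \<bar>X t r z\<bar> * ((1 + r) ^ N * (1 + z\<^sup>2))"
        by (rule mult_left_mono) simp
      also have "\<dots> \<le> D" using D(2)[OF \<open>t \<in> T\<close>, of r z] elim by simp
      finally have "\<bar>X t r z\<bar> * r powr \<alpha> * inverse r \<le> D * inverse r"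
        using elim by (intro mult_right_mono) auto
      then show ?case using elim by (simp add: powr_diff abs_mult divide_inverse mult_ac)
    qed
  qed
qed

lemma decays_tendsto_axial:
  assumes "decays T X" "t \<in> T" "r \<ge> 0"
  shows "((\<lambda>z. c * X t r z) \<longlongrightarrow> 0) at_top" "((\<lambda>z. c * X t r z) \<longlongrightarrow> 0) at_bot"
proof -
  obtain C where "C \<ge> 0" and C: "\<And>t r z. t \<in> T \<Longrightarrow> r \<ge> 0 \<Longrightarrow> \<bar>X t r z\<bar> * ((1 + r) ^ 0 * (1 + z\<^sup>2)) \<le> C"
    by (rule decaysE[OF assms(1), of "0"]; blast)
  have le: "norm (c * X t r z) \<le> \<bar>c\<bar> * (C * inverse (1 + z\<^sup>2))" for z
  proof -
    have "0 < 1 + z\<^sup>2" by (rule add_pos_nonneg) auto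
    then have "\<bar>X t r z\<bar> \<le> C * inverse (1 + z\<^sup>2)"
      using C[OF assms(2,3), of z] by (simp add: field_simps)
    then show ?thesis by (simp add: abs_mult mult_left_mono)
  qed
  have "filterlim (\<lambda>z::real. 1 + z\<^sup>2) at_top at_top"
    by (intro filterlim_tendsto_add_at_top[OF tendsto_const] filterlim_pow_at_top filterlim_ident) simp_all
  then have "((\<lambda>z::real. inverse (1 + z\<^sup>2)) \<longlongrightarrow> 0) at_top"
    by (rule tendsto_inverse_0_at_top)
  then have "((\<lambda>z::real. \<bar>c\<bar> * (C * inverse (1 + z\<^sup>2))) \<longlongrightarrow> 0) at_top"
    by (intro tendsto_mult_right_zero)
  then show "((\<lambda>z. c * X t r z) \<longlongrightarrow> 0) at_top"
    by (rule Lim_null_comparison[rotated]) (use le in auto)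
  have "filterlim (\<lambda>z::real. 1 + z\<^sup>2) at_top at_bot"
    by (intro filterlim_tendsto_add_at_top[OF tendsto_const] filterlim_pow_at_bot_even filterlim_ident) simp_all
  then have "((\<lambda>z::real. inverse (1 + z\<^sup>2)) \<longlongrightarrow> 0) at_bot"
    by (rule tendsto_inverse_0_at_top)
  then have "((\<lambda>z::real. \<bar>c\<bar> * (C * inverse (1 + z\<^sup>2))) \<longlongrightarrow> 0) at_bot"
    by (intro tendsto_mult_right_zero)
  then show "((\<lambda>z. c * X t r z) \<longlongrightarrow> 0) at_bot"
    by (rule Lim_null_comparison[rotated]) (use le in auto)
qed

section \<open>The weighted energy identity in the half-plane\<close>

text \<open>A class of profiles at a fixed time that is closed under all operations building the
  integrands of the energy identity.\<close>

definition tame :: "(real \<Rightarrow> real \<Rightarrow> real) \<Rightarrow> bool" where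
  "tame X \<longleftrightarrow> continuous_on halfplane (\<lambda>(r, z). X r z) \<and> decays UNIV (\<lambda>_. X)"

lemma tameI:
  assumes "continuous_on halfplane (\<lambda>(r, z). X r z)" "decays {t} (\<lambda>_. X)"
  shows "tame X"
  using assms unfolding tame_def decays_def by auto

lemma continuous_on_halfplane_case:
  "continuous_on halfplane (\<lambda>(r, z). X r z) \<longleftrightarrow> continuous_on halfplane (\<lambda>x. X (fst x) (snd x))"
  by (simp add: case_prod_unfold)

lemma tame_add: "tame X \<Longrightarrow> tame Y \<Longrightarrow> tame (\<lambda>r z. X r z + Y r z)"
  unfolding tame_def continuous_on_halfplane_case
  using decays_add[of UNIV "\<lambda>_. X" "\<lambda>_. Y"] by (auto intro!: continuous_intros)

lemma tame_diff: "tame X \<Longrightarrow> tame Y \<Longrightarrow> tame (\<lambda>r z. X r z - Y r z)"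
  unfolding tame_def continuous_on_halfplane_case
  using decays_diff[of UNIV "\<lambda>_. X" "\<lambda>_. Y"] by (auto intro!: continuous_intros)

lemma tame_mult: "tame X \<Longrightarrow> tame Y \<Longrightarrow> tame (\<lambda>r z. X r z * Y r z)"
  unfolding tame_def continuous_on_halfplane_case
  using decays_mult[of UNIV "\<lambda>_. Y" "\<lambda>_. X"] by (auto intro!: continuous_intros)

lemma tame_cmult: "tame X \<Longrightarrow> tame (\<lambda>r z. c * X r z)"
  unfolding tame_def continuous_on_halfplane_case
  using decays_cmult[of UNIV "\<lambda>_. X"] by (auto intro!: continuous_intros)

lemma tame_power_r: "tame X \<Longrightarrow> tame (\<lambda>r z. r ^ k * X r z)"
  unfolding tame_def continuous_on_halfplane_case
  using decays_power_r[of UNIV "\<lambda>_. X"] by (auto intro!: continuous_intros)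

lemma tame_mult_r: "tame X \<Longrightarrow> tame (\<lambda>r z. r * X r z)"
  using tame_power_r[of X 1] by simp

lemma tame_sgn_powr_mult: "tame F \<Longrightarrow> tame X \<Longrightarrow> q > 0 \<Longrightarrow> tame (\<lambda>r z. sgn_powr q (F r z) * X r z)"
  unfolding tame_def continuous_on_halfplane_case
  using decays_sgn_powr_mult[of UNIV "\<lambda>_. X" "\<lambda>_. F" q] by (auto intro!: continuous_intros)

lemma tame_abs_powr: "tame F \<Longrightarrow> p > 1 \<Longrightarrow> tame (\<lambda>r z. \<bar>F r z\<bar> powr p)"
  unfolding tame_def continuous_on_halfplane_case
  using decays_abs_powr[of UNIV "\<lambda>_. F" p] by (auto intro!: continuous_intros)

lemmas tame_intros = tame_add tame_diff tame_cmult tame_power_r tame_mult_r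
  tame_sgn_powr_mult tame_abs_powr tame_mult

lemma tame_set_integrable:
  assumes "tame X" "\<alpha> > 1"
  shows "set_integrable lborel halfplane (\<lambda>(r, z). r powr (\<alpha> - 2) * X r z)"
proof (rule decays_set_integrable[of UNIV "\<lambda>_. X" 0])
  show "set_borel_measurable lborel halfplane (\<lambda>(r, z). r powr (\<alpha> - 2) * X r z)"
    by (rule set_borel_measurable_continuous_halfplane)
      (use assms(1) in \<open>auto simp: tame_def case_prod_unfold halfplane_def intro!: continuous_intros\<close>)
qed (use assms in \<open>auto simp: tame_def\<close>)

text \<open>Every integrand is written with the weight $r^{\alpha-2}$ and the remaining integer powers of
  $r$ as factors, so that one integrability statement covers all of them.\<close>

definition weighted_integral :: "real \<Rightarrow> (real \<Rightarrow> real \<Rightarrow> real) \<Rightarrow> real" where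
  "weighted_integral \<alpha> X = (LINT x:halfplane|lborel. (case x of (r, z) \<Rightarrow> r powr (\<alpha> - 2) * X r z))"

lemma weighted_integral_add:
  assumes "tame X" "tame Y" "\<alpha> > 1"
  shows "weighted_integral \<alpha> (\<lambda>r z. X r z + Y r z) = weighted_integral \<alpha> X + weighted_integral \<alpha> Y"
  using set_integral_add(2)[OF tame_set_integrable[OF assms(1,3)] tame_set_integrable[OF assms(2,3)]]
  unfolding weighted_integral_def by (simp add: case_prod_unfold distrib_left)

lemma weighted_integral_cmult: "weighted_integral \<alpha> (\<lambda>r z. c * X r z) = c * weighted_integral \<alpha> X"
  unfolding weighted_integral_def
  by (subst set_integral_mult_right[symmetric]) (simp add: case_prod_unfold mult.left_commute)

lemma weighted_integral_cong:
  assumes "\<And>r z. r > 0 \<Longrightarrow> X r z = Y r z"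
  shows "weighted_integral \<alpha> X = weighted_integral \<alpha> Y"
  unfolding weighted_integral_def by (rule set_lebesgue_integral_cong) (use assms in auto)

lemma set_borel_measurable_quadratic:
  fixes X Y :: "real \<Rightarrow> real \<Rightarrow> real"
  assumes X: "continuous_on halfplane (\<lambda>(r, z). X r z)" and Y: "continuous_on halfplane (\<lambda>(r, z). Y r z)"
  shows "set_borel_measurable lborel halfplane (\<lambda>(r, z). r powr \<beta> * (c * (r\<^sup>2 * (\<bar>X r z\<bar> powr s * (Y r z)\<^sup>2))))"
proof -
  define X' where "X' = (\<lambda>x. indicator halfplane x * (case x of (r, z) \<Rightarrow> X r z))"
  define Y' where "Y' = (\<lambda>x. indicator halfplane x * (case x of (r, z) \<Rightarrow> Y r z))"
  have [measurable]: "X' \<in> borel_measurable borel" "Y' \<in> borel_measurable borel"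
    using borel_measurable_continuous_on_indicator[OF halfplane_sets X]
      borel_measurable_continuous_on_indicator[OF halfplane_sets Y] by (simp_all add: X'_def Y'_def)
  have "(\<lambda>x. indicator halfplane x *\<^sub>R (case x of (r, z) \<Rightarrow> r powr \<beta> * (c * (r\<^sup>2 * (\<bar>X r z\<bar> powr s * (Y r z)\<^sup>2)))))
     = (\<lambda>x. indicator halfplane x * (fst x powr \<beta> * (c * ((fst x)\<^sup>2 * (\<bar>X' x\<bar> powr s * (Y' x)\<^sup>2)))))"
    by (auto simp: X'_def Y'_def indicator_def)
  moreover have "(\<lambda>x. indicator halfplane x * (fst x powr \<beta> * (c * ((fst x)\<^sup>2 * (\<bar>X' x\<bar> powr s * (Y' x)\<^sup>2))))) \<in> borel_measurable borel"
  proof -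
    have [measurable]: "(fst :: real \<times> real \<Rightarrow> real) \<in> borel_measurable borel"
      by (intro borel_measurable_continuous_onI continuous_intros)
    show ?thesis by measurable
  qed
  ultimately show ?thesis by (simp add: set_borel_measurable_def)
qed

text \<open>The data of the energy identity at one instant: \<open>F\<close> is the transported quantity, \<open>a\<close> and \<open>w\<close> are
  the radial and axial velocities, and suffixes stand for partial derivatives.\<close>

locale weighted_transport =
  fixes p \<alpha> \<nu> :: real and F Fr Fz Frr Fzz a ar w wz :: "real \<Rightarrow> real \<Rightarrow> real"
  assumes p: "p > 1" and \<alpha>: "\<alpha> > 1" and \<nu>: "\<nu> > 0"
    and F_r: "\<And>r z. r > 0 \<Longrightarrow> ((\<lambda>r. F r z) has_real_derivative Fr r z) (at r)"
    and F_z: "\<And>r z. r > 0 \<Longrightarrow> ((\<lambda>z. F r z) has_real_derivative Fz r z) (at z)"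
    and F_rr: "\<And>r z. r > 0 \<Longrightarrow> ((\<lambda>r. Fr r z) has_real_derivative Frr r z) (at r)"
    and F_zz: "\<And>r z. r > 0 \<Longrightarrow> ((\<lambda>z. Fz r z) has_real_derivative Fzz r z) (at z)"
    and a_r: "\<And>r z. r > 0 \<Longrightarrow> ((\<lambda>r. a r z) has_real_derivative ar r z) (at r)"
    and w_z: "\<And>r z. r > 0 \<Longrightarrow> ((\<lambda>z. w r z) has_real_derivative wz r z) (at z)"
    and tame: "tame F" "tame Fr" "tame Fz" "tame Frr" "tame Fzz" "tame a" "tame ar" "tame w" "tame wz"
    and incompressible: "\<And>r z. r > 0 \<Longrightarrow> ar r z + a r z / r + wz r z = 0"
begin

abbreviation g :: "real \<Rightarrow> real \<Rightarrow> real" where "g r z \<equiv> sgn_powr (p - 1) (F r z)"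

abbreviation Fp :: "real \<Rightarrow> real \<Rightarrow> real" where "Fp r z \<equiv> \<bar>F r z\<bar> powr p"

lemma Fp_r: "r > 0 \<Longrightarrow> ((\<lambda>r. Fp r z) has_real_derivative p * (g r z * Fr r z)) (at r)"
  using DERIV_chain2[OF DERIV_abs_powr[OF p] F_r] by (simp add: mult.assoc)

lemma Fp_z: "r > 0 \<Longrightarrow> ((\<lambda>z. Fp r z) has_real_derivative p * (g r z * Fz r z)) (at z)"
  using DERIV_chain2[OF DERIV_abs_powr[OF p] F_z] by (simp add: mult.assoc)

lemma gFr_r:
  assumes "r > 0" "F r z \<noteq> 0 \<or> Fr r z = 0"
  shows "((\<lambda>r. g r z * Fr r z) has_real_derivative
     (p - 1) * (\<bar>F r z\<bar> powr (p - 2) * (Fr r z)\<^sup>2) + g r z * Frr r z) (at r)"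
  using DERIV_sgn_powr_mult_derivative[of "p - 1" "\<lambda>r. F r z" "\<lambda>r. Fr r z" r "Frr r z"] p F_r F_rr assms
  by (simp add: mult.assoc)

lemma gFz_z:
  assumes "r > 0" "F r z \<noteq> 0 \<or> Fz r z = 0"
  shows "((\<lambda>z. g r z * Fz r z) has_real_derivative
     (p - 1) * (\<bar>F r z\<bar> powr (p - 2) * (Fz r z)\<^sup>2) + g r z * Fzz r z) (at z)"
  using DERIV_sgn_powr_mult_derivative[of "p - 1" "\<lambda>z. F r z" "\<lambda>z. Fz r z" z "Fzz r z"] p F_z F_zz assms
  by (simp add: mult.assoc)

definition radial_dissipation :: "real \<times> real \<Rightarrow> real" where
  "radial_dissipation = (\<lambda>(r, z). r powr (\<alpha> - 2) * (\<nu> * (p - 1) * (r\<^sup>2 * (\<bar>F r z\<bar> powr (p - 2) * (Fr r z)\<^sup>2))))"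

definition axial_dissipation :: "real \<times> real \<Rightarrow> real" where
  "axial_dissipation = (\<lambda>(r, z). r powr (\<alpha> - 2) * (\<nu> * (p - 1) * (r\<^sup>2 * (\<bar>F r z\<bar> powr (p - 2) * (Fz r z)\<^sup>2))))"

text \<open>What is left of the radial derivative of
  $r^{\alpha-1} (\nu r |F|^{p-2} F F_r + \nu \frac{3-\alpha}{p} |F|^p - \frac1p r a |F|^p)$ after removing the
  dissipation. This flux collects the radial diffusion, the correction due to the weight, and the
  radial transport, so that a single integration by parts treats the three together.\<close>

abbreviation radial_source :: "real \<Rightarrow> real \<Rightarrow> real" where
  "radial_source r z \<equiv> \<nu> * (r ^ 2 * (g r z * Frr r z) + 3 * (r * (g r z * Fr r z)))
     + \<nu> * (3 - \<alpha>) * (\<alpha> - 1) / p * Fp r z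
     - (1 / p) * ((\<alpha> * (r * a r z) + r ^ 2 * ar r z) * Fp r z) - r ^ 2 * (a r z * (g r z * Fr r z))"

text \<open>The corresponding remainder for the axial flux
  $r^\alpha (\nu |F|^{p-2} F F_z - \frac1p w |F|^p)$.\<close>

abbreviation axial_source :: "real \<Rightarrow> real \<Rightarrow> real" where
  "axial_source r z \<equiv> r ^ 2 * (\<nu> * (g r z * Fzz r z) - (1 / p) * (wz r z * Fp r z) - w r z * (g r z * Fz r z))"

lemma tame_radial_source: "tame radial_source"
  by (rule tame tame_intros | use p in simp)+

lemma tame_axial_source: "tame axial_source"
  by (rule tame tame_intros | use p in simp)+

lemma radial_identity:
  "set_integrable lborel halfplane radial_dissipation
    \<and> (LINT x:halfplane|lborel. radial_dissipation x) = - weighted_integral \<alpha> radial_source"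
proof -
  define X where "X = (\<lambda>r z. \<nu> * (r * (g r z * Fr r z)) + \<nu> * (3 - \<alpha>) / p * Fp r z - (1 / p) * (r * (a r z * Fp r z)))"
  have tX: "tame X" unfolding X_def by (rule tame tame_intros | use p in simp)+
  define P where "P = (\<lambda>(r, z). r powr (\<alpha> - 1) * X r z)"
  define B where "B = (\<lambda>(r, z). r powr (\<alpha> - 2) * radial_source r z)"
  have cX: "continuous_on halfplane (\<lambda>(r, z). X r z)" using tX by (simp add: tame_def)
  have "set_integrable lborel halfplane radial_dissipation
    \<and> (LINT x:halfplane|lborel. radial_dissipation x) = - (LINT x:halfplane|lborel. B x)"
  proof (rule radial_integration_by_parts[where P=P and K="\<lambda>z. {r \<in> {0<..}. F r z = 0 \<and> Fr r z \<noteq> 0}"])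
    show "((\<lambda>r. P (r, z)) \<longlongrightarrow> 0) (at_right 0)" for z
      using decays_tendsto_axis[of UNIV "\<lambda>_. X" 0 \<alpha>] tX \<alpha> by (simp add: P_def tame_def)
    show "((\<lambda>r. P (r, z)) \<longlongrightarrow> 0) at_top" for z
      using decays_tendsto_radial[of UNIV "\<lambda>_. X" 0 \<alpha>] tX by (simp add: P_def tame_def)
    show "countable {r \<in> {0<..}. F r z = 0 \<and> Fr r z \<noteq> 0}" for z
      by (rule countable_simple_zeros) (use F_r in auto)
    show "continuous_on {0<..} (\<lambda>r. P (r, z))" for z
      unfolding P_def case_prod_conv
      by (intro continuous_intros continuous_on_compose2[OF cX, of _ "\<lambda>r. (r, z)", simplified]) (auto simp: halfplane_def)
    show "set_integrable lborel halfplane B"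
      unfolding B_def by (rule tame_set_integrable[OF tame_radial_source \<alpha>])
    show "set_borel_measurable lborel halfplane radial_dissipation"
      unfolding radial_dissipation_def
      by (rule set_borel_measurable_quadratic) (use tame in \<open>auto simp: tame_def\<close>)
    show "radial_dissipation (r, z) \<ge> 0" for r z
      using p \<nu> by (simp add: radial_dissipation_def)
    fix r z :: real assume r: "r > 0" "r \<notin> {r \<in> {0<..}. F r z = 0 \<and> Fr r z \<noteq> 0}"
    define Q where "Q = \<bar>F r z\<bar> powr (p - 2) * (Fr r z)\<^sup>2"
    have dg: "((\<lambda>r. g r z * Fr r z) has_real_derivative (p - 1) * Q + g r z * Frr r z) (at r)"
      unfolding Q_def using r by (intro gFr_r) auto
    have dX: "((\<lambda>r. X r z) has_real_derivative
        \<nu> * (g r z * Fr r z + r * ((p - 1) * Q + g r z * Frr r z))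
          + \<nu> * (3 - \<alpha>) / p * (p * (g r z * Fr r z))
          - (1 / p) * (a r z * Fp r z + r * (ar r z * Fp r z + a r z * (p * (g r z * Fr r z))))) (at r)"
      unfolding X_def
      by (rule derivative_eq_intros dg Fp_r a_r r refl)+ (simp add: algebra_simps)
    have dpow: "((\<lambda>r. r powr (\<alpha> - 1)) has_real_derivative (\<alpha> - 1) * r powr (\<alpha> - 2)) (at r)"
      using has_real_derivative_powr[OF r(1), of "\<alpha> - 1"] by simp
    have rp: "r powr (\<alpha> - 1) = r powr (\<alpha> - 2) * r"
      using r(1) powr_add[of r "\<alpha> - 2" 1] by simp
    have "((\<lambda>r. P (r, z)) has_real_derivative
        (\<alpha> - 1) * r powr (\<alpha> - 2) * X r z + (\<nu> * (g r z * Fr r z + r * ((p - 1) * Q + g r z * Frr r z))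
          + \<nu> * (3 - \<alpha>) / p * (p * (g r z * Fr r z))
          - (1 / p) * (a r z * Fp r z + r * (ar r z * Fp r z + a r z * (p * (g r z * Fr r z))))) * r powr (\<alpha> - 1)) (at r)"
      unfolding P_def case_prod_conv by (rule DERIV_mult[OF dpow dX])
    moreover have "(\<alpha> - 1) * r powr (\<alpha> - 2) * X r z + (\<nu> * (g r z * Fr r z + r * ((p - 1) * Q + g r z * Frr r z))
          + \<nu> * (3 - \<alpha>) / p * (p * (g r z * Fr r z))
          - (1 / p) * (a r z * Fp r z + r * (ar r z * Fp r z + a r z * (p * (g r z * Fr r z))))) * r powr (\<alpha> - 1)
        = radial_dissipation (r, z) + B (r, z)"
      unfolding rp radial_dissipation_def B_def case_prod_conv Q_def[symmetric] X_def
      using p by (simp add: field_simps power2_eq_square)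
    ultimately show "((\<lambda>r. P (r, z)) has_real_derivative radial_dissipation (r, z) + B (r, z)) (at r)"
      by simp
  qed
  then show ?thesis by (simp add: weighted_integral_def B_def)
qed

lemma axial_identity:
  "set_integrable lborel halfplane axial_dissipation
    \<and> (LINT x:halfplane|lborel. axial_dissipation x) = - weighted_integral \<alpha> axial_source"
proof -
  define Y where "Y = (\<lambda>r z. \<nu> * (g r z * Fz r z) - (1 / p) * (w r z * Fp r z))"
  have tY: "tame Y" unfolding Y_def by (rule tame tame_intros | use p in simp)+
  define P where "P = (\<lambda>(r, z). r powr (\<alpha> - 2) * r\<^sup>2 * Y r z)"
  define B where "B = (\<lambda>(r, z). r powr (\<alpha> - 2) * axial_source r z)"
  have cY: "continuous_on halfplane (\<lambda>(r, z). Y r z)" using tY by (simp add: tame_def)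
  have "set_integrable lborel halfplane axial_dissipation
    \<and> (LINT x:halfplane|lborel. axial_dissipation x) = - (LINT x:halfplane|lborel. B x)"
  proof (rule axial_integration_by_parts[where P=P and K="\<lambda>r. {z \<in> UNIV. F r z = 0 \<and> Fz r z \<noteq> 0}"])
    fix r :: real assume r: "r > 0"
    show "((\<lambda>z. P (r, z)) \<longlongrightarrow> 0) at_top" "((\<lambda>z. P (r, z)) \<longlongrightarrow> 0) at_bot"
      using decays_tendsto_axial[of UNIV "\<lambda>_. Y" 0 r] tY r by (simp_all add: P_def tame_def)
    show "countable {z \<in> UNIV. F r z = 0 \<and> Fz r z \<noteq> 0}"
      by (rule countable_simple_zeros) (use F_z r in auto)
    show "continuous_on UNIV (\<lambda>z. P (r, z))"
      unfolding P_def case_prod_conv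
      by (intro continuous_intros continuous_on_compose2[OF cY, of _ "\<lambda>z. (r, z)", simplified])
        (use r in \<open>auto simp: halfplane_def\<close>)
  next
    show "set_integrable lborel halfplane B"
      unfolding B_def by (rule tame_set_integrable[OF tame_axial_source \<alpha>])
    show "set_borel_measurable lborel halfplane axial_dissipation"
      unfolding axial_dissipation_def
      by (rule set_borel_measurable_quadratic) (use tame in \<open>auto simp: tame_def\<close>)
    show "axial_dissipation (r, z) \<ge> 0" for r z
      using p \<nu> by (simp add: axial_dissipation_def)
    fix r z :: real assume r: "r > 0" "z \<notin> {z \<in> UNIV. F r z = 0 \<and> Fz r z \<noteq> 0}"
    define Q where "Q = \<bar>F r z\<bar> powr (p - 2) * (Fz r z)\<^sup>2"
    have dg: "((\<lambda>z. g r z * Fz r z) has_real_derivative (p - 1) * Q + g r z * Fzz r z) (at z)"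
      unfolding Q_def using r by (intro gFz_z) auto
    have "((\<lambda>z. P (r, z)) has_real_derivative r powr (\<alpha> - 2) * r\<^sup>2 *
        (\<nu> * ((p - 1) * Q + g r z * Fzz r z) - (1 / p) * (wz r z * Fp r z + w r z * (p * (g r z * Fz r z))))) (at z)"
      unfolding P_def Y_def case_prod_conv
      by (rule derivative_eq_intros dg Fp_z w_z r refl)+ (simp add: algebra_simps)
    moreover have "r powr (\<alpha> - 2) * r\<^sup>2 *
        (\<nu> * ((p - 1) * Q + g r z * Fzz r z) - (1 / p) * (wz r z * Fp r z + w r z * (p * (g r z * Fz r z))))
        = axial_dissipation (r, z) + B (r, z)"
      unfolding axial_dissipation_def B_def case_prod_conv Q_def[symmetric]
      using p by (simp add: field_simps power2_eq_square)
    ultimately show "((\<lambda>z. P (r, z)) has_real_derivative axial_dissipation (r, z) + B (r, z)) (at z)"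
      by simp
  qed
  then show ?thesis by (simp add: weighted_integral_def B_def)
qed

definition dissipation :: "real \<times> real \<Rightarrow> real" where
  "dissipation = (\<lambda>(r, z). r powr \<alpha> * (\<bar>F r z\<bar> powr (p - 2) * ((Fr r z)\<^sup>2 + (Fz r z)\<^sup>2)))"

text \<open>Adding the two remainders, incompressibility eliminates the derivatives of the velocity and
  leaves $|F|^{p-2} F$ times the right-hand side of the equation for $F$, plus multiples of $|F|^p$
  and $r a |F|^p$. Here \<open>G\<close> stands for $r^2 F_t$.\<close>

lemma energy_identity:
  assumes G: "\<And>r z. r > 0 \<Longrightarrow> G r z
    = r\<^sup>2 * (\<nu> * (Frr r z + 3 / r * Fr r z + Fzz r z) - a r z * Fr r z - w r z * Fz r z - 2 * (a r z / r) * F r z)"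
  shows "set_integrable lborel halfplane dissipation"
    and "weighted_integral \<alpha> (\<lambda>r z. g r z * G r z) + \<nu> * (p - 1) * (LINT x:halfplane|lborel. dissipation x)
       + \<nu> * ((3 - \<alpha>) * (\<alpha> - 1) / p) * weighted_integral \<alpha> Fp
       = (\<alpha> - (2 * p + 1)) / p * weighted_integral \<alpha> (\<lambda>r z. r * (a r z * Fp r z))"
proof -
  define S where "S = (\<lambda>r z. radial_source r z + axial_source r z)"
  define R where "R = (\<lambda>r z. \<nu> * ((3 - \<alpha>) * (\<alpha> - 1) / p) * Fp r z
       + - ((\<alpha> - (2 * p + 1)) / p) * (r * (a r z * Fp r z)))"
  have tS: "tame S" unfolding S_def by (rule tame_add[OF tame_radial_source tame_axial_source])
  have tR: "tame R" unfolding R_def by (rule tame tame_intros | use p in simp)+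
  have c: "\<nu> * (p - 1) > 0" using p \<nu> by simp
  have diss: "\<nu> * (p - 1) * dissipation x = radial_dissipation x + axial_dissipation x" if "x \<in> halfplane" for x
  proof -
    obtain r z where x: "x = (r, z)" by (cases x)
    have "r powr \<alpha> = r powr (\<alpha> - 2) * r\<^sup>2"
      using that powr_add[of r "\<alpha> - 2" 2] by (simp add: x)
    then show ?thesis unfolding x dissipation_def radial_dissipation_def axial_dissipation_def case_prod_conv
      by (simp add: algebra_simps)
  qed
  have sum: "set_integrable lborel halfplane (\<lambda>x. radial_dissipation x + axial_dissipation x)"
    using radial_identity axial_identity by (intro set_integral_add) auto
  then have "set_integrable lborel halfplane (\<lambda>x. \<nu> * (p - 1) * dissipation x)"
    by (subst set_integrable_cong[OF refl refl diss]) 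
  then show int: "set_integrable lborel halfplane dissipation"
    by (subst (asm) set_integrable_mult_right_iff) (use c in auto)
  have "\<nu> * (p - 1) * (LINT x:halfplane|lborel. dissipation x)
      = (LINT x:halfplane|lborel. radial_dissipation x + axial_dissipation x)"
    unfolding set_integral_mult_right[symmetric]
    by (rule set_lebesgue_integral_cong) (use diss in auto)
  also have "\<dots> = - (weighted_integral \<alpha> radial_source + weighted_integral \<alpha> axial_source)"
    using radial_identity axial_identity by (subst set_integral_add) auto
  also have "weighted_integral \<alpha> radial_source + weighted_integral \<alpha> axial_source = weighted_integral \<alpha> S"
    unfolding S_def by (rule weighted_integral_add[symmetric, OF tame_radial_source tame_axial_source \<alpha>])
  also have "\<dots> = weighted_integral \<alpha> (\<lambda>r z. (S r z - R r z) + R r z)" by simp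
  also have "\<dots> = weighted_integral \<alpha> (\<lambda>r z. S r z - R r z) + weighted_integral \<alpha> R"
    by (rule weighted_integral_add[OF tame_diff[OF tS tR] tR \<alpha>])
  also have "weighted_integral \<alpha> (\<lambda>r z. S r z - R r z) = weighted_integral \<alpha> (\<lambda>r z. g r z * G r z)"
  proof (rule weighted_integral_cong)
    fix r z :: real assume r: "r > 0"
    have wz: "wz r z = - ar r z - a r z / r" using incompressible[OF r, of z] by linarith
    have Fp: "Fp r z = F r z * g r z" by (simp add: sgn_powr_mult_self)
    show "S r z - R r z = g r z * G r z"
      unfolding S_def R_def G[OF r] wz Fp using r p by (simp add: field_simps power2_eq_square)
  qed
  also have "weighted_integral \<alpha> R = \<nu> * ((3 - \<alpha>) * (\<alpha> - 1) / p) * weighted_integral \<alpha> Fp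
       + - ((\<alpha> - (2 * p + 1)) / p) * weighted_integral \<alpha> (\<lambda>r z. r * (a r z * Fp r z))"
    unfolding R_def
    unfolding weighted_integral_cmult[symmetric]
    by (rule weighted_integral_add) (rule tame \<alpha> tame_intros | use p in simp)+
  finally show "weighted_integral \<alpha> (\<lambda>r z. g r z * G r z) + \<nu> * (p - 1) * (LINT x:halfplane|lborel. dissipation x)
       + \<nu> * ((3 - \<alpha>) * (\<alpha> - 1) / p) * weighted_integral \<alpha> Fp
       = (\<alpha> - (2 * p + 1)) / p * weighted_integral \<alpha> (\<lambda>r z. r * (a r z * Fp r z))"
    by simp
qed

end

section \<open>Smooth space-time fields and rotations about the axis\<close>

lemma smooth_on_differentiable: "smooth_on S f \<Longrightarrow> x \<in> S \<Longrightarrow> f differentiable (at x)"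
  unfolding smooth_on_def by (metis C_on.simps(2))

lemma smooth_on_frechet_derivative:
  "smooth_on S f \<Longrightarrow> smooth_on S (\<lambda>x. frechet_derivative f (at x) v)"
  unfolding smooth_on_def by (metis C_on.simps(2))

lemma has_derivative_time_slice:
  assumes "smooth_on (I \<times> UNIV) f" "t \<in> I"
  shows "((\<lambda>x. f (t, x)) has_derivative (\<lambda>h. frechet_derivative f (at (t, x)) (0, h))) (at x)"
proof -
  have "(f has_derivative frechet_derivative f (at (t, x))) (at (t, x))"
    using smooth_on_differentiable[OF assms(1)] assms(2) by (simp add: frechet_derivative_works)
  moreover have "((\<lambda>x. (t, x)) has_derivative (\<lambda>h. (0, h))) (at x)"
    by (intro derivative_eq_intros) auto
  ultimately show ?thesis using has_derivative_compose[of "\<lambda>x. (t, x)"] by blast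
qed

text \<open>Iterated spatial derivatives at a fixed time are time slices of one smooth space-time function,
  which makes them differentiable in space.\<close>

lemma smooth_on_pds:
  fixes f :: "real \<times> (real^3) \<Rightarrow> 'b::real_normed_vector"
  assumes "smooth_on (I \<times> UNIV) f"
  shows "\<exists>g. smooth_on (I \<times> UNIV) g \<and> (\<forall>t\<in>I. pds js (\<lambda>x. f (t, x)) = (\<lambda>x. g (t, x)))"
proof (induction js)
  case Nil
  then show ?case using assms by auto
next
  case (Cons j js)
  then obtain g where g: "smooth_on (I \<times> UNIV) g" "\<forall>t\<in>I. pds js (\<lambda>x. f (t, x)) = (\<lambda>x. g (t, x))"
    by blast
  have "pds (j # js) (\<lambda>x. f (t, x)) = (\<lambda>x. frechet_derivative g (at (t, x)) (0, axis j 1))" if "t \<in> I" for t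
  proof -
    have "pds js (\<lambda>x. f (t, x)) = (\<lambda>x. g (t, x))" using g(2) that by blast
    then show ?thesis
      unfolding pds.simps pd_def
      by (simp only: frechet_derivative_at[OF has_derivative_time_slice[OF g(1) that], symmetric])
  qed
  then show ?case
    by (intro exI[of _ "\<lambda>x. frechet_derivative g (at x) (0, axis j 1)"])
      (auto intro: smooth_on_frechet_derivative g)
qed

lemma smooth_on_pds_differentiable:
  fixes f :: "real \<Rightarrow> real^3 \<Rightarrow> 'b::real_normed_vector"
  assumes "smooth_on (I \<times> UNIV) (\<lambda>(t, x). f t x)" "t \<in> I"
  shows "pds js (f t) differentiable (at x)"
proof -
  obtain g where g: "smooth_on (I \<times> UNIV) g" "\<forall>t\<in>I. pds js (\<lambda>x. f t x) = (\<lambda>x. g (t, x))"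
    using smooth_on_pds[OF assms(1)] by auto
  then have "pds js (f t) = (\<lambda>x. g (t, x))" using assms(2) by auto
  then show ?thesis
    using has_derivative_time_slice[OF g(1) assms(2)] by (auto simp: differentiable_def)
qed

lemma smooth_on_time_derivative:
  fixes f :: "real \<Rightarrow> real^3 \<Rightarrow> 'b::real_normed_vector"
  assumes "smooth_on (I \<times> UNIV) (\<lambda>(t, x). f t x)" "t \<in> I"
  shows "((\<lambda>s. f s x) has_vector_derivative vector_derivative (\<lambda>s. f s x) (at t)) (at t)"
proof -
  have "(\<lambda>(t, x). f t x) differentiable (at (t, x))"
    using smooth_on_differentiable[OF assms(1)] assms(2) by simp
  moreover have "((\<lambda>s. (s, x)) has_derivative (\<lambda>h. (h, 0))) (at t)"
    by (intro derivative_eq_intros) auto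
  then have "(\<lambda>s. (s, x)) differentiable (at t)"
    unfolding differentiable_def by blast
  ultimately have "(\<lambda>s. f s x) differentiable (at t)"
    using differentiable_chain_at[of "\<lambda>s. (s, x)" t "\<lambda>(t, x). f t x"] by (simp add: o_def)
  then show ?thesis by (simp add: vector_derivative_works)
qed

lemma vector_3_eq: "(vector [a, b, c] :: real^3) = a *\<^sub>R axis 1 1 + b *\<^sub>R axis 2 1 + c *\<^sub>R axis 3 1"
  by (simp add: vec_eq_iff forall_3 axis_def)

lemma frechet_derivative_eq_pd:
  fixes g :: "real^3 \<Rightarrow> 'b::real_normed_vector"
  assumes "g differentiable (at y)"
  shows "frechet_derivative g (at y) v = v $ 1 *\<^sub>R pd 1 g y + v $ 2 *\<^sub>R pd 2 g y + v $ 3 *\<^sub>R pd 3 g y"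
proof -
  have v: "v = v $ 1 *\<^sub>R axis 1 1 + v $ 2 *\<^sub>R axis 2 1 + v $ 3 *\<^sub>R axis 3 1"
    by (simp add: vec_eq_iff forall_3 axis_def)
  have l: "linear (frechet_derivative g (at y))"
    using assms by (rule linear_frechet_derivative)
  show ?thesis
    by (subst v) (simp add: pd_def linear_add[OF l] linear_scale[OF l])
qed

lemma has_vector_derivative_vector_3:
  assumes "(a has_real_derivative a') (at s)" "(b has_real_derivative b') (at s)" "(c has_real_derivative c') (at s)"
  shows "((\<lambda>s. vector [a s, b s, c s] :: real^3) has_vector_derivative vector [a', b', c']) (at s)"
proof -
  have *: "((\<lambda>s. f s *\<^sub>R (v :: real^3)) has_vector_derivative f' *\<^sub>R v) (at s)"
    if "(f has_real_derivative f') (at s)" for f f' v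
    using has_vector_derivative_scaleR[OF that has_vector_derivative_const[of v]] by simp
  show ?thesis unfolding vector_3_eq by (intro has_vector_derivative_add * assms)
qed

lemma has_vector_derivative_along_curve:
  fixes g :: "real^3 \<Rightarrow> 'b::real_normed_vector"
  assumes "(a has_real_derivative a') (at s)" "(b has_real_derivative b') (at s)" "(c has_real_derivative c') (at s)"
    and g: "g differentiable (at (vector [a s, b s, c s]))"
  shows "((\<lambda>s. g (vector [a s, b s, c s])) has_vector_derivative
     (a' *\<^sub>R pd 1 g (vector [a s, b s, c s]) + b' *\<^sub>R pd 2 g (vector [a s, b s, c s])
       + c' *\<^sub>R pd 3 g (vector [a s, b s, c s]))) (at s)"
proof -
  let ?y = "vector [a s, b s, c s] :: real^3"
  have "(g has_derivative frechet_derivative g (at ?y)) (at ?y)"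
    using g by (simp add: frechet_derivative_works)
  from vector_derivative_diff_chain_within[OF has_vector_derivative_vector_3[OF assms(1-3)]
      has_derivative_at_withinI[OF this]]
  show ?thesis by (simp add: o_def frechet_derivative_eq_pd[OF g])
qed

lemma pd_linear_combination:
  assumes "g differentiable (at x)" "h differentiable (at x)"
  shows "pd j (\<lambda>x. c *\<^sub>R g x + d *\<^sub>R h x) x = c *\<^sub>R pd j g x + d *\<^sub>R pd j h x"
proof -
  have "((\<lambda>x. c *\<^sub>R g x + d *\<^sub>R h x) has_derivative
     (\<lambda>v. c *\<^sub>R frechet_derivative g (at x) v + d *\<^sub>R frechet_derivative h (at x) v)) (at x)"
    using assms by (intro derivative_intros frechet_derivative_works[THEN iffD1])
  from frechet_derivative_at[OF this, symmetric] show ?thesis by (simp add: pd_def)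
qed

definition rot :: "real \<Rightarrow> real^3 \<Rightarrow> real^3" where
  "rot \<theta> x = vector [cos \<theta> * x $ 1 - sin \<theta> * x $ 2, sin \<theta> * x $ 1 + cos \<theta> * x $ 2, x $ 3]"

lemma bounded_linear_rot: "bounded_linear (rot \<theta>)"
  unfolding linear_conv_bounded_linear[symmetric]
  by (rule linearI) (simp_all add: rot_def vec_eq_iff forall_3 algebra_simps)

lemma rot_cyl: "rot \<theta> (cyl r \<phi> z) = cyl r (\<theta> + \<phi>) z"
  by (simp add: rot_def cyl_def vec_eq_iff forall_3 cos_add sin_add algebra_simps)

lemma rot_frame:
  "rot \<theta> (a *\<^sub>R e_r \<phi> + b *\<^sub>R e_theta \<phi> + c *\<^sub>R e_z) = a *\<^sub>R e_r (\<theta> + \<phi>) + b *\<^sub>R e_theta (\<theta> + \<phi>) + c *\<^sub>R e_z"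
  by (simp add: rot_def e_r_def e_theta_def e_z_def vec_eq_iff forall_3 cos_add sin_add algebra_simps)

lemma ex_cyl:
  assumes "x $ 1 \<noteq> 0 \<or> x $ 2 \<noteq> 0"
  shows "\<exists>r>0. \<exists>\<phi>. x = cyl r \<phi> (x $ 3)"
proof -
  obtain r \<phi> where rf: "x $ 1 = r * cos \<phi>" "x $ 2 = r * sin \<phi>"
    using polar_Ex by blast
  show ?thesis
  proof (cases "r > 0")
    case True
    then show ?thesis using rf by (intro exI[of _ r] conjI exI[of _ \<phi>]) (auto simp: cyl_def vec_eq_iff forall_3)
  next
    case False
    then have "- r > 0" using assms rf by (cases "r = 0") auto
    then show ?thesis using rf
      by (intro exI[of _ "- r"] conjI exI[of _ "\<phi> + pi"]) (auto simp: cyl_def vec_eq_iff forall_3)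
  qed
qed

text \<open>Off the axis this is the addition theorem for sine and cosine; on the axis it follows by
  continuity.\<close>

lemma axisymmetric_equivariant:
  assumes ax: "axisymmetric_with I u ur ut uz" and "t \<in> I" and cont: "continuous_on UNIV (u t)"
  shows "u t (rot \<theta> x) = rot \<theta> (u t x)"
proof -
  have off: "u t (rot \<theta> x) = rot \<theta> (u t x)" if off: "x $ 1 \<noteq> 0 \<or> x $ 2 \<noteq> 0" for x
  proof -
    obtain r \<phi> where r: "r > 0" "x = cyl r \<phi> (x $ 3)" using ex_cyl[OF off] by blast
    have eq: "u t (cyl r \<psi> z) = ur r z t *\<^sub>R e_r \<psi> + ut r z t *\<^sub>R e_theta \<psi> + uz r z t *\<^sub>R e_z" for \<psi> z
      using ax \<open>t \<in> I\<close> r(1) by (auto simp: axisymmetric_with_def)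
    show ?thesis by (subst (1 2) r(2)) (simp only: rot_cyl eq rot_frame)
  qed
  show ?thesis
  proof (cases "x $ 1 \<noteq> 0 \<or> x $ 2 \<noteq> 0")
    case False
    define y where "y = (\<lambda>s::real. x + s *\<^sub>R (axis 1 1 :: real^3))"
    have y: "(y \<longlongrightarrow> x) (at_right 0)"
      unfolding y_def by (rule tendsto_eq_intros refl | simp)+
    have ct: "isCont (u t) y" for y using cont by (simp add: continuous_on_eq_continuous_at)
    have 1: "((\<lambda>s. u t (rot \<theta> (y s))) \<longlongrightarrow> u t (rot \<theta> x)) (at_right 0)"
      by (rule isCont_tendsto_compose[OF ct bounded_linear.tendsto[OF bounded_linear_rot y]])
    have 2: "((\<lambda>s. rot \<theta> (u t (y s))) \<longlongrightarrow> rot \<theta> (u t x)) (at_right 0)"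
      by (rule bounded_linear.tendsto[OF bounded_linear_rot isCont_tendsto_compose[OF ct y]])
    have "\<forall>\<^sub>F s in at_right 0. rot \<theta> (u t (y s)) = u t (rot \<theta> (y s))"
      using eventually_at_right_less[of 0]
    proof eventually_elim
      case (elim s)
      have "y s $ 1 \<noteq> 0" using False elim by (simp add: y_def axis_def)
      then show ?case using off[of "y s"] by simp
    qed
    from Lim_transform_eventually[OF 2 this] show ?thesis
      by (rule tendsto_unique[OF trivial_limit_at_right_real 1])
  qed (rule off)
qed

lemma frechet_derivative_rot:
  fixes g G :: "real^3 \<Rightarrow> 'b::real_normed_vector"
  assumes eq: "\<And>x. G (rot \<theta> x) = L (g x)" and L: "bounded_linear L"
    and G: "G differentiable (at (rot \<theta> x))" and g: "g differentiable (at x)"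
  shows "frechet_derivative G (at (rot \<theta> x)) (rot \<theta> v) = L (frechet_derivative g (at x) v)"
proof -
  have "((\<lambda>x. G (rot \<theta> x)) has_derivative (\<lambda>v. frechet_derivative G (at (rot \<theta> x)) (rot \<theta> v))) (at x)"
    by (rule has_derivative_compose[OF bounded_linear_imp_has_derivative[OF bounded_linear_rot]
          frechet_derivative_works[THEN iffD1, OF G]])
  moreover have "((\<lambda>x. L (g x)) has_derivative (\<lambda>v. L (frechet_derivative g (at x) v))) (at x)"
    by (rule bounded_linear.has_derivative[OF L frechet_derivative_works[THEN iffD1, OF g]])
  ultimately show ?thesis unfolding eq using has_derivative_unique by metis
qed

text \<open>Solving the rotated chain rule for the Cartesian partial derivatives.\<close>

lemma pd_rot:
  fixes g G :: "real^3 \<Rightarrow> 'b::real_normed_vector"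
  assumes eq: "\<And>x. G (rot \<theta> x) = L (g x)" and L: "bounded_linear L"
    and G: "\<And>x. G differentiable (at x)" and g: "\<And>x. g differentiable (at x)"
  shows "pd 1 G (rot \<theta> x) = L (cos \<theta> *\<^sub>R pd 1 g x + (- sin \<theta>) *\<^sub>R pd 2 g x)"
    and "pd 2 G (rot \<theta> x) = L (sin \<theta> *\<^sub>R pd 1 g x + cos \<theta> *\<^sub>R pd 2 g x)"
    and "pd 3 G (rot \<theta> x) = L (pd 3 g x)"
proof -
  have *: "(cos \<theta> * v $ 1 - sin \<theta> * v $ 2) *\<^sub>R pd 1 G (rot \<theta> x) + (sin \<theta> * v $ 1 + cos \<theta> * v $ 2) *\<^sub>R pd 2 G (rot \<theta> x)
      + v $ 3 *\<^sub>R pd 3 G (rot \<theta> x) = L (v $ 1 *\<^sub>R pd 1 g x + v $ 2 *\<^sub>R pd 2 g x + v $ 3 *\<^sub>R pd 3 g x)" for v :: "real^3"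
    using frechet_derivative_rot[OF eq L G g, of x v]
    by (simp add: frechet_derivative_eq_pd[OF G] frechet_derivative_eq_pd[OF g] rot_def)
  have cs: "cos \<theta> * cos \<theta> + sin \<theta> * sin \<theta> = 1"
    using sin_cos_squared_add[of \<theta>] by (simp add: power2_eq_square)
  show "pd 1 G (rot \<theta> x) = L (cos \<theta> *\<^sub>R pd 1 g x + (- sin \<theta>) *\<^sub>R pd 2 g x)"
    using *[of "vector [cos \<theta>, - sin \<theta>, 0]"] cs by (simp add: mult.commute)
  show "pd 2 G (rot \<theta> x) = L (sin \<theta> *\<^sub>R pd 1 g x + cos \<theta> *\<^sub>R pd 2 g x)"
    using *[of "vector [sin \<theta>, cos \<theta>, 0]"] cs by (simp add: mult.commute add.commute)
  show "pd 3 G (rot \<theta> x) = L (pd 3 g x)"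
    using *[of "vector [0, 0, 1]"] by simp
qed

section \<open>The swirl equation\<close>

definition convection :: "(real^3 \<Rightarrow> real^3) \<Rightarrow> real^3 \<Rightarrow> real^3" where
  "convection v x = (\<Sum>j\<in>UNIV. (v x $ j) *\<^sub>R pd j v x)"

definition laplacian :: "(real^3 \<Rightarrow> real^3) \<Rightarrow> real^3 \<Rightarrow> real^3" where
  "laplacian v x = (\<Sum>j\<in>UNIV. pd j (pd j v) x)"

lemma convection_eq_frechet_derivative:
  assumes "v differentiable (at x)"
  shows "convection v x = frechet_derivative v (at x) (v x)"
  by (simp add: convection_def frechet_derivative_eq_pd[OF assms] sum_3)

lemma convection_rot:
  assumes eq: "\<And>x. v (rot \<theta> x) = rot \<theta> (v x)" and v: "\<And>x. v differentiable (at x)"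
  shows "convection v (rot \<theta> x) = rot \<theta> (convection v x)"
  unfolding convection_eq_frechet_derivative[OF v]
  using frechet_derivative_rot[OF eq bounded_linear_rot v v] eq by simp

lemma laplacian_rot:
  assumes eq: "\<And>x. v (rot \<theta> x) = rot \<theta> (v x)" and v: "\<And>x. v differentiable (at x)"
    and v2: "\<And>j x. pd j v differentiable (at x)"
  shows "laplacian v (rot \<theta> x) = rot \<theta> (laplacian v x)"
proof -
  note lin = bounded_linear_rot
  note first = pd_rot[OF eq lin v v]
  have d: "(\<lambda>x. c *\<^sub>R pd i v x + d *\<^sub>R pd j v x) differentiable (at x)" for c d i j x
    using v2 by (intro derivative_intros)
  have 1: "pd 1 (pd 1 v) (rot \<theta> x) = rot \<theta>
     (cos \<theta> *\<^sub>R pd 1 (\<lambda>x. cos \<theta> *\<^sub>R pd 1 v x + (- sin \<theta>) *\<^sub>R pd 2 v x) x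
      + (- sin \<theta>) *\<^sub>R pd 2 (\<lambda>x. cos \<theta> *\<^sub>R pd 1 v x + (- sin \<theta>) *\<^sub>R pd 2 v x) x)"
    by (rule pd_rot(1)[OF first(1) lin v2 d])
  have 2: "pd 2 (pd 2 v) (rot \<theta> x) = rot \<theta>
     (sin \<theta> *\<^sub>R pd 1 (\<lambda>x. sin \<theta> *\<^sub>R pd 1 v x + cos \<theta> *\<^sub>R pd 2 v x) x
      + cos \<theta> *\<^sub>R pd 2 (\<lambda>x. sin \<theta> *\<^sub>R pd 1 v x + cos \<theta> *\<^sub>R pd 2 v x) x)"
    by (rule pd_rot(2)[OF first(2) lin v2 d])
  have 3: "pd 3 (pd 3 v) (rot \<theta> x) = rot \<theta> (pd 3 (pd 3 v) x)"
    by (rule pd_rot(3)[OF first(3) lin v2 v2])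
  note pd_lc = pd_linear_combination[OF v2 v2]
  have cs: "cos \<theta> * cos \<theta> + sin \<theta> * sin \<theta> = 1"
    using sin_cos_squared_add[of \<theta>] by (simp add: power2_eq_square)
  define A where "A = pd 1 (pd 1 v) x" define B where "B = pd 1 (pd 2 v) x"
  define C where "C = pd 2 (pd 1 v) x" define D where "D = pd 2 (pd 2 v) x"
  \<comment> \<open>The mixed derivatives cancel in the sum, by bilinearity alone, leaving the invariant trace.\<close>
  have "(c *\<^sub>R (c *\<^sub>R A + (- s) *\<^sub>R B) + (- s) *\<^sub>R (c *\<^sub>R C + (- s) *\<^sub>R D))
      + (s *\<^sub>R (s *\<^sub>R A + c *\<^sub>R B) + c *\<^sub>R (s *\<^sub>R C + c *\<^sub>R D)) = (c * c + s * s) *\<^sub>R (A + D)" for c s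
    by (simp add: algebra_simps)
  from this[of "cos \<theta>" "sin \<theta>"] have trace:
    "(cos \<theta> *\<^sub>R (cos \<theta> *\<^sub>R A + (- sin \<theta>) *\<^sub>R B) + (- sin \<theta>) *\<^sub>R (cos \<theta> *\<^sub>R C + (- sin \<theta>) *\<^sub>R D))
      + (sin \<theta> *\<^sub>R (sin \<theta> *\<^sub>R A + cos \<theta> *\<^sub>R B) + cos \<theta> *\<^sub>R (sin \<theta> *\<^sub>R C + cos \<theta> *\<^sub>R D)) = A + D"
    unfolding cs by simp
  then have key: "rot \<theta> (cos \<theta> *\<^sub>R (cos \<theta> *\<^sub>R A + (- sin \<theta>) *\<^sub>R B) + (- sin \<theta>) *\<^sub>R (cos \<theta> *\<^sub>R C + (- sin \<theta>) *\<^sub>R D))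
      + rot \<theta> (sin \<theta> *\<^sub>R (sin \<theta> *\<^sub>R A + cos \<theta> *\<^sub>R B) + cos \<theta> *\<^sub>R (sin \<theta> *\<^sub>R C + cos \<theta> *\<^sub>R D)) = rot \<theta> (A + D)"
    by (simp only: linear_add[OF bounded_linear.linear[OF lin], symmetric] trace)
  show ?thesis
    unfolding laplacian_def sum_3 1 2 3 pd_lc A_def[symmetric] B_def[symmetric] C_def[symmetric] D_def[symmetric] key
    by (simp add: linear_add[OF bounded_linear.linear[OF lin]])
qed

locale axisymmetric_NS =
  fixes \<nu> :: real and I :: "real set" and u :: "real \<Rightarrow> real^3 \<Rightarrow> real^3" and q :: "real \<Rightarrow> real^3 \<Rightarrow> real"
    and ur ut uz :: "real \<Rightarrow> real \<Rightarrow> real \<Rightarrow> real"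
  assumes open_I: "open I"
    and NS: "smooth_NS_solution \<nu> I u q"
    and decay: "rapidly_decaying I u"
    and axisym: "axisymmetric_with I u ur ut uz"
begin

lemma u_smooth: "smooth_on (I \<times> UNIV) (\<lambda>(t, x). u t x)"
  and q_smooth: "smooth_on (I \<times> UNIV) (\<lambda>(t, x). q t x)"
  using NS by (auto simp: smooth_NS_solution_def)

lemma pds_u_differentiable: "t \<in> I \<Longrightarrow> pds js (u t) differentiable (at x)"
  by (rule smooth_on_pds_differentiable[OF u_smooth])

lemma u_differentiable: "t \<in> I \<Longrightarrow> u t differentiable (at x)"
  using pds_u_differentiable[of t "[]"] by simp

lemma pd_u_differentiable: "t \<in> I \<Longrightarrow> pd j (u t) differentiable (at x)"
  using pds_u_differentiable[of t "[j]"] by simp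

lemma q_differentiable: "t \<in> I \<Longrightarrow> q t differentiable (at x)"
  using smooth_on_pds_differentiable[OF q_smooth, of t "[]"] by simp

lemma u_time_derivative:
  "t \<in> I \<Longrightarrow> ((\<lambda>s. u s x) has_vector_derivative vector_derivative (\<lambda>s. u s x) (at t)) (at t)"
  by (rule smooth_on_time_derivative[OF u_smooth])

lemma u_rot: "t \<in> I \<Longrightarrow> u t (rot \<theta> x) = rot \<theta> (u t x)"
  by (rule axisymmetric_equivariant[OF axisym])
    (auto intro!: continuous_at_imp_continuous_on differentiable_imp_continuous_within u_differentiable)

lemma momentum:
  assumes "t \<in> I"
  shows "(\<chi> i. pd i (q t) x) = \<nu> *\<^sub>R laplacian (u t) x - convection (u t) x - vector_derivative (\<lambda>s. u s x) (at t)"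
proof -
  have "vector_derivative (\<lambda>s. u s x) (at t) + convection (u t) x
          = - (\<chi> i. pd i (q t) x) + \<nu> *\<^sub>R laplacian (u t) x"
    using NS assms by (simp add: smooth_NS_solution_def convection_def laplacian_def)
  then show ?thesis by (simp add: algebra_simps)
qed

lemma divergence_free: "t \<in> I \<Longrightarrow> pd 1 (u t) x $ 1 + pd 2 (u t) x $ 2 + pd 3 (u t) x $ 3 = 0"
  using NS by (simp add: smooth_NS_solution_def sum_3)

lemma time_derivative_rot:
  assumes "t \<in> I"
  shows "vector_derivative (\<lambda>s. u s (rot \<theta> x)) (at t) = rot \<theta> (vector_derivative (\<lambda>s. u s x) (at t))"
proof (rule vector_derivative_at)
  have "((\<lambda>s. rot \<theta> (u s x)) has_vector_derivative rot \<theta> (vector_derivative (\<lambda>s. u s x) (at t))) (at t)"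
    by (rule bounded_linear.has_vector_derivative[OF bounded_linear_rot u_time_derivative[OF assms]])
  then show "((\<lambda>s. u s (rot \<theta> x)) has_vector_derivative rot \<theta> (vector_derivative (\<lambda>s. u s x) (at t))) (at t)"
    by (rule has_vector_derivative_transform_within_open[OF _ open_I assms]) (simp add: u_rot)
qed

lemma pressure_gradient_rot:
  assumes "t \<in> I"
  shows "(\<chi> i. pd i (q t) (rot \<theta> x)) = rot \<theta> (\<chi> i. pd i (q t) x)"
proof -
  have l: "linear (rot \<theta>)" by (rule bounded_linear.linear[OF bounded_linear_rot])
  show ?thesis
    unfolding momentum[OF assms] time_derivative_rot[OF assms]
      convection_rot[OF u_rot[OF assms] u_differentiable[OF assms]]
      laplacian_rot[OF u_rot[OF assms] u_differentiable[OF assms] pd_u_differentiable[OF assms]]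
    by (simp add: linear_diff[OF l] linear_scale[OF l])
qed

lemma cyl_vector: "cyl r \<theta> z = vector [r * cos \<theta>, r * sin \<theta>, z]"
  by (simp add: cyl_def)

text \<open>Rotating the pressure gradient shows that the derivative of the pressure along a circle around
  the axis is constant; it must vanish because the pressure takes the same value after one turn.\<close>

lemma no_azimuthal_pressure_force:
  assumes t: "t \<in> I" and r: "r > 0"
  shows "pd 2 (q t) (cyl r 0 z) = 0"
proof -
  let ?k = "r * pd 2 (q t) (cyl r 0 z)"
  have der: "((\<lambda>\<theta>. q t (cyl r \<theta> z)) has_real_derivative ?k) (at \<theta>)" for \<theta>
  proof -
    have "((\<lambda>\<theta>. q t (cyl r \<theta> z)) has_vector_derivative
       ((- (r * sin \<theta>)) *\<^sub>R pd 1 (q t) (cyl r \<theta> z) + (r * cos \<theta>) *\<^sub>R pd 2 (q t) (cyl r \<theta> z)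
          + 0 *\<^sub>R pd 3 (q t) (cyl r \<theta> z))) (at \<theta>)"
      unfolding cyl_vector
      by (rule has_vector_derivative_along_curve) (auto intro!: derivative_eq_intros q_differentiable t)
    moreover have "(- (r * sin \<theta>)) *\<^sub>R pd 1 (q t) (cyl r \<theta> z) + (r * cos \<theta>) *\<^sub>R pd 2 (q t) (cyl r \<theta> z)
          + 0 *\<^sub>R pd 3 (q t) (cyl r \<theta> z) = ?k"
    proof -
      have "cyl r \<theta> z = rot \<theta> (cyl r 0 z)" by (simp add: rot_cyl)
      then have g: "(\<chi> i. pd i (q t) (cyl r \<theta> z)) = rot \<theta> (\<chi> i. pd i (q t) (cyl r 0 z))"
        using pressure_gradient_rot[OF t] by simp
      define a where "a = pd 1 (q t) (cyl r 0 z)"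
      define b where "b = pd 2 (q t) (cyl r 0 z)"
      have 1: "pd 1 (q t) (cyl r \<theta> z) = cos \<theta> * a - sin \<theta> * b"
        using arg_cong[OF g, of "\<lambda>v. v $ 1"] by (simp add: rot_def a_def b_def)
      have 2: "pd 2 (q t) (cyl r \<theta> z) = sin \<theta> * a + cos \<theta> * b"
        using arg_cong[OF g, of "\<lambda>v. v $ 2"] by (simp add: rot_def a_def b_def)
      have "- (r * s) * (c * a - s * b) + (r * c) * (s * a + c * b) = r * b * (s\<^sup>2 + c\<^sup>2)" for c s
        by (simp add: algebra_simps power2_eq_square)
      from this[of "sin \<theta>" "cos \<theta>"]
      have "- (r * sin \<theta>) * (cos \<theta> * a - sin \<theta> * b) + (r * cos \<theta>) * (sin \<theta> * a + cos \<theta> * b) = r * b"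
        by (simp only: sin_cos_squared_add mult_1_right)
      then show ?thesis unfolding 1 2 b_def by simp
    qed
    ultimately show ?thesis by (simp add: has_real_derivative_iff_has_vector_derivative)
  qed
  have "((\<lambda>\<theta>. q t (cyl r \<theta> z) - ?k * \<theta>) has_real_derivative 0) (at \<theta>)" for \<theta>
    by (rule derivative_eq_intros der refl | simp)+
  from DERIV_isconst_all[of "\<lambda>\<theta>. q t (cyl r \<theta> z) - ?k * \<theta>", of "2 * pi" 0] this
  have "q t (cyl r (2 * pi) z) - ?k * (2 * pi) = q t (cyl r 0 z)" by simp
  moreover have "cyl r (2 * pi) z = cyl r 0 z" by (simp add: cyl_def)
  ultimately show ?thesis using r by simp
qed

lemma components:
  assumes "t \<in> I" "r > 0"
  shows "ur r z t = u t (cyl r 0 z) $ 1" "ut r z t = u t (cyl r 0 z) $ 2" "uz r z t = u t (cyl r 0 z) $ 3"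
  using axisym assms by (auto simp: axisymmetric_with_def e_r_def e_theta_def e_z_def)

text \<open>Obtained by differentiating $u_2 = u^r \sin\theta + u^\theta \cos\theta$ once and twice in \<open>\<theta>\<close> at \<open>0\<close>.
  These relations express the derivatives transverse to the half-plane $\theta = 0$ by data on it.\<close>

lemma azimuthal_derivatives:
  assumes t: "t \<in> I" and r: "r > 0"
  shows "r * pd 2 (u t) (cyl r 0 z) $ 2 = u t (cyl r 0 z) $ 1"
    and "r\<^sup>2 * pd 2 (pd 2 (u t)) (cyl r 0 z) $ 2 = r * pd 1 (u t) (cyl r 0 z) $ 2 - u t (cyl r 0 z) $ 2"
proof -
  have curve: "((\<lambda>\<theta>. f (cyl r \<theta> z) $ 2) has_real_derivative
       (- (r * sin \<theta>)) * pd 1 f (cyl r \<theta> z) $ 2 + (r * cos \<theta>) * pd 2 f (cyl r \<theta> z) $ 2) (at \<theta>)"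
    if f: "\<And>x. f differentiable (at x)" for f :: "real^3 \<Rightarrow> real^3" and \<theta>
  proof -
    have "((\<lambda>\<theta>. f (cyl r \<theta> z)) has_vector_derivative
       ((- (r * sin \<theta>)) *\<^sub>R pd 1 f (cyl r \<theta> z) + (r * cos \<theta>) *\<^sub>R pd 2 f (cyl r \<theta> z)
          + 0 *\<^sub>R pd 3 f (cyl r \<theta> z))) (at \<theta>)"
      unfolding cyl_vector
      by (rule has_vector_derivative_along_curve) (auto intro!: derivative_eq_intros f)
    from bounded_linear.has_vector_derivative[OF bounded_linear_vec_nth[of 2] this]
    show ?thesis by (simp add: has_real_derivative_iff_has_vector_derivative)
  qed
  define a where "a = u t (cyl r 0 z) $ 1"
  define b where "b = u t (cyl r 0 z) $ 2"
  have eq: "u t (cyl r \<theta> z) $ 2 = a * sin \<theta> + b * cos \<theta>" for \<theta>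
  proof -
    have "u t (cyl r \<theta> z) = rot \<theta> (u t (cyl r 0 z))"
      using u_rot[OF t, of \<theta> "cyl r 0 z"] by (simp add: rot_cyl)
    then show ?thesis by (simp add: rot_def a_def b_def)
  qed
  have first: "(- (r * sin \<theta>)) * pd 1 (u t) (cyl r \<theta> z) $ 2 + (r * cos \<theta>) * pd 2 (u t) (cyl r \<theta> z) $ 2
      = a * cos \<theta> - b * sin \<theta>" for \<theta>
  proof -
    have "((\<lambda>\<theta>. u t (cyl r \<theta> z) $ 2) has_real_derivative a * cos \<theta> - b * sin \<theta>) (at \<theta>)"
      unfolding eq by (auto intro!: derivative_eq_intros)
    then show ?thesis using curve[OF u_differentiable[OF t]] DERIV_unique by blast
  qed
  show "r * pd 2 (u t) (cyl r 0 z) $ 2 = u t (cyl r 0 z) $ 1"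
    using first[of 0] by (simp add: a_def)
  note c1 = curve[OF pd_u_differentiable[OF t], of 1 0] and c2 = curve[OF pd_u_differentiable[OF t], of 2 0]
  have "((\<lambda>\<theta>. (- (r * sin \<theta>)) * pd 1 (u t) (cyl r \<theta> z) $ 2 + (r * cos \<theta>) * pd 2 (u t) (cyl r \<theta> z) $ 2)
     has_real_derivative - r * pd 1 (u t) (cyl r 0 z) $ 2 + r * (r * pd 2 (pd 2 (u t)) (cyl r 0 z) $ 2)) (at 0)"
    by (rule derivative_eq_intros c1 c2 refl | simp)+
  moreover have "((\<lambda>\<theta>. a * cos \<theta> - b * sin \<theta>) has_real_derivative - b) (at 0)"
    by (auto intro!: derivative_eq_intros)
  ultimately have "- r * pd 1 (u t) (cyl r 0 z) $ 2 + r * (r * pd 2 (pd 2 (u t)) (cyl r 0 z) $ 2) = - b"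
    unfolding first using DERIV_unique by blast
  then show "r\<^sup>2 * pd 2 (pd 2 (u t)) (cyl r 0 z) $ 2 = r * pd 1 (u t) (cyl r 0 z) $ 2 - u t (cyl r 0 z) $ 2"
    by (simp add: b_def power2_eq_square)
qed

lemma swirl_equation:
  fixes t r z :: real
  assumes t: "t \<in> I" and r: "r > 0"
  defines "v \<equiv> \<lambda>js. pds js (u t) (cyl r 0 z)"
  shows "vector_derivative (\<lambda>s. u s (cyl r 0 z)) (at t) $ 2
     = \<nu> * (v [1, 1] $ 2 + v [1] $ 2 / r - v [] $ 2 / r\<^sup>2 + v [3, 3] $ 2)
       - v [] $ 1 * v [1] $ 2 - v [] $ 1 / r * v [] $ 2 - v [] $ 3 * v [3] $ 2"
proof -
  have p: "(\<chi> i. pd i (q t) (cyl r 0 z)) $ 2 = 0"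
    using no_azimuthal_pressure_force[OF t r] by simp
  have d2: "pd 2 (u t) (cyl r 0 z) $ 2 = v [] $ 1 / r"
    using azimuthal_derivatives(1)[OF t r, of z] r by (simp add: v_def field_simps)
  have d22: "pd 2 (pd 2 (u t)) (cyl r 0 z) $ 2 = v [1] $ 2 / r - v [] $ 2 / r\<^sup>2"
    using azimuthal_derivatives(2)[OF t r, of z] r by (simp add: v_def field_simps power2_eq_square)
  show ?thesis
    using p unfolding momentum[OF t]
    by (simp add: laplacian_def convection_def sum_3 d2 d22) (simp add: v_def algebra_simps)
qed

lemma continuity_equation:
  assumes "t \<in> I" "r > 0"
  shows "pds [1] (u t) (cyl r 0 z) $ 1 + pds [] (u t) (cyl r 0 z) $ 1 / r + pds [3] (u t) (cyl r 0 z) $ 3 = 0"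
proof -
  have "pd 2 (u t) (cyl r 0 z) $ 2 = u t (cyl r 0 z) $ 1 / r"
    using azimuthal_derivatives(1)[OF assms, of z] assms by (simp add: field_simps)
  then show ?thesis using divergence_free[OF assms(1), of "cyl r 0 z"] by simp
qed

text \<open>A half-turn fixes the axis and reverses horizontal vectors.\<close>

lemma vanishing_on_axis:
  assumes "t \<in> I"
  shows "u t (cyl 0 0 z) $ 1 = 0" "u t (cyl 0 0 z) $ 2 = 0"
proof -
  have "rot pi (cyl 0 0 z) = cyl 0 0 z" by (simp add: rot_cyl) (simp add: cyl_def)
  then have "u t (cyl 0 0 z) = rot pi (u t (cyl 0 0 z))" using u_rot[OF assms, of pi "cyl 0 0 z"] by simp
  then have "u t (cyl 0 0 z) $ 1 = rot pi (u t (cyl 0 0 z)) $ 1" "u t (cyl 0 0 z) $ 2 = rot pi (u t (cyl 0 0 z)) $ 2"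
    by (rule arg_cong)+
  moreover have "rot pi v $ 1 = - (v $ 1)" "rot pi v $ 2 = - (v $ 2)" for v by (simp_all add: rot_def)
  ultimately show "u t (cyl 0 0 z) $ 1 = 0" "u t (cyl 0 0 z) $ 2 = 0" by (metis neg_equal_zero)+
qed

end

section \<open>The swirl quotient near the axis and its time derivative\<close>

text \<open>Division by powers of \<open>r\<close> preserves decay if the numerator vanishes on the axis to the matching
  order, which is expressed through its radial derivative. Near the axis the mean value theorem
  bounds the quotient by \<open>m\<close>; away from it the division is harmless. On the axis itself the quotient
  is \<open>0\<close> by the convention for division by zero.\<close>

lemma decays_quotient:
  assumes deriv: "\<And>t r z. t \<in> T \<Longrightarrow> r \<ge> 0 \<Longrightarrow> ((\<lambda>r. n t r z) has_real_derivative r ^ k * m t r z) (at r)"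
    and zero: "\<And>t z. t \<in> T \<Longrightarrow> n t 0 z = 0"
    and n: "decays T n" and m: "decays T m"
  shows "decays T (\<lambda>t r z. n t r z / r ^ Suc k)"
  unfolding decays_def
proof
  fix N
  obtain C where "C \<ge> 0" and C: "\<And>t r z. t \<in> T \<Longrightarrow> r \<ge> 0 \<Longrightarrow> \<bar>n t r z\<bar> * ((1 + r) ^ N * (1 + z\<^sup>2)) \<le> C"
    by (rule decaysE[OF n, of N]; blast)
  obtain D where "D \<ge> 0" and D: "\<And>t r z. t \<in> T \<Longrightarrow> r \<ge> 0 \<Longrightarrow> \<bar>m t r z\<bar> * ((1 + r) ^ 0 * (1 + z\<^sup>2)) \<le> D"
    by (rule decaysE[OF m, of 0]; blast)
  show "\<exists>C. \<forall>t\<in>T. \<forall>r\<ge>0. \<forall>z. \<bar>n t r z / r ^ Suc k\<bar> * ((1 + r) ^ N * (1 + z\<^sup>2)) \<le> C"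
  proof (intro exI[of _ "C + 2 ^ N * D"] ballI allI impI)
    fix t r z :: real assume tr: "t \<in> T" "0 \<le> r"
    have w: "0 \<le> (1 + r) ^ N * (1 + z\<^sup>2)" using tr by simp
    have D': "0 \<le> 2 ^ N * D" using \<open>D \<ge> 0\<close> by simp
    consider "r = 0" | "r \<ge> 1" | "0 < r" "r < 1" using tr by linarith
    then show "\<bar>n t r z / r ^ Suc k\<bar> * ((1 + r) ^ N * (1 + z\<^sup>2)) \<le> C + 2 ^ N * D"
    proof cases
      case 1
      then show ?thesis using \<open>C \<ge> 0\<close> D' by simp
    next
      case 2
      then have "1 \<le> r ^ Suc k" by (rule one_le_power)
      then have "\<bar>n t r z / r ^ Suc k\<bar> \<le> \<bar>n t r z\<bar>"
        using 2 by (simp add: abs_divide divide_le_eq mult_left_le[of 1] mult_le_cancel_left1 del: power_Suc)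
      then have "\<bar>n t r z / r ^ Suc k\<bar> * ((1 + r) ^ N * (1 + z\<^sup>2)) \<le> \<bar>n t r z\<bar> * ((1 + r) ^ N * (1 + z\<^sup>2))"
        by (rule mult_right_mono[OF _ w])
      then show ?thesis using C[OF tr, of z] D' by linarith
    next
      case 3
      have "\<exists>s. 0 < s \<and> s < r \<and> n t r z - n t 0 z = (r - 0) * (s ^ k * m t s z)"
        by (rule MVT2) (use 3 deriv[OF tr(1)] in auto)
      then obtain s where s: "0 < s" "s < r" "n t r z = r * (s ^ k * m t s z)"
        using zero[OF tr(1)] by auto
      have "\<bar>n t r z / r ^ Suc k\<bar> = (s ^ k / r ^ k) * \<bar>m t s z\<bar>"
        using s 3 by (simp add: abs_mult)
      also have "\<dots> \<le> 1 * \<bar>m t s z\<bar>"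
        using s power_mono[of s r k] by (intro mult_right_mono) auto
      finally have "\<bar>n t r z / r ^ Suc k\<bar> * ((1 + r) ^ N * (1 + z\<^sup>2)) \<le> \<bar>m t s z\<bar> * ((1 + r) ^ N * (1 + z\<^sup>2))"
        by (intro mult_right_mono[OF _ w]) simp
      also have "\<dots> \<le> \<bar>m t s z\<bar> * (2 ^ N * (1 + z\<^sup>2))"
        using 3 by (intro mult_left_mono mult_right_mono power_mono) auto
      also have "\<dots> \<le> 2 ^ N * D"
        using mult_left_mono[OF D[of t s z], of "2 ^ N"] tr s by (simp add: mult_ac)
      finally show ?thesis using \<open>C \<ge> 0\<close> by linarith
    qed
  qed
qed

text \<open>Differentiation under the integral sign: by the mean value theorem the difference quotients are
  dominated by the uniform decay of the time derivative.\<close>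

lemma weighted_integral_has_real_derivative:
  assumes \<alpha>: "\<alpha> > 1" and \<delta>: "\<delta> > 0" and T: "T = {t0 - \<delta>..t0 + \<delta>}"
    and X: "\<And>t. t \<in> T \<Longrightarrow> tame (X t)"
    and deriv: "\<And>t r z. t \<in> T \<Longrightarrow> r > 0 \<Longrightarrow> ((\<lambda>s. X s r z) has_real_derivative X' t r z) (at t)"
    and X': "decays T X'"
  shows "((\<lambda>s. weighted_integral \<alpha> (X s)) has_real_derivative weighted_integral \<alpha> (X' t0)) (at t0)"
proof -
  have t0: "t0 \<in> T" using \<delta> by (simp add: T)
  obtain C where C: "C \<ge> 0"
    "\<And>t r z. t \<in> T \<Longrightarrow> r > 0 \<Longrightarrow> \<bar>r powr (\<alpha> - 2) * X' t r z\<bar> \<le> C * dominator \<alpha> (r, z)"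
    by (rule decays_dominated[OF X', of \<alpha>]; blast)
  define W where "W = (\<lambda>t x. indicator halfplane x * (case x of (r, z) \<Rightarrow> r powr (\<alpha> - 2) * X t r z))"
  define W' where "W' = (\<lambda>x. indicator halfplane x * (case x of (r, z) \<Rightarrow> r powr (\<alpha> - 2) * X' t0 r z))"
  have W: "integrable lborel (W t)" if "t \<in> T" for t
    using tame_set_integrable[OF X[OF that] \<alpha>] by (simp add: W_def set_integrable_def)
  have dom: "integrable lborel (\<lambda>x. C * (indicator halfplane x * dominator \<alpha> x))"
    using integrable_dominator[OF \<alpha>] by (simp add: set_integrable_def)
  have dW: "((\<lambda>s. W s x) has_real_derivative (indicator halfplane x * (case x of (r, z) \<Rightarrow> r powr (\<alpha> - 2) * X' t r z))) (at t)"
    if "t \<in> T" for t x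
  proof (cases x)
    case (Pair r z)
    show ?thesis
    proof (cases "r > 0")
      case True
      show ?thesis unfolding W_def Pair using True
        by (auto intro!: derivative_eq_intros deriv[OF that True])
    qed (simp add: W_def Pair)
  qed
  have "((\<lambda>s. (weighted_integral \<alpha> (X s) - weighted_integral \<alpha> (X t0)) / (s - t0)) \<longlongrightarrow> weighted_integral \<alpha> (X' t0)) (at t0 within T)"
    unfolding tendsto_at_iff_sequentially
  proof (intro allI impI)
    fix s :: "nat \<Rightarrow> real" assume s: "\<forall>i. s i \<in> T - {t0}" and lim: "s \<longlonglongrightarrow> t0"
    define Q where "Q = (\<lambda>n x. (W (s n) x - W t0 x) / (s n - t0))"
    have iQ: "integrable lborel (Q n)" for n
      unfolding Q_def using s t0 by (intro integrable_divide Bochner_Integration.integrable_diff W) auto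
    have limQ: "(\<lambda>n. Q n x) \<longlonglongrightarrow> W' x" for x
    proof -
      have "((\<lambda>s. (W s x - W t0 x) / (s - t0)) \<longlongrightarrow> W' x) (at t0)"
        using dW[OF t0, of x] unfolding W'_def has_field_derivative_iff .
      moreover have "filterlim s (at t0) sequentially"
        using s lim by (auto simp: filterlim_at)
      ultimately show ?thesis unfolding Q_def by (rule filterlim_compose)
    qed
    have bound: "norm (Q n x) \<le> C * (indicator halfplane x * dominator \<alpha> x)" for n x
    proof -
      have sn: "s n \<in> T" "s n \<noteq> t0" using s by auto
      have "\<exists>\<xi>\<in>T. W (s n) x - W t0 x = (s n - t0) * (indicator halfplane x * (case x of (r, z) \<Rightarrow> r powr (\<alpha> - 2) * X' \<xi> r z))"
      proof (cases "s n < t0")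
        case True
        have "\<exists>\<xi>>s n. \<xi> < t0 \<and> W t0 x - W (s n) x = (t0 - s n) * (indicator halfplane x * (case x of (r, z) \<Rightarrow> r powr (\<alpha> - 2) * X' \<xi> r z))"
          by (rule MVT2[OF True]) (use sn t0 in \<open>auto intro!: dW simp: T\<close>)
        then obtain \<xi> where \<xi>: "s n < \<xi>" "\<xi> < t0"
          and eq: "W t0 x - W (s n) x = (t0 - s n) * (indicator halfplane x * (case x of (r, z) \<Rightarrow> r powr (\<alpha> - 2) * X' \<xi> r z))"
          by blast
        show ?thesis using \<xi> eq sn t0 by (intro bexI[of _ \<xi>]) (auto simp: T algebra_simps)
      next
        case False
        then have "t0 < s n" using sn by simp
        then have "\<exists>\<xi>>t0. \<xi> < s n \<and> W (s n) x - W t0 x = (s n - t0) * (indicator halfplane x * (case x of (r, z) \<Rightarrow> r powr (\<alpha> - 2) * X' \<xi> r z))"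
          by (rule MVT2) (use sn t0 in \<open>auto intro!: dW simp: T\<close>)
        then obtain \<xi> where "t0 < \<xi>" "\<xi> < s n"
          "W (s n) x - W t0 x = (s n - t0) * (indicator halfplane x * (case x of (r, z) \<Rightarrow> r powr (\<alpha> - 2) * X' \<xi> r z))"
          by blast
        then show ?thesis using sn t0 by (intro bexI[of _ \<xi>]) (auto simp: T)
      qed
      then obtain \<xi> where \<xi>: "\<xi> \<in> T"
        "W (s n) x - W t0 x = (s n - t0) * (indicator halfplane x * (case x of (r, z) \<Rightarrow> r powr (\<alpha> - 2) * X' \<xi> r z))"
        by blast
      have "Q n x = indicator halfplane x * (case x of (r, z) \<Rightarrow> r powr (\<alpha> - 2) * X' \<xi> r z)"
        unfolding Q_def \<xi>(2) using sn by simp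
      then show ?thesis
        using C(2)[OF \<xi>(1)] by (cases x) (auto simp: indicator_def)
    qed
    have "(\<lambda>n. integral\<^sup>L lborel (Q n)) \<longlonglongrightarrow> integral\<^sup>L lborel W'"
    proof (rule integral_dominated_convergence[OF _ _ dom])
      show "W' \<in> borel_measurable lborel"
        by (rule borel_measurable_LIMSEQ_real[OF limQ]) (use iQ in auto)
    qed (use iQ limQ bound in auto)
    moreover have "integral\<^sup>L lborel (Q n) = (weighted_integral \<alpha> (X (s n)) - weighted_integral \<alpha> (X t0)) / (s n - t0)" for n
    proof -
      have "integral\<^sup>L lborel (Q n) = (integral\<^sup>L lborel (W (s n)) - integral\<^sup>L lborel (W t0)) / (s n - t0)"
        unfolding Q_def using s t0 W by simp
      then show ?thesis by (simp add: W_def weighted_integral_def set_lebesgue_integral_def)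
    qed
    moreover have "integral\<^sup>L lborel W' = weighted_integral \<alpha> (X' t0)"
      by (simp add: W'_def weighted_integral_def set_lebesgue_integral_def)
    ultimately show "((\<lambda>s. (weighted_integral \<alpha> (X s) - weighted_integral \<alpha> (X t0)) / (s - t0)) \<circ> s) \<longlonglongrightarrow> weighted_integral \<alpha> (X' t0)"
      by (simp add: o_def)
  qed
  then have "((\<lambda>s. weighted_integral \<alpha> (X s)) has_real_derivative weighted_integral \<alpha> (X' t0)) (at t0 within T)"
    by (simp add: has_field_derivative_iff)
  moreover have "at t0 within T = at t0"
    by (rule at_within_interior) (use \<delta> in \<open>simp add: T interior_cbox[of "t0 - \<delta>" "t0 + \<delta>", simplified]\<close>)
  ultimately show ?thesis by simp
qed

context axisymmetric_NS
begin

text \<open>The \<open>i\<close>-th component of an iterated Cartesian derivative of the velocity, restricted to the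
  half-plane \<open>\<theta> = 0\<close>. There the components \<open>1\<close>, \<open>2\<close>, \<open>3\<close> are the radial, azimuthal and axial ones, and
  the derivatives in the directions \<open>1\<close> and \<open>3\<close> are those in \<open>r\<close> and \<open>z\<close>.\<close>

definition profile :: "3 list \<Rightarrow> 3 \<Rightarrow> real \<Rightarrow> real \<Rightarrow> real \<Rightarrow> real" where
  "profile js i t r z = pds js (u t) (cyl r 0 z) $ i"

lemma profile_r:
  assumes "t \<in> I"
  shows "((\<lambda>r. profile js i t r z) has_real_derivative profile (1 # js) i t r z) (at r)"
proof -
  have "((\<lambda>s. pds js (u t) (vector [s, 0, z])) has_vector_derivative
     (1 *\<^sub>R pd 1 (pds js (u t)) (vector [r, 0, z]) + 0 *\<^sub>R pd 2 (pds js (u t)) (vector [r, 0, z])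
       + 0 *\<^sub>R pd 3 (pds js (u t)) (vector [r, 0, z]))) (at r)"
    by (rule has_vector_derivative_along_curve) (auto intro!: derivative_eq_intros pds_u_differentiable assms)
  from bounded_linear.has_vector_derivative[OF bounded_linear_vec_nth[of i] this]
  show ?thesis by (simp add: profile_def cyl_def has_real_derivative_iff_has_vector_derivative)
qed

lemma profile_z:
  assumes "t \<in> I"
  shows "((\<lambda>z. profile js i t r z) has_real_derivative profile (3 # js) i t r z) (at z)"
proof -
  have "((\<lambda>s. pds js (u t) (vector [r, 0, s])) has_vector_derivative
     (0 *\<^sub>R pd 1 (pds js (u t)) (vector [r, 0, z]) + 0 *\<^sub>R pd 2 (pds js (u t)) (vector [r, 0, z])
       + 1 *\<^sub>R pd 3 (pds js (u t)) (vector [r, 0, z]))) (at z)"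
    by (rule has_vector_derivative_along_curve) (auto intro!: derivative_eq_intros pds_u_differentiable assms)
  from bounded_linear.has_vector_derivative[OF bounded_linear_vec_nth[of i] this]
  show ?thesis by (simp add: profile_def cyl_def has_real_derivative_iff_has_vector_derivative)
qed

lemma continuous_on_profile [continuous_intros]:
  assumes "t \<in> I"
  shows "continuous_on A (\<lambda>x. profile js i t (fst x) (snd x))"
proof -
  have "continuous_on UNIV (pds js (u t))"
    by (auto intro!: continuous_at_imp_continuous_on differentiable_imp_continuous_within pds_u_differentiable assms)
  moreover have "continuous_on A (\<lambda>x. cyl (fst x) 0 (snd x))"
    unfolding cyl_def vector_3_eq by (intro continuous_intros)
  ultimately have "continuous_on A (\<lambda>x. pds js (u t) (cyl (fst x) 0 (snd x)))"
    by (rule continuous_on_compose2) auto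
  then show ?thesis unfolding profile_def by (intro continuous_intros)
qed

lemma decays_profile:
  assumes K: "compact K" "K \<subseteq> I"
  shows "decays K (profile js i)"
  unfolding decays_def
proof
  fix N
  have ex: "\<exists>C. \<forall>t\<in>K. \<forall>x. norm x ^ M * norm (pds js (u t) x) \<le> C" for M
    using decay K unfolding rapidly_decaying_def by simp
  obtain C0 where "\<forall>t\<in>K. \<forall>x. norm x ^ 0 * norm (pds js (u t) x) \<le> C0"
    using ex[of 0] ..
  then have C0: "norm x ^ 0 * norm (pds js (u t) x) \<le> C0" if "t \<in> K" for t x
    using that by blast
  obtain C1 where "\<forall>t\<in>K. \<forall>x. norm x ^ (N + 2) * norm (pds js (u t) x) \<le> C1"
    using ex[of "N + 2"] ..
  then have C1: "norm x ^ (N + 2) * norm (pds js (u t) x) \<le> C1" if "t \<in> K" for t x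
    using that by blast
  show "\<exists>C. \<forall>t\<in>K. \<forall>r\<ge>0. \<forall>z. \<bar>profile js i t r z\<bar> * ((1 + r) ^ N * (1 + z\<^sup>2)) \<le> C"
  proof (intro exI[of _ "2 ^ (N + 2) * (C0 + C1)"] ballI allI impI)
    fix t r z :: real assume t: "t \<in> K" and r: "0 \<le> r"
    let ?x = "cyl r 0 z"
    define n where "n = norm ?x"
    have "\<bar>?x $ 1\<bar> \<le> n" "\<bar>?x $ 3\<bar> \<le> n" unfolding n_def by (rule component_le_norm_cart)+
    then have rn: "r \<le> n" and zn: "\<bar>z\<bar> \<le> n" using r by (simp_all add: cyl_def)
    have n0: "0 \<le> n" by (simp add: n_def)
    \<comment> \<open>All weights are dominated by a power of one plus the norm, hence by the two bounds with exponents \<open>0\<close> and \<open>N + 2\<close>.\<close>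
    have "1 + z\<^sup>2 \<le> (1 + n)\<^sup>2"
    proof -
      have "z\<^sup>2 \<le> n\<^sup>2" using power_mono[OF zn, of 2] by simp
      then show ?thesis using n0 by (simp add: power2_eq_square algebra_simps)
    qed
    moreover have "(1 + r) ^ N \<le> (1 + n) ^ N" using rn r by (intro power_mono) auto
    ultimately have "(1 + r) ^ N * (1 + z\<^sup>2) \<le> (1 + n) ^ N * (1 + n)\<^sup>2"
      using r n0 by (intro mult_mono) auto
    also have "\<dots> = (1 + n) ^ (N + 2)" by (rule power_add[symmetric])
    also have "\<dots> \<le> (2 * max 1 n) ^ (N + 2)" using n0 by (intro power_mono) auto
    also have "\<dots> = 2 ^ (N + 2) * max 1 n ^ (N + 2)" by (rule power_mult_distrib)
    also have "\<dots> \<le> 2 ^ (N + 2) * (1 + n ^ (N + 2))"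
      using n0 by (intro mult_left_mono) (auto simp: max_def)
    finally have w: "(1 + r) ^ N * (1 + z\<^sup>2) \<le> 2 ^ (N + 2) * (1 + n ^ (N + 2))" .
    have "\<bar>profile js i t r z\<bar> * ((1 + r) ^ N * (1 + z\<^sup>2))
        \<le> norm (pds js (u t) ?x) * (2 ^ (N + 2) * (1 + n ^ (N + 2)))"
      unfolding profile_def using r by (intro mult_mono[OF component_le_norm_cart w]) auto
    also have "\<dots> = 2 ^ (N + 2) * (norm ?x ^ 0 * norm (pds js (u t) ?x) + norm ?x ^ (N + 2) * norm (pds js (u t) ?x))"
      unfolding n_def by (simp add: algebra_simps)
    also have "\<dots> \<le> 2 ^ (N + 2) * (C0 + C1)"
      by (intro mult_left_mono add_mono C0[OF t] C1[OF t]) simp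
    finally show "\<bar>profile js i t r z\<bar> * ((1 + r) ^ N * (1 + z\<^sup>2)) \<le> 2 ^ (N + 2) * (C0 + C1)" .
  qed
qed

lemma profile_axis:
  assumes "t \<in> I"
  shows "profile [] 2 t 0 z = 0" "profile [3] 2 t 0 z = 0" "profile [3, 3] 2 t 0 z = 0"
proof -
  show 0: "profile [] 2 t 0 z = 0" for z
    using vanishing_on_axis[OF assms] by (simp add: profile_def)
  show 1: "profile [3] 2 t 0 z = 0" for z
    using profile_z[OF assms, of "[]" 2 0 z] DERIV_unique[OF _ DERIV_const] unfolding 0 by blast
  show "profile [3, 3] 2 t 0 z = 0"
    using profile_z[OF assms, of "[3]" 2 0 z] DERIV_unique[OF _ DERIV_const] unfolding 1 by blast
qed

text \<open>The quotient $u^\theta / r$ and its partial derivatives, written out so that their numerators fit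
  \<open>decays_quotient\<close>.\<close>

definition "swirl t r z = profile [] 2 t r z / r"
definition "swirl_r t r z = (r * profile [1] 2 t r z - profile [] 2 t r z) / r\<^sup>2"
definition "swirl_z t r z = profile [3] 2 t r z / r"
definition "swirl_rr t r z = (r\<^sup>2 * profile [1, 1] 2 t r z - 2 * r * profile [1] 2 t r z + 2 * profile [] 2 t r z) / r ^ 3"
definition "swirl_zz t r z = profile [3, 3] 2 t r z / r"

lemma swirl_deriv_r:
  assumes "t \<in> I" "r > 0"
  shows "((\<lambda>r. swirl t r z) has_real_derivative swirl_r t r z) (at r)"
  unfolding swirl_def swirl_r_def
  by (rule derivative_eq_intros profile_r[OF assms(1)] refl | use assms in \<open>simp add: field_simps power2_eq_square\<close>)+

lemma swirl_deriv_z: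
  assumes "t \<in> I" "r > 0"
  shows "((\<lambda>z. swirl t r z) has_real_derivative swirl_z t r z) (at z)"
  unfolding swirl_def swirl_z_def by (rule DERIV_cdivide[OF profile_z[OF assms(1)]])

lemma swirl_deriv_rr:
  assumes "t \<in> I" "r > 0"
  shows "((\<lambda>r. swirl_r t r z) has_real_derivative swirl_rr t r z) (at r)"
proof -
  have "((\<lambda>r. swirl_r t r z) has_real_derivative
     ((profile [1] 2 t r z + r * profile [1, 1] 2 t r z - profile [1] 2 t r z) * r\<^sup>2
       - (r * profile [1] 2 t r z - profile [] 2 t r z) * (2 * r)) / (r\<^sup>2 * r\<^sup>2)) (at r)"
    unfolding swirl_r_def
    by (rule derivative_eq_intros profile_r[OF assms(1)] refl | use assms in simp)+
  moreover have "((profile [1] 2 t r z + r * profile [1, 1] 2 t r z - profile [1] 2 t r z) * r\<^sup>2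
       - (r * profile [1] 2 t r z - profile [] 2 t r z) * (2 * r)) / (r\<^sup>2 * r\<^sup>2) = swirl_rr t r z"
    unfolding swirl_rr_def using assms by (simp add: field_simps power2_eq_square power3_eq_cube)
  ultimately show ?thesis by simp
qed

lemma swirl_deriv_zz:
  assumes "t \<in> I" "r > 0"
  shows "((\<lambda>z. swirl_z t r z) has_real_derivative swirl_zz t r z) (at z)"
  unfolding swirl_z_def swirl_zz_def by (rule DERIV_cdivide[OF profile_z[OF assms(1)]])

lemma decays_swirl:
  assumes K: "compact K" "K \<subseteq> I"
  shows "decays K swirl" "decays K swirl_r" "decays K swirl_z" "decays K swirl_rr" "decays K swirl_zz"
proof -
  note d = decays_profile[OF K]
  have tI: "t \<in> I" if "t \<in> K" for t using K that by blast
  have "decays K (\<lambda>t r z. profile [] 2 t r z / r ^ Suc 0)"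
    by (rule decays_quotient[of _ _ _ "profile [1] 2"]) (use profile_r profile_axis tI d in simp_all)
  then show "decays K swirl" by (rule decays_cong) (simp add: swirl_def)
  have "decays K (\<lambda>t r z. profile [3] 2 t r z / r ^ Suc 0)"
    by (rule decays_quotient[of _ _ _ "profile [1, 3] 2"]) (use profile_r profile_axis tI d in simp_all)
  then show "decays K swirl_z" by (rule decays_cong) (simp add: swirl_z_def)
  have "decays K (\<lambda>t r z. profile [3, 3] 2 t r z / r ^ Suc 0)"
    by (rule decays_quotient[of _ _ _ "profile [1, 3, 3] 2"]) (use profile_r profile_axis tI d in simp_all)
  then show "decays K swirl_zz" by (rule decays_cong) (simp add: swirl_zz_def)
  have "decays K (\<lambda>t r z. (r * profile [1] 2 t r z - profile [] 2 t r z) / r ^ Suc 1)"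
  proof (rule decays_quotient[of _ _ _ "profile [1, 1] 2"])
    show "decays K (\<lambda>t r z. r * profile [1] 2 t r z - profile [] 2 t r z)"
      by (intro decays_diff decays_mult_r d)
    show "((\<lambda>r. r * profile [1] 2 t r z - profile [] 2 t r z) has_real_derivative r ^ 1 * profile [1, 1] 2 t r z) (at r)"
      if "t \<in> K" for t r z
      by (rule derivative_eq_intros profile_r[OF tI[OF that]] refl | simp)+
  qed (use profile_axis tI d in simp_all)
  then show "decays K swirl_r" by (rule decays_cong) (simp add: swirl_r_def power2_eq_square)
  have "decays K (\<lambda>t r z. (r ^ 2 * profile [1, 1] 2 t r z - 2 * (r * profile [1] 2 t r z) + 2 * profile [] 2 t r z) / r ^ Suc 2)"
  proof (rule decays_quotient[of _ _ _ "profile [1, 1, 1] 2"])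
    show "decays K (\<lambda>t r z. r ^ 2 * profile [1, 1] 2 t r z - 2 * (r * profile [1] 2 t r z) + 2 * profile [] 2 t r z)"
      by (intro decays_diff decays_add decays_cmult decays_mult_r decays_power_r d)
    show "((\<lambda>r. r ^ 2 * profile [1, 1] 2 t r z - 2 * (r * profile [1] 2 t r z) + 2 * profile [] 2 t r z)
        has_real_derivative r ^ 2 * profile [1, 1, 1] 2 t r z) (at r)"
      if "t \<in> K" for t r z
      by (rule derivative_eq_intros profile_r[OF tI[OF that]] refl | simp)+
  qed (use profile_axis tI d in simp_all)
  then show "decays K swirl_rr" by (rule decays_cong) (simp add: swirl_rr_def power3_eq_cube power2_eq_square mult.assoc)
qed

lemma tame_fields:
  assumes t: "t \<in> I"
  shows "tame (swirl t)" "tame (swirl_r t)" "tame (swirl_z t)" "tame (swirl_rr t)" "tame (swirl_zz t)" "tame (profile js i t)"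
proof -
  have K: "compact {t}" "{t} \<subseteq> I" using t by auto
  have *: "tame (X t)" if "continuous_on halfplane (\<lambda>x. X t (fst x) (snd x))" "decays {t} X" for X
    by (rule tameI[of _ t]) (use that in \<open>auto simp: continuous_on_halfplane_case decays_def\<close>)
  have pos: "\<forall>x\<in>halfplane. fst x ^ k \<noteq> 0" for k by (auto simp: halfplane_def)
  have pos1: "\<forall>x\<in>halfplane. fst x \<noteq> 0" by (auto simp: halfplane_def)
  show "tame (swirl t)" by (rule *[OF _ decays_swirl(1)[OF K]]) (unfold swirl_def, intro continuous_intros t pos1)
  show "tame (swirl_r t)" by (rule *[OF _ decays_swirl(2)[OF K]]) (unfold swirl_r_def, intro continuous_intros t pos)
  show "tame (swirl_z t)" by (rule *[OF _ decays_swirl(3)[OF K]]) (unfold swirl_z_def, intro continuous_intros t pos1)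
  show "tame (swirl_rr t)" by (rule *[OF _ decays_swirl(4)[OF K]]) (unfold swirl_rr_def, intro continuous_intros t pos)
  show "tame (swirl_zz t)" by (rule *[OF _ decays_swirl(5)[OF K]]) (unfold swirl_zz_def, intro continuous_intros t pos1)
  show "tame (profile js i t)" by (rule *[OF _ decays_profile[OF K]]) (intro continuous_intros t)
qed

text \<open>This is $r^2 F_t$, by the swirl equation. The factor $r^2$ removes the singular coefficient
  $3 / r$ of the operator and belongs to the weight $r^\alpha = r^{\alpha-2} r^2$.\<close>

definition "swirl_rate t r z = \<nu> * (r ^ 2 * swirl_rr t r z + 3 * (r * swirl_r t r z) + r ^ 2 * swirl_zz t r z)
   - r ^ 2 * (profile [] 1 t r z * swirl_r t r z) - r ^ 2 * (profile [] 3 t r z * swirl_z t r z)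
   - 2 * (r * (profile [] 1 t r z * swirl t r z))"

lemma decays_swirl_rate:
  assumes K: "compact K" "K \<subseteq> I"
  shows "decays K swirl_rate"
  unfolding swirl_rate_def
  by (intro decays_diff decays_add decays_cmult decays_mult_r decays_power_r decays_mult decays_swirl[OF K] decays_profile[OF K])

lemma swirl_time_derivative:
  assumes t: "t \<in> I" and r: "r > 0"
  shows "((\<lambda>s. swirl s r z) has_real_derivative swirl_rate t r z / r\<^sup>2) (at t)"
proof -
  have "((\<lambda>s. u s (cyl r 0 z) $ 2) has_vector_derivative vector_derivative (\<lambda>s. u s (cyl r 0 z)) (at t) $ 2) (at t)"
    by (rule bounded_linear.has_vector_derivative[OF bounded_linear_vec_nth u_time_derivative[OF t]])
  then have "((\<lambda>s. swirl s r z) has_real_derivative vector_derivative (\<lambda>s. u s (cyl r 0 z)) (at t) $ 2 / r) (at t)"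
    unfolding swirl_def profile_def
    by (intro DERIV_cdivide) (simp add: has_real_derivative_iff_has_vector_derivative)
  moreover have "vector_derivative (\<lambda>s. u s (cyl r 0 z)) (at t) $ 2 / r = swirl_rate t r z / r\<^sup>2"
    unfolding swirl_equation[OF t r] swirl_rate_def swirl_def swirl_r_def swirl_rr_def swirl_z_def swirl_zz_def profile_def[symmetric]
    using r by (simp add: field_simps power2_eq_square power3_eq_cube)
  ultimately show ?thesis by simp
qed

lemma weighted_transport_at:
  assumes "t \<in> I" "p > 1" "\<alpha> > 1" "\<nu> > 0"
  shows "weighted_transport p \<alpha> \<nu> (swirl t) (swirl_r t) (swirl_z t) (swirl_rr t) (swirl_zz t)
    (profile [] 1 t) (profile [1] 1 t) (profile [] 3 t) (profile [3] 3 t)"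
proof
  show "profile [1] 1 t r z + profile [] 1 t r z / r + profile [3] 3 t r z = 0" if "r > 0" for r z
    using continuity_equation[OF assms(1) that, of z] by (simp add: profile_def)
qed (use assms in \<open>auto intro: swirl_deriv_r swirl_deriv_z swirl_deriv_rr swirl_deriv_zz profile_r profile_z tame_fields\<close>)

lemma weighted_integral_powr_has_derivative:
  assumes t: "t \<in> I" and p: "p > 1" and \<alpha>: "\<alpha> > 1"
  shows "((\<lambda>s. weighted_integral \<alpha> (\<lambda>r z. r ^ 2 * \<bar>swirl s r z\<bar> powr p)) has_real_derivative
     p * weighted_integral \<alpha> (\<lambda>r z. sgn_powr (p - 1) (swirl t r z) * swirl_rate t r z)) (at t)"
proof -
  obtain \<delta> where \<delta>: "\<delta> > 0" "cball t \<delta> \<subseteq> I" using open_I t open_contains_cball by blast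
  define T where "T = {t - \<delta>..t + \<delta>}"
  have T: "compact T" "T \<subseteq> I"
    using \<delta> by (auto simp: T_def cball_def dist_real_def subset_iff abs_le_iff)
  have "((\<lambda>s. weighted_integral \<alpha> (\<lambda>r z. r ^ 2 * \<bar>swirl s r z\<bar> powr p)) has_real_derivative
     weighted_integral \<alpha> (\<lambda>r z. p * (sgn_powr (p - 1) (swirl t r z) * swirl_rate t r z))) (at t)"
  proof (rule weighted_integral_has_real_derivative[OF \<alpha> \<delta>(1) T_def, where X="\<lambda>s r z. r ^ 2 * \<bar>swirl s r z\<bar> powr p"
      and X'="\<lambda>s r z. p * (sgn_powr (p - 1) (swirl s r z) * swirl_rate s r z)"])
    show "tame (\<lambda>r z. r ^ 2 * \<bar>swirl s r z\<bar> powr p)" if "s \<in> T" for s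
      using that T p by (intro tame_power_r tame_abs_powr tame_fields) auto
    show "decays T (\<lambda>s r z. p * (sgn_powr (p - 1) (swirl s r z) * swirl_rate s r z))"
      using p by (intro decays_cmult decays_sgn_powr_mult decays_swirl_rate[OF T] decays_swirl(1)[OF T]) simp
    show "((\<lambda>s. r ^ 2 * \<bar>swirl s r z\<bar> powr p) has_real_derivative p * (sgn_powr (p - 1) (swirl s r z) * swirl_rate s r z)) (at s)"
      if s: "s \<in> T" and r: "r > 0" for s r z
    proof -
      have "s \<in> I" using s T by blast
      from DERIV_cmult[OF DERIV_chain2[OF DERIV_abs_powr[OF p] swirl_time_derivative[OF this r]], of "r ^ 2"]
      show ?thesis using r by (simp add: mult_ac)
    qed
  qed
  then show ?thesis by (simp only: weighted_integral_cmult)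
qed

end

section \<open>Null sets, the measure of the half-plane, and the gradient of the power\<close>

text \<open>Classical derivatives of $|F|^{p/2}$ are only described almost everywhere, so their
  measurability has to come from completeness of Lebesgue measure.\<close>

lemma integral_lebesgue_on_halfplane_AE:
  fixes f f0 :: "real \<times> real \<Rightarrow> real"
  assumes i: "set_integrable lborel halfplane f0" and ae: "AE x in lebesgue_on halfplane. f x = f0 x"
  shows "integrable (lebesgue_on halfplane) f
       \<and> integral\<^sup>L (lebesgue_on halfplane) f = (LINT x:halfplane|lborel. f0 x)"
proof -
  define g where "g = (\<lambda>x. indicator halfplane x *\<^sub>R f0 x)"
  define h where "h = (\<lambda>x. indicator halfplane x *\<^sub>R f x)"
  have hs: "halfplane \<inter> space lebesgue \<in> sets lebesgue" by simp
  have g: "integrable lborel g" using i by (simp add: g_def set_integrable_def)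
  then have gl: "integrable lebesgue g" by (simp add: integrable_completion)
  have "AE x in lebesgue. x \<in> halfplane \<longrightarrow> f x = f0 x"
    using ae by (subst (asm) AE_restrict_space_iff[OF hs])
  then have aeq: "AE x in lebesgue. g x = h x"
    by eventually_elim (auto simp: g_def h_def indicator_def)
  have hm: "h \<in> borel_measurable lebesgue"
    by (rule borel_measurable_AE[OF borel_measurable_integrable[OF gl] aeq])
  have ih: "integrable lebesgue h" by (rule integrable_cong_AE_imp[OF gl hm aeq])
  have "integral\<^sup>L lebesgue h = integral\<^sup>L lebesgue g"
    by (rule integral_cong_AE[OF hm borel_measurable_integrable[OF gl]]) (use aeq in eventually_elim, simp)
  also have "\<dots> = integral\<^sup>L lborel g"
    by (rule integral_completion) (use g in simp)
  finally have "integral\<^sup>L lebesgue h = integral\<^sup>L lborel g" .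
  then show ?thesis
    using ih by (simp add: integrable_restrict_space[OF hs] integral_restrict_space[OF hs] h_def g_def set_lebesgue_integral_def)
qed

lemma integral_mu_AE:
  fixes f f0 :: "real \<times> real \<Rightarrow> real"
  assumes i: "set_integrable lborel halfplane (\<lambda>x. fst x powr \<alpha> * f0 x)"
    and ae: "AE x in lebesgue_on halfplane. f x = f0 x"
  shows "integrable (mu \<alpha>) f \<and> integral\<^sup>L (mu \<alpha>) f = (LINT x:halfplane|lborel. fst x powr \<alpha> * f0 x)"
proof -
  have fst_m [measurable]: "(fst :: real \<times> real \<Rightarrow> real) \<in> borel_measurable borel"
    by (intro borel_measurable_continuous_onI continuous_intros)
  have w: "(\<lambda>x :: real \<times> real. fst x powr \<beta>) \<in> borel_measurable (lebesgue_on halfplane)" for \<beta>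
  proof (rule measurable_restrict_space1, rule measurable_completion)
    show "(\<lambda>x :: real \<times> real. fst x powr \<beta>) \<in> borel_measurable lborel"
      unfolding measurable_lborel1 by measurable
  qed
  have ae': "AE x in lebesgue_on halfplane. fst x powr \<alpha> * f x = fst x powr \<alpha> * f0 x"
    using ae by eventually_elim simp
  note I = integral_lebesgue_on_halfplane_AE[OF i ae']
  have "(\<lambda>x. fst x powr (- \<alpha>) * (fst x powr \<alpha> * f x)) \<in> borel_measurable (lebesgue_on halfplane)"
    by (rule borel_measurable_times[OF w borel_measurable_integrable[OF conjunct1[OF I]]])
  then have fm: "f \<in> borel_measurable (lebesgue_on halfplane)"
    by (rule measurable_cong[THEN iffD1, rotated])
      (auto simp: space_restrict_space halfplane_def powr_minus)
  have mu: "mu \<alpha> = density (lebesgue_on halfplane) (\<lambda>x. ennreal (fst x powr \<alpha>))"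
    by (simp add: mu_def case_prod_unfold)
  show ?thesis
    unfolding mu using I
    by (simp add: integrable_density[OF fm w] integral_density[OF fm w])
qed

lemma null_set_of_null_slices:
  assumes N: "N \<in> sets (borel :: (real \<times> real) measure)"
  shows "(\<And>r. countable {z. (r, z) \<in> N}) \<Longrightarrow> N \<in> null_sets lborel"
    and "(\<And>z. countable {r. (r, z) \<in> N}) \<Longrightarrow> N \<in> null_sets lborel"
proof -
  have N': "N \<in> sets (lborel \<Otimes>\<^sub>M lborel)" using N unfolding lborel_prod by simp
  have null: "emeasure lborel A = 0" if "countable A" for A :: "real set"
    using countable_imp_null_set_lborel[OF that] by (simp add: null_sets_def)
  show "N \<in> null_sets lborel" if "\<And>r. countable {z. (r, z) \<in> N}"
  proof -
    have "emeasure (lborel \<Otimes>\<^sub>M lborel) N = (\<integral>\<^sup>+r. emeasure lborel (Pair r -` N) \<partial>lborel)"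
      by (rule lborel.emeasure_pair_measure_alt[OF N'])
    also have "\<dots> = 0" using null that by (simp add: vimage_def)
    finally show ?thesis using N by (simp add: lborel_prod null_sets_def)
  qed
  show "N \<in> null_sets lborel" if "\<And>z. countable {r. (r, z) \<in> N}"
  proof -
    have "emeasure (lborel \<Otimes>\<^sub>M lborel) N = (\<integral>\<^sup>+z. emeasure lborel ((\<lambda>r. (r, z)) -` N) \<partial>lborel)"
      by (rule lborel_pair.emeasure_pair_measure_alt2[OF N'])
    also have "\<dots> = 0" using null that by (simp add: vimage_def)
    finally show ?thesis using N by (simp add: lborel_prod null_sets_def)
  qed
qed

lemma sets_borel_zero_nonzero:
  fixes X Y :: "real \<Rightarrow> real \<Rightarrow> real"
  assumes X: "continuous_on halfplane (\<lambda>(r, z). X r z)" and Y: "continuous_on halfplane (\<lambda>(r, z). Y r z)"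
  shows "{x \<in> halfplane. X (fst x) (snd x) = 0 \<and> Y (fst x) (snd x) \<noteq> 0} \<in> sets borel"
proof -
  define X' where "X' = (\<lambda>x. indicator halfplane x * (case x of (r, z) \<Rightarrow> X r z))"
  define Y' where "Y' = (\<lambda>x. indicator halfplane x * (case x of (r, z) \<Rightarrow> Y r z))"
  have [measurable]: "X' \<in> borel_measurable borel" "Y' \<in> borel_measurable borel"
    using borel_measurable_continuous_on_indicator[OF halfplane_sets X]
      borel_measurable_continuous_on_indicator[OF halfplane_sets Y] by (simp_all add: X'_def Y'_def)
  have "{x \<in> halfplane. X (fst x) (snd x) = 0 \<and> Y (fst x) (snd x) \<noteq> 0}
      = (X' -` {0} \<inter> space borel) \<inter> (Y' -` (- {0}) \<inter> space borel) \<inter> halfplane"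
    by (auto simp: X'_def Y'_def indicator_def case_prod_unfold)
  moreover have "\<dots> \<in> sets borel"
    by (intro sets.Int measurable_sets[of _ borel borel] halfplane_sets) (auto simp: borel_open)
  ultimately show ?thesis by simp
qed

lemma differentiable_local_lipschitz:
  fixes f :: "'a::real_normed_vector \<Rightarrow> real"
  assumes "f differentiable (at x)"
  shows "\<exists>M\<ge>0. \<exists>d>0. \<forall>y. norm (y - x) < d \<longrightarrow> \<bar>f y - f x\<bar> \<le> M * norm (y - x)"
proof -
  obtain f' where f': "(f has_derivative f') (at x)" using assms by (auto simp: differentiable_def)
  then have bl: "bounded_linear f'" by (rule has_derivative_bounded_linear)
  obtain d where d: "d > 0" "\<forall>y. norm (y - x) < d \<longrightarrow> norm (f y - f x - f' (y - x)) \<le> 1 * norm (y - x)"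
    using f'[unfolded has_derivative_at_alt] zero_less_one by blast
  show ?thesis
  proof (rule exI[of _ "1 + onorm f'"], intro conjI exI[of _ d] allI impI)
    show "0 \<le> 1 + onorm f'" using onorm_pos_le[OF bl] by simp
    fix y assume y: "norm (y - x) < d"
    have "\<bar>f y - f x\<bar> \<le> \<bar>f y - f x - f' (y - x)\<bar> + \<bar>f' (y - x)\<bar>" by linarith
    also have "\<dots> \<le> norm (y - x) + onorm f' * norm (y - x)"
      using d(2) y onorm[OF bl, of "y - x"] by (intro add_mono) auto
    finally show "\<bar>f y - f x\<bar> \<le> (1 + onorm f') * norm (y - x)" by (simp add: algebra_simps)
  qed (rule d(1))
qed

text \<open>At a degenerate zero the gradient is at most a multiple of the distance to \<open>x\<close>, so $|f|$ is at most a multiple of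
  its square and $|f|^q$ by a power with exponent $2q > 1$.\<close>

lemma has_derivative_abs_powr_degenerate_zero:
  fixes f A B :: "real \<times> real \<Rightarrow> real"
  assumes q: "q > 1/2" and S: "open S" "x \<in> S"
    and f: "\<And>y. y \<in> S \<Longrightarrow> (f has_derivative (\<lambda>h. A y * fst h + B y * snd h)) (at y)"
    and A: "A differentiable (at x)" and B: "B differentiable (at x)"
    and zero: "f x = 0" "A x = 0" "B x = 0"
  shows "((\<lambda>y. \<bar>f y\<bar> powr q) has_derivative (\<lambda>h. 0)) (at x)"
proof -
  obtain M1 d1 where M1: "M1 \<ge> 0" "d1 > 0" "\<And>y. norm (y - x) < d1 \<Longrightarrow> \<bar>A y\<bar> \<le> M1 * norm (y - x)"
    using differentiable_local_lipschitz[OF A] zero by auto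
  obtain M2 d2 where M2: "M2 \<ge> 0" "d2 > 0" "\<And>y. norm (y - x) < d2 \<Longrightarrow> \<bar>B y\<bar> \<le> M2 * norm (y - x)"
    using differentiable_local_lipschitz[OF B] zero by auto
  obtain d3 where d3: "d3 > 0" "ball x d3 \<subseteq> S" using S open_contains_ball by blast
  define d where "d = min d1 (min d2 d3)"
  have d: "d > 0" using M1 M2 d3 by (simp add: d_def)
  define M where "M = M1 + M2"
  have M0: "M \<ge> 0" using M1 M2 by (simp add: M_def)
  have quad: "\<bar>f y\<bar> \<le> M * (norm (y - x))\<^sup>2" if y: "norm (y - x) < d" for y
  proof -
    define C where "C = cball x (norm (y - x))"
    have near: "norm (w - x) \<le> norm (y - x)" "w \<in> S" "norm (w - x) < d1" "norm (w - x) < d2" if "w \<in> C" for w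
    proof -
      show 1: "norm (w - x) \<le> norm (y - x)" using that by (simp add: C_def dist_norm norm_minus_commute)
      then have "w \<in> ball x d3" using y by (simp add: d_def dist_norm norm_minus_commute)
      then show "w \<in> S" using d3(2) by blast
      show "norm (w - x) < d1" "norm (w - x) < d2" using 1 y by (simp_all add: d_def)
    qed
    have "norm (f y - f x) \<le> (M * norm (y - x)) * norm (y - x)"
    proof (rule differentiable_bound[of C])
      show "convex C" "y \<in> C" "x \<in> C" by (auto simp: C_def dist_norm norm_minus_commute)
      fix w assume w: "w \<in> C"
      show "(f has_derivative (\<lambda>h. A w * fst h + B w * snd h)) (at w within C)"
        by (rule has_derivative_at_withinI[OF f[OF near(2)[OF w]]])
      show "onorm (\<lambda>h. A w * fst h + B w * snd h) \<le> M * norm (y - x)"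
      proof (rule onorm_bound)
        show "0 \<le> M * norm (y - x)" using M0 by simp
        fix h :: "real \<times> real"
        have "norm (A w * fst h + B w * snd h) \<le> \<bar>A w\<bar> * \<bar>fst h\<bar> + \<bar>B w\<bar> * \<bar>snd h\<bar>"
          by (metis abs_mult abs_triangle_ineq real_norm_def)
        also have "\<dots> \<le> (M1 * norm (y - x)) * norm h + (M2 * norm (y - x)) * norm h"
        proof (intro add_mono mult_mono)
          show "\<bar>A w\<bar> \<le> M1 * norm (y - x)"
            using M1(3)[OF near(3)[OF w]] mult_left_mono[OF near(1)[OF w] M1(1)] by linarith
          show "\<bar>B w\<bar> \<le> M2 * norm (y - x)"
            using M2(3)[OF near(4)[OF w]] mult_left_mono[OF near(1)[OF w] M2(1)] by linarith
        qed (use M1 M2 norm_fst_le[of "fst h" "snd h"] norm_snd_le[of "snd h" "fst h"] in auto)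
        also have "\<dots> = M * norm (y - x) * norm h" by (simp add: M_def algebra_simps)
        finally show "norm (A w * fst h + B w * snd h) \<le> M * norm (y - x) * norm h" .
      qed
    qed
    then show ?thesis using zero by (simp add: power2_eq_square mult.assoc)
  qed
  have "((\<lambda>h. norm (\<bar>f (x + h)\<bar> powr q - \<bar>f x\<bar> powr q - 0) / norm h) \<longlongrightarrow> 0) (at 0)"
  proof (rule Lim_null_comparison)
    have "continuous_on UNIV (\<lambda>h::real \<times> real. M powr q * norm h powr (2 * q - 1))"
      by (intro continuous_intros continuous_on_powr') (use q in auto)
    then have "isCont (\<lambda>h::real \<times> real. M powr q * norm h powr (2 * q - 1)) 0"
      using continuous_on_eq_continuous_at[OF open_UNIV] by blast
    then show "((\<lambda>h::real \<times> real. M powr q * norm h powr (2 * q - 1)) \<longlongrightarrow> 0) (at 0)"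
      using q by (simp add: isCont_def)
    show "\<forall>\<^sub>F h in at 0. norm (norm (\<bar>f (x + h)\<bar> powr q - \<bar>f x\<bar> powr q - 0) / norm h)
        \<le> M powr q * norm h powr (2 * q - 1)"
      unfolding eventually_at
    proof (intro exI[of _ d] conjI d ballI impI)
      fix h :: "real \<times> real" assume h: "h \<noteq> 0 \<and> dist h 0 < d"
      have "\<bar>f (x + h)\<bar> powr q \<le> (M * (norm h)\<^sup>2) powr q"
        using quad[of "x + h"] h q by (intro powr_mono2) auto
      also have "\<dots> = M powr q * norm h powr (2 * q)"
        using M0 by (simp add: powr_mult powr_powr flip: powr_numeral)
      finally have "\<bar>f (x + h)\<bar> powr q / norm h \<le> M powr q * norm h powr (2 * q) / norm h"
        by (rule divide_right_mono) simp
      then show "norm (norm (\<bar>f (x + h)\<bar> powr q - \<bar>f x\<bar> powr q - 0) / norm h)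
        \<le> M powr q * norm h powr (2 * q - 1)"
        using h zero by (simp add: powr_diff)
    qed
  qed
  then show ?thesis by (simp add: has_derivative_at)
qed

lemma has_derivative_abs_powr:
  fixes f A B :: "real \<times> real \<Rightarrow> real"
  assumes q: "q > 1/2" and S: "open S" "x \<in> S"
    and f: "\<And>y. y \<in> S \<Longrightarrow> (f has_derivative (\<lambda>h. A y * fst h + B y * snd h)) (at y)"
    and A: "A differentiable (at x)" and B: "B differentiable (at x)"
    and x: "f x \<noteq> 0 \<or> A x = 0 \<and> B x = 0"
  shows "((\<lambda>y. \<bar>f y\<bar> powr q) has_derivative
     (\<lambda>h. q * sgn_powr (q - 1) (f x) * A x * fst h + q * sgn_powr (q - 1) (f x) * B x * snd h)) (at x)"
proof (cases "f x = 0")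
  case True
  then show ?thesis using has_derivative_abs_powr_degenerate_zero[OF q S f A B] x by simp
next
  case False
  have "((\<lambda>y. \<bar>f y\<bar> powr q) has_derivative (\<lambda>h. (A x * fst h + B x * snd h) * (q * sgn_powr (q - 1) (f x)))) (at x)"
    by (rule has_derivative_compose[OF f[OF S(2)]])
      (use DERIV_abs_powr_nonzero[OF False, of q] in \<open>simp add: has_field_derivative_def mult.commute[of _ "_ * sgn_powr _ _"]\<close>)
  then show ?thesis by (simp add: algebra_simps)
qed

lemma grad_eqI:
  assumes "((\<lambda>(r, z). h r z) has_derivative (\<lambda>v. a * fst v + b * snd v)) (at (r, z))"
  shows "grad h (r, z) = (a, b)"
proof -
  have 1: "((\<lambda>s. (s, z)) has_derivative (\<lambda>k. (k, 0))) (at r)"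
    by (intro derivative_eq_intros) auto
  have 2: "((\<lambda>s. (r, s)) has_derivative (\<lambda>k. (0, k))) (at z)"
    by (intro derivative_eq_intros) auto
  have "((\<lambda>s. h s z) has_real_derivative a) (at r)" "((\<lambda>s. h r s) has_real_derivative b) (at z)"
    using has_derivative_compose[OF 1 assms] has_derivative_compose[OF 2 assms]
    by (simp_all add: has_field_derivative_def)
  then show ?thesis by (simp add: grad_def DERIV_imp_deriv)
qed

lemma norm_pair_power2: "(norm (a :: real, b :: real))\<^sup>2 = a\<^sup>2 + b\<^sup>2"
  by (simp add: norm_Pair)

lemma gradient_of_abs_powr_half:
  fixes f A B :: "real \<Rightarrow> real \<Rightarrow> real"
  assumes p: "p > 1" and S: "open S" "(r, z) \<in> S"
    and f: "\<And>r z. (r, z) \<in> S \<Longrightarrow> ((\<lambda>(r, z). f r z) has_derivative (\<lambda>h. A r z * fst h + B r z * snd h)) (at (r, z))"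
    and A: "(\<lambda>(r, z). A r z) differentiable (at (r, z))" and B: "(\<lambda>(r, z). B r z) differentiable (at (r, z))"
    and x: "f r z \<noteq> 0 \<or> A r z = 0 \<and> B r z = 0"
  shows "(\<lambda>(r, z). \<bar>f r z\<bar> powr (p / 2)) differentiable (at (r, z))"
    and "(norm (grad (\<lambda>r z. \<bar>f r z\<bar> powr (p / 2)) (r, z)))\<^sup>2
       = p\<^sup>2 / 4 * (\<bar>f r z\<bar> powr (p - 2) * ((A r z)\<^sup>2 + (B r z)\<^sup>2))"
proof -
  define c where "c = p / 2 * sgn_powr (p / 2 - 1) (f r z)"
  have "((\<lambda>y. \<bar>case y of (r, z) \<Rightarrow> f r z\<bar> powr (p / 2)) has_derivative
     (\<lambda>h. p / 2 * sgn_powr (p / 2 - 1) (case (r, z) of (r, z) \<Rightarrow> f r z) * (case (r, z) of (r, z) \<Rightarrow> A r z) * fst h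
        + p / 2 * sgn_powr (p / 2 - 1) (case (r, z) of (r, z) \<Rightarrow> f r z) * (case (r, z) of (r, z) \<Rightarrow> B r z) * snd h)) (at (r, z))"
    by (rule has_derivative_abs_powr[OF _ S _ A B]) (use p x f in auto)
  then have d: "((\<lambda>(r, z). \<bar>f r z\<bar> powr (p / 2)) has_derivative
      (\<lambda>h. c * A r z * fst h + c * B r z * snd h)) (at (r, z))"
    by (simp add: case_prod_unfold c_def)
  then show "(\<lambda>(r, z). \<bar>f r z\<bar> powr (p / 2)) differentiable (at (r, z))"
    unfolding differentiable_def by blast
  have c2: "c\<^sup>2 = p\<^sup>2 / 4 * \<bar>f r z\<bar> powr (p - 2)"
  proof -
    have "c\<^sup>2 = (p / 2)\<^sup>2 * \<bar>sgn_powr (p / 2 - 1) (f r z)\<bar>\<^sup>2"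
      by (simp add: c_def power_mult_distrib power_divide)
    also have "\<bar>sgn_powr (p / 2 - 1) (f r z)\<bar>\<^sup>2 = \<bar>f r z\<bar> powr (p - 2)"
      unfolding abs_sgn_powr power2_eq_square powr_add[symmetric] by simp
    finally show ?thesis by (simp add: power2_eq_square)
  qed
  show "(norm (grad (\<lambda>r z. \<bar>f r z\<bar> powr (p / 2)) (r, z)))\<^sup>2
       = p\<^sup>2 / 4 * (\<bar>f r z\<bar> powr (p - 2) * ((A r z)\<^sup>2 + (B r z)\<^sup>2))"
    unfolding grad_eqI[OF d] norm_pair_power2 power_mult_distrib c2 by (simp add: algebra_simps)
qed

context axisymmetric_NS
begin

lemma profile_has_derivative:
  assumes t: "t \<in> I"
  shows "((\<lambda>x. profile js i t (fst x) (snd x)) has_derivative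
     (\<lambda>h. profile (1 # js) i t (fst x) (snd x) * fst h + profile (3 # js) i t (fst x) (snd x) * snd h)) (at x)"
proof -
  let ?g = "pds js (u t)"
  let ?c = "\<lambda>x :: real \<times> real. cyl (fst x) 0 (snd x)"
  have c: "(?c has_derivative (\<lambda>h. fst h *\<^sub>R axis 1 1 + 0 *\<^sub>R axis 2 1 + snd h *\<^sub>R axis 3 1)) (at x)"
    unfolding cyl_def vector_3_eq by (auto intro!: derivative_eq_intros)
  have g: "?g differentiable (at (?c x))" by (rule pds_u_differentiable[OF t])
  have "((\<lambda>x. ?g (?c x)) has_derivative
      (\<lambda>h. frechet_derivative ?g (at (?c x)) (fst h *\<^sub>R axis 1 1 + 0 *\<^sub>R axis 2 1 + snd h *\<^sub>R axis 3 1))) (at x)"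
    by (rule has_derivative_compose[OF c frechet_derivative_works[THEN iffD1, OF g]])
  from bounded_linear.has_derivative[OF bounded_linear_vec_nth[of i] this]
  show ?thesis
    by (simp add: profile_def frechet_derivative_eq_pd[OF g] axis_def mult.commute)
qed

lemma profile_differentiable: "t \<in> I \<Longrightarrow> (\<lambda>x. profile js i t (fst x) (snd x)) differentiable (at x)"
  using profile_has_derivative unfolding differentiable_def by blast

lemma swirl_has_derivative:
  assumes t: "t \<in> I" and r: "r > 0"
  shows "((\<lambda>(r, z). swirl t r z) has_derivative (\<lambda>h. swirl_r t r z * fst h + swirl_z t r z * snd h)) (at (r, z))"
proof -
  have "((\<lambda>x. profile [] 2 t (fst x) (snd x) / fst x) has_derivative
      (\<lambda>h. ((profile [1] 2 t r z * fst h + profile [3] 2 t r z * snd h) * r - profile [] 2 t r z * fst h) / (r * r))) (at (r, z))"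
    using has_derivative_divide'[OF profile_has_derivative[OF t, of "[]" 2 "(r, z)"]
        has_derivative_fst[OF has_derivative_ident]] r by simp
  moreover have "((profile [1] 2 t r z * fst h + profile [3] 2 t r z * snd h) * r - profile [] 2 t r z * fst h) / (r * r)
      = swirl_r t r z * fst h + swirl_z t r z * snd h" for h :: "real \<times> real"
    unfolding swirl_r_def swirl_z_def using r by (simp add: field_simps power2_eq_square)
  ultimately show ?thesis by (simp add: swirl_def case_prod_unfold)
qed

lemma swirl_gradient_differentiable:
  assumes t: "t \<in> I" and r: "r > 0"
  shows "(\<lambda>(r, z). swirl_r t r z) differentiable (at (r, z))" "(\<lambda>(r, z). swirl_z t r z) differentiable (at (r, z))"
proof -
  have fst: "(fst :: real \<times> real \<Rightarrow> real) differentiable (at x)" for x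
    by (rule bounded_linear_imp_differentiable[OF bounded_linear_fst])
  show "(\<lambda>(r, z). swirl_r t r z) differentiable (at (r, z))" "(\<lambda>(r, z). swirl_z t r z) differentiable (at (r, z))"
    unfolding swirl_r_def swirl_z_def case_prod_unfold
    using r by (auto intro!: differentiable_divide differentiable_diff differentiable_mult differentiable_power
        fst profile_differentiable[OF t])
qed

text \<open>The simple zeros along radial or axial lines, where the gradient formula for $|F|^{p/2}$ may
  fail.\<close>

definition degenerate_set :: "real \<Rightarrow> (real \<times> real) set" where
  "degenerate_set t = {x \<in> halfplane. swirl t (fst x) (snd x) = 0 \<and> swirl_r t (fst x) (snd x) \<noteq> 0}
     \<union> {x \<in> halfplane. swirl t (fst x) (snd x) = 0 \<and> swirl_z t (fst x) (snd x) \<noteq> 0}"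

lemma AE_not_degenerate:
  assumes t: "t \<in> I"
  shows "AE x in lebesgue_on halfplane. x \<in> halfplane \<and> x \<notin> degenerate_set t"
proof -
  note tf = tame_fields(1-3)[OF t, unfolded tame_def, THEN conjunct1]
  let ?R = "{x \<in> halfplane. swirl t (fst x) (snd x) = 0 \<and> swirl_r t (fst x) (snd x) \<noteq> 0}"
  let ?Z = "{x \<in> halfplane. swirl t (fst x) (snd x) = 0 \<and> swirl_z t (fst x) (snd x) \<noteq> 0}"
  have "?R \<in> null_sets lborel"
  proof (rule null_set_of_null_slices(2)[OF sets_borel_zero_nonzero[OF tf(1,2)]])
    fix z
    have "countable {r \<in> {0<..}. swirl t r z = 0 \<and> swirl_r t r z \<noteq> 0}"
      by (rule countable_simple_zeros) (use swirl_deriv_r[OF t] in auto)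
    then show "countable {r. (r, z) \<in> ?R}" by (rule countable_subset[rotated]) auto
  qed
  moreover have "?Z \<in> null_sets lborel"
  proof (rule null_set_of_null_slices(1)[OF sets_borel_zero_nonzero[OF tf(1,3)]])
    fix r
    show "countable {z. (r, z) \<in> ?Z}"
    proof (cases "r > 0")
      case True
      have "countable {z \<in> UNIV. swirl t r z = 0 \<and> swirl_z t r z \<noteq> 0}"
        by (rule countable_simple_zeros) (use swirl_deriv_z[OF t True] in auto)
      then show ?thesis by (rule countable_subset[rotated]) auto
    qed simp
  qed
  ultimately have "degenerate_set t \<in> null_sets lborel" unfolding degenerate_set_def by (rule null_sets.Un)
  then have "AE x in lebesgue. x \<notin> degenerate_set t"
    by (intro AE_not_in null_sets_completionI)
  then show ?thesis by (subst AE_restrict_space_iff) (auto elim: eventually_mono)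
qed

end

section \<open>The theorem\<close>

theorem theorem3p1:
  fixes p \<alpha> \<nu> :: real and I :: "real set"
    and u :: "real \<Rightarrow> real^3 \<Rightarrow> real^3" and q :: "real \<Rightarrow> real^3 \<Rightarrow> real"
    and ur ut uz F U H :: "real \<Rightarrow> real \<Rightarrow> real \<Rightarrow> real"
  assumes "p > 1" and "\<alpha> > 1" and "\<nu> > 0"
    and "open I" and "is_interval I"
    and "smooth_NS_solution \<nu> I u q"
    and "rapidly_decaying I u"
    and "axisymmetric_with I u ur ut uz"
    and F_eq: "F = (\<lambda>r z t. ut r z t / r)"
    and U_eq: "U = (\<lambda>r z t. ur r z t / r)"
    and H_eq: "H = (\<lambda>r z t. \<bar>F r z t\<bar> powr (p / 2))"
  shows "(\<forall>t\<in>I.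
      (AE x in lebesgue_on halfplane.
         (\<lambda>(r, z). H r z t) differentiable (at x) \<and>
         4 / p\<^sup>2 * (norm (grad (\<lambda>r z. H r z t) x))\<^sup>2
           = (case x of (r, z) \<Rightarrow> \<bar>F r z t\<bar> powr (p - 2)) * (norm (grad (\<lambda>r z. F r z t) x))\<^sup>2) \<and>
      integrable (mu \<alpha>) (\<lambda>(r, z). \<bar>F r z t\<bar> powr p) \<and>
      integrable (mu \<alpha>) (\<lambda>x. (norm (grad (\<lambda>r z. H r z t) x))\<^sup>2) \<and>
      integrable (lebesgue_on halfplane) (\<lambda>(r, z). (H r z t)\<^sup>2 * r powr (\<alpha> - 2)) \<and>
      integrable (mu \<alpha>) (\<lambda>(r, z). U r z t * \<bar>F r z t\<bar> powr p) \<and>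
      Z \<alpha> p F differentiable (at t) \<and>
      1 / p * deriv (Z \<alpha> p F) t
        + \<nu> * (4 * (p - 1) / p\<^sup>2) * (\<integral>x. (norm (grad (\<lambda>r z. H r z t) x))\<^sup>2 \<partial>mu \<alpha>)
        + \<nu> * ((3 - \<alpha>) * (\<alpha> - 1) / p)
            * (\<integral>(r, z). (H r z t)\<^sup>2 * r powr (\<alpha> - 2) \<partial>lebesgue_on halfplane)
      = (\<alpha> - (2 * p + 1)) / p * (\<integral>(r, z). U r z t * \<bar>F r z t\<bar> powr p \<partial>mu \<alpha>))
    \<and> 2 * p + 1 > 1
    \<and> (\<forall>\<beta>::real. (\<beta> - (2 * p + 1)) / p = 0 \<longleftrightarrow> \<beta> = 2 * p + 1)"
proof (intro conjI ballI allI)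
  show "2 * p + 1 > 1" using \<open>p > 1\<close> by simp
  show "(\<beta> - (2 * p + 1)) / p = 0 \<longleftrightarrow> \<beta> = 2 * p + 1" for \<beta> using \<open>p > 1\<close> by auto
next
  fix t assume t: "t \<in> I"
  note p = \<open>p > 1\<close> and \<alpha> = \<open>\<alpha> > 1\<close> and \<nu> = \<open>\<nu> > 0\<close>
  interpret axisymmetric_NS \<nu> I u q ur ut uz
    using \<open>open I\<close> \<open>smooth_NS_solution \<nu> I u q\<close> \<open>rapidly_decaying I u\<close> \<open>axisymmetric_with I u ur ut uz\<close>
    by unfold_locales
  interpret W: weighted_transport p \<alpha> \<nu> "swirl t" "swirl_r t" "swirl_z t" "swirl_rr t" "swirl_zz t"
    "profile [] 1 t" "profile [1] 1 t" "profile [] 3 t" "profile [3] 3 t"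
    by (rule weighted_transport_at[OF t p \<alpha> \<nu>])
  have F: "F r z s = swirl s r z" if "s \<in> I" "r > 0" for r z s
    using components(2)[OF that, of z] by (simp add: F_eq swirl_def profile_def)
  have U: "U r z t = profile [] 1 t r z / r" if "r > 0" for r z
    using components(1)[OF t that, of z] by (simp add: U_eq profile_def)
  have shift: "r powr \<alpha> = r powr (\<alpha> - 2) * r\<^sup>2" if "r > 0" for r :: real
    using that powr_add[of r "\<alpha> - 2" 2] by simp
  have on_halfplane: "AE x in lebesgue_on halfplane. x \<in> halfplane"
    using AE_not_degenerate[OF t] by eventually_elim simp
  have F_derivative: "((\<lambda>(r, z). F r z t) has_derivative (\<lambda>h. swirl_r t r z * fst h + swirl_z t r z * snd h)) (at (r, z))"
    if "(r, z) \<in> halfplane" for r z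
    by (rule has_derivative_transform_within_open[OF swirl_has_derivative[OF t] open_halfplane that])
      (use that in \<open>auto simp: F[OF t]\<close>)
  have H_gradient: "(\<lambda>(r, z). H r z t) differentiable (at (r, z))"
      "(norm (grad (\<lambda>r z. H r z t) (r, z)))\<^sup>2
         = p\<^sup>2 / 4 * (\<bar>swirl t r z\<bar> powr (p - 2) * ((swirl_r t r z)\<^sup>2 + (swirl_z t r z)\<^sup>2))"
    if "r > 0" "(r, z) \<notin> degenerate_set t" for r z
  proof -
    have rz: "(r, z) \<in> halfplane" using that by simp
    have nd: "F r z t \<noteq> 0 \<or> swirl_r t r z = 0 \<and> swirl_z t r z = 0"
      using that F[OF t that(1), of z] by (auto simp: degenerate_set_def)
    note grads = gradient_of_abs_powr_half[OF p open_halfplane rz F_derivative swirl_gradient_differentiable[OF t that(1)] nd]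
    show "(\<lambda>(r, z). H r z t) differentiable (at (r, z))" using grads(1) by (simp add: H_eq)
    show "(norm (grad (\<lambda>r z. H r z t) (r, z)))\<^sup>2
         = p\<^sup>2 / 4 * (\<bar>swirl t r z\<bar> powr (p - 2) * ((swirl_r t r z)\<^sup>2 + (swirl_z t r z)\<^sup>2))"
      using grads(2) F[OF t that(1), of z] by (simp add: H_eq)
  qed
  have gradF: "(norm (grad (\<lambda>r z. F r z t) (r, z)))\<^sup>2 = (swirl_r t r z)\<^sup>2 + (swirl_z t r z)\<^sup>2" if "r > 0" for r z
    using grad_eqI[OF F_derivative] that by (simp add: norm_pair_power2)
  show "AE x in lebesgue_on halfplane. (\<lambda>(r, z). H r z t) differentiable (at x) \<and>
         4 / p\<^sup>2 * (norm (grad (\<lambda>r z. H r z t) x))\<^sup>2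
           = (case x of (r, z) \<Rightarrow> \<bar>F r z t\<bar> powr (p - 2)) * (norm (grad (\<lambda>r z. F r z t) x))\<^sup>2"
    using AE_not_degenerate[OF t]
  proof eventually_elim
    case (elim x)
    obtain r z where x: "x = (r, z)" by (cases x)
    have r: "r > 0" "(r, z) \<notin> degenerate_set t" using elim by (auto simp: x)
    show ?case
      unfolding x case_prod_conv H_gradient(2)[OF r] gradF[OF r(1)] F[OF t r(1)]
      using p H_gradient(1)[OF r] by simp
  qed
  \<comment> \<open>Integrals against the weight $r^\alpha$ become weighted integrals once the factor $r^2$ is moved into the integrand.\<close>
  have weighted_integral_eq: "set_integrable lborel halfplane (\<lambda>x. fst x powr \<alpha> * f x)
      \<and> (LINT x:halfplane|lborel. fst x powr \<alpha> * f x) = weighted_integral \<alpha> X"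
    if X: "tame X" and eq: "\<And>r z. r > 0 \<Longrightarrow> X r z = r\<^sup>2 * f (r, z)" for X and f :: "real \<times> real \<Rightarrow> real"
  proof -
    have e: "fst x powr \<alpha> * f x = (case x of (r, z) \<Rightarrow> r powr (\<alpha> - 2) * X r z)" if "x \<in> halfplane" for x
      using that by (cases x) (simp add: shift eq mult.assoc)
    have "set_integrable lborel halfplane (\<lambda>x. fst x powr \<alpha> * f x)"
      using tame_set_integrable[OF X \<alpha>] by (subst set_integrable_cong[OF refl refl e])
    moreover have "(LINT x:halfplane|lborel. fst x powr \<alpha> * f x) = weighted_integral \<alpha> X"
      unfolding weighted_integral_def by (rule set_lebesgue_integral_cong) (use e in auto)
    ultimately show ?thesis ..
  qed
  have Z: "integrable (mu \<alpha>) (\<lambda>(r, z). \<bar>F r z s\<bar> powr p) \<and> Z \<alpha> p F s = weighted_integral \<alpha> (\<lambda>r z. r ^ 2 * \<bar>swirl s r z\<bar> powr p)"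
    if s: "s \<in> I" for s
  proof -
    define f where "f = (\<lambda>(r, z). \<bar>swirl s r z\<bar> powr p)"
    have i: "set_integrable lborel halfplane (\<lambda>x. fst x powr \<alpha> * f x)
      \<and> (LINT x:halfplane|lborel. fst x powr \<alpha> * f x) = weighted_integral \<alpha> (\<lambda>r z. r ^ 2 * \<bar>swirl s r z\<bar> powr p)"
      by (rule weighted_integral_eq) (use p s in \<open>auto simp: f_def intro!: tame_power_r tame_abs_powr tame_fields\<close>)
    have ae: "AE x in lebesgue_on halfplane. (case x of (r, z) \<Rightarrow> \<bar>F r z s\<bar> powr p) = f x"
      using on_halfplane by eventually_elim (auto simp: f_def F[OF s])
    show ?thesis using integral_mu_AE[OF conjunct1[OF i] ae] i by (simp add: Z_def)
  qed
  show "integrable (mu \<alpha>) (\<lambda>(r, z). \<bar>F r z t\<bar> powr p)" using Z[OF t] by blast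
  have G: "swirl_rate t r z = r\<^sup>2 * (\<nu> * (swirl_rr t r z + 3 / r * swirl_r t r z + swirl_zz t r z)
      - profile [] 1 t r z * swirl_r t r z - profile [] 3 t r z * swirl_z t r z - 2 * (profile [] 1 t r z / r) * swirl t r z)"
    if "r > 0" for r z
    unfolding swirl_rate_def using that by (simp add: field_simps power2_eq_square)
  note energy = W.energy_identity[OF G]
  have D: "integrable (mu \<alpha>) (\<lambda>x. (norm (grad (\<lambda>r z. H r z t) x))\<^sup>2)
     \<and> (\<integral>x. (norm (grad (\<lambda>r z. H r z t) x))\<^sup>2 \<partial>mu \<alpha>) = p\<^sup>2 / 4 * (LINT x:halfplane|lborel. W.dissipation x)"
  proof -
    define f where "f = (\<lambda>(r, z). p\<^sup>2 / 4 * (\<bar>swirl t r z\<bar> powr (p - 2) * ((swirl_r t r z)\<^sup>2 + (swirl_z t r z)\<^sup>2)))"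
    have e: "(\<lambda>x. fst x powr \<alpha> * f x) = (\<lambda>x. p\<^sup>2 / 4 * W.dissipation x)"
      by (auto simp: f_def W.dissipation_def)
    have i: "set_integrable lborel halfplane (\<lambda>x. fst x powr \<alpha> * f x)"
      unfolding e using energy(1) by (rule set_integrable_mult_right)
    have ae: "AE x in lebesgue_on halfplane. (norm (grad (\<lambda>r z. H r z t) x))\<^sup>2 = f x"
      using AE_not_degenerate[OF t]
      by eventually_elim (auto simp: f_def H_gradient(2))
    show ?thesis using integral_mu_AE[OF i ae] unfolding e by simp
  qed
  then show "integrable (mu \<alpha>) (\<lambda>x. (norm (grad (\<lambda>r z. H r z t) x))\<^sup>2)" by blast
  have E: "integrable (lebesgue_on halfplane) (\<lambda>(r, z). (H r z t)\<^sup>2 * r powr (\<alpha> - 2))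
     \<and> (\<integral>(r, z). (H r z t)\<^sup>2 * r powr (\<alpha> - 2) \<partial>lebesgue_on halfplane) = weighted_integral \<alpha> (\<lambda>r z. \<bar>swirl t r z\<bar> powr p)"
  proof -
    have tm: "tame (\<lambda>r z. \<bar>swirl t r z\<bar> powr p)" using p by (intro tame_abs_powr tame_fields t)
    have ae: "AE x in lebesgue_on halfplane. (case x of (r, z) \<Rightarrow> (H r z t)\<^sup>2 * r powr (\<alpha> - 2))
        = (case x of (r, z) \<Rightarrow> r powr (\<alpha> - 2) * \<bar>swirl t r z\<bar> powr p)"
      using on_halfplane
    proof eventually_elim
      case (elim x)
      have "(\<bar>a\<bar> powr (p / 2))\<^sup>2 = \<bar>a\<bar> powr p" for a :: real
        unfolding power2_eq_square powr_add[symmetric] by simp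
      then show ?case using elim by (cases x) (simp add: H_eq F[OF t])
    qed
    show ?thesis
      using integral_lebesgue_on_halfplane_AE[OF tame_set_integrable[OF tm \<alpha>] ae] by (simp add: weighted_integral_def)
  qed
  then show "integrable (lebesgue_on halfplane) (\<lambda>(r, z). (H r z t)\<^sup>2 * r powr (\<alpha> - 2))" by blast
  have S: "integrable (mu \<alpha>) (\<lambda>(r, z). U r z t * \<bar>F r z t\<bar> powr p)
     \<and> (\<integral>(r, z). U r z t * \<bar>F r z t\<bar> powr p \<partial>mu \<alpha>) = weighted_integral \<alpha> (\<lambda>r z. r * (profile [] 1 t r z * \<bar>swirl t r z\<bar> powr p))"
  proof -
    define f where "f = (\<lambda>(r, z). profile [] 1 t r z / r * \<bar>swirl t r z\<bar> powr p)"
    have tm: "tame (\<lambda>r z. r * (profile [] 1 t r z * \<bar>swirl t r z\<bar> powr p))"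
      using p by (intro tame_mult_r tame_mult tame_abs_powr tame_fields t)
    have i: "set_integrable lborel halfplane (\<lambda>x. fst x powr \<alpha> * f x)
      \<and> (LINT x:halfplane|lborel. fst x powr \<alpha> * f x) = weighted_integral \<alpha> (\<lambda>r z. r * (profile [] 1 t r z * \<bar>swirl t r z\<bar> powr p))"
      by (rule weighted_integral_eq[OF tm]) (simp add: f_def power2_eq_square)
    have ae: "AE x in lebesgue_on halfplane. (case x of (r, z) \<Rightarrow> U r z t * \<bar>F r z t\<bar> powr p) = f x"
      using on_halfplane by eventually_elim (auto simp: f_def F[OF t] U)
    show ?thesis using integral_mu_AE[OF conjunct1[OF i] ae] i by simp
  qed
  then show "integrable (mu \<alpha>) (\<lambda>(r, z). U r z t * \<bar>F r z t\<bar> powr p)" by blast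
  have "(Z \<alpha> p F has_real_derivative p * weighted_integral \<alpha> (\<lambda>r z. sgn_powr (p - 1) (swirl t r z) * swirl_rate t r z)) (at t)"
    by (rule has_field_derivative_transform_within_open[OF weighted_integral_powr_has_derivative[OF t p \<alpha>] \<open>open I\<close> t])
      (use Z in auto)
  then have dZ: "deriv (Z \<alpha> p F) t = p * weighted_integral \<alpha> (\<lambda>r z. sgn_powr (p - 1) (swirl t r z) * swirl_rate t r z)"
    and diffZ: "Z \<alpha> p F differentiable (at t)"
    by (auto intro: DERIV_imp_deriv simp: real_differentiable_def)
  show "Z \<alpha> p F differentiable (at t)" by (rule diffZ)
  have coeffs: "1 / p * (p * w) = w" "\<nu> * (4 * (p - 1) / p\<^sup>2) * (p\<^sup>2 / 4 * w) = \<nu> * (p - 1) * w" for w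
    using p by simp_all
  show "1 / p * deriv (Z \<alpha> p F) t
        + \<nu> * (4 * (p - 1) / p\<^sup>2) * (\<integral>x. (norm (grad (\<lambda>r z. H r z t) x))\<^sup>2 \<partial>mu \<alpha>)
        + \<nu> * ((3 - \<alpha>) * (\<alpha> - 1) / p)
            * (\<integral>(r, z). (H r z t)\<^sup>2 * r powr (\<alpha> - 2) \<partial>lebesgue_on halfplane)
      = (\<alpha> - (2 * p + 1)) / p * (\<integral>(r, z). U r z t * \<bar>F r z t\<bar> powr p \<partial>mu \<alpha>)"
    unfolding dZ conjunct2[OF D] conjunct2[OF E] conjunct2[OF S] coeffs by (rule energy(2))
qed

end
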